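(* Let $k$ be a perfect field of characteristic $p>0$, let $2\le r\le s$ be integers, let $A=k[x_1,\dots,x_r]\,\#\,k[y_1,\dots,y_s]$ be the Segre product, and put $d=r+s-1$. Then $$\mathrm{m}_{\mathrm{HK}}(A)=\frac{r!}{d!}\,S(d,r)+\frac{1}{d!}\sum_{k=1}^{r-1}\sum_{j=1}^{r-k}\binom{r}{k+j}\binom{s}{j}(-1)^{r+k}k^d,$$ where $S(n,k)$ denotes the Stirling number of the second kind (and in the sum $k$ is a summation index). In particular, $$e_{\mathrm{HK}}(A)+\mathrm{m}_{\mathrm{HK}}(A)=\frac{r!\cdot S(d,r)+s!\cdot S(d,s)}{d!}.$$
   Context: With $R=k[x_1,\dots,x_r]$ and $S=k[y_1,\dots,y_s]$ standard graded, the Segre product is the graded subring $A=R\#S=\bigoplus_{n\ge0}R_n\otimes_kS_n$ of $R\otimes_kS$; it has dimension $d=r+s-1$ and graded maximal ideal $\mathfrak M=\bigoplus_{n\ge1}R_n\otimes_kS_n$. The invariants $e_{\mathrm{HK}}(A)$ and $\mathrm{m}_{\mathrm{HK}}(A)$ of this graded ring mean those of the local ring $A_{\mathfrak M}$. $S(n,k)$ is the number of partitions of $\{1,\dots,n\}$ into $k$ (nonempty) blocks. For a Noetherian local ring $(A,\mathfrak m)$ of characteristic $p$ and dimension $d$, with $\ell_A$ denoting length: $e_{\mathrm{HK}}(A)=\lim_{e\to\infty}\ell_A(A/\mathfrak m^{[p^e]})/p^{de}$, where $\mathfrak m^{[q]}$ is the ideal generated by $\{a^q:a\in\mathfrak m\}$.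 Minimal Hilbert-Kunz multiplicity: let ${}^eA$ be $A$ viewed as an $A$-algebra via $a\mapsto a^{p^e}$, and for an $A$-module $M$ let $\mathbf F_A^e(M)={}^eA\otimes_A M$, regarded as an $A$-module by $a'(a\otimes m)=a'a\otimes m$ (so $a'\otimes am=a'a^{p^e}\otimes m$). Let $F_A^e:M\to\mathbf F_A^e(M)$, $x\mapsto 1\otimes x$. Let $E_A=E_A(A/\mathfrak m)$ be the injective hull of the residue field and $z$ a generator of its socle $\{x\in E_A:\mathfrak m x=0\}$. Then $$\mathrm{m}_{\mathrm{HK}}(A)=\liminf_{e\to\infty}\frac{\ell_A\big(A/\operatorname{ann}_A(F_A^e(z))\big)}{p^{ed}}.$$ *)

theory Defs
  imports
    "HOL-Library.Poly_Mapping"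
    "HOL-Library.Extended_Real"
    "HOL-Library.Liminf_Limsup"
    "HOL-Computational_Algebra.Fraction_Field"
    "HOL-Algebra.Module"
    "HOL-Algebra.QuotRing"
    "HOL-Algebra.Free_Abelian_Groups"
    "HOL-Combinatorics.Stirling"
begin

section \<open>Modules over a commutative ring\<close>

definition linear_map ::
    "'a ring \<Rightarrow> ('a, 'b) module \<Rightarrow> ('a, 'c) module \<Rightarrow> ('b \<Rightarrow> 'c) \<Rightarrow> bool" where
  "linear_map A M N f \<longleftrightarrow>
     f \<in> carrier M \<rightarrow> carrier N \<and>
     (\<forall>x\<in>carrier M. \<forall>y\<in>carrier M. f (x \<oplus>\<^bsub>M\<^esub> y) = f x \<oplus>\<^bsub>N\<^esub> f y) \<and>
     (\<forall>a\<in>carrier A. \<forall>x\<in>carrier M. f (a \<odot>\<^bsub>M\<^esub> x) = a \<odot>\<^bsub>N\<^esub> f x)"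

definition module_length :: "'a ring \<Rightarrow> ('a, 'b) module \<Rightarrow> enat" where
  "module_length A M =
     Sup {enat n | n. \<exists>N :: nat \<Rightarrow> 'b set.
       (\<forall>i\<le>n. submodule (N i) A M) \<and> (\<forall>i<n. N i \<subset> N (Suc i))}"

definition quotient_module :: "'a ring \<Rightarrow> 'a set \<Rightarrow> ('a, 'a set) module" where
  "quotient_module A I =
     \<lparr>carrier = carrier (A Quot I), monoid.mult = monoid.mult (A Quot I),
      monoid.one = monoid.one (A Quot I), ring.zero = ring.zero (A Quot I),
      ring.add = ring.add (A Quot I),
      smult = (\<lambda>a U. (I +>\<^bsub>A\<^esub> a) \<otimes>\<^bsub>A Quot I\<^esub> U)\<rparr>"

text \<open>
  A definition in HOL cannot quantify over all types, so the modules \<open>M\<close>, \<open>N\<close> in the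
  lifting property have their elements in the type of the ring elements.  The ideals of
  the ring are among them, so by Baer's criterion this is injectivity with respect to
  all modules.
\<close>

definition injective_module :: "'a ring \<Rightarrow> ('a, 'e) module \<Rightarrow> bool" where
  "injective_module A E \<longleftrightarrow>
     module A E \<and>
     (\<forall>(M :: ('a, 'a) module) (N :: ('a, 'a) module) i f.
        module A M \<and> module A N \<and>
        linear_map A M N i \<and> inj_on i (carrier M) \<and> linear_map A M E f \<longrightarrow>
        (\<exists>g. linear_map A N E g \<and> (\<forall>x\<in>carrier M. g (i x) = f x)))"

definition injective_hull :: "'a ring \<Rightarrow> ('a, 'b) module \<Rightarrow> ('a, 'e) module \<Rightarrow> bool" where
  "injective_hull A M E \<longleftrightarrow>
     injective_module A E \<and>
     (\<exists>\<iota>. linear_map A M E \<iota> \<and> inj_on \<iota> (carrier M) \<and>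
        (\<forall>N. submodule N A E \<and> N \<noteq> {\<zero>\<^bsub>E\<^esub>} \<longrightarrow> N \<inter> \<iota> ` carrier M \<noteq> {\<zero>\<^bsub>E\<^esub>}))"

definition tensor_relations ::
    "'a ring \<Rightarrow> ('a, 'b) module \<Rightarrow> ('a, 'c) module \<Rightarrow> ('b \<times> 'c \<Rightarrow>\<^sub>0 int) set" where
  "tensor_relations A N M =
     {frag_of (x \<oplus>\<^bsub>N\<^esub> y, m) - frag_of (x, m) - frag_of (y, m) | x y m.
        x \<in> carrier N \<and> y \<in> carrier N \<and> m \<in> carrier M} \<union>
     {frag_of (x, m \<oplus>\<^bsub>M\<^esub> n) - frag_of (x, m) - frag_of (x, n) | x m n.
        x \<in> carrier N \<and> m \<in> carrier M \<and> n \<in> carrier M} \<union>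
     {frag_of (a \<odot>\<^bsub>N\<^esub> x, m) - frag_of (x, a \<odot>\<^bsub>M\<^esub> m) | a x m.
        a \<in> carrier A \<and> x \<in> carrier N \<and> m \<in> carrier M}"

abbreviation tensor_free ::
    "('a, 'b) module \<Rightarrow> ('a, 'c) module \<Rightarrow> ('b \<times> 'c \<Rightarrow>\<^sub>0 int) monoid" where
  "tensor_free N M \<equiv> free_Abelian_group (carrier N \<times> carrier M)"

definition tensor_kernel ::
    "'a ring \<Rightarrow> ('a, 'b) module \<Rightarrow> ('a, 'c) module \<Rightarrow> ('b \<times> 'c \<Rightarrow>\<^sub>0 int) set" where
  "tensor_kernel A N M = generate (tensor_free N M) (tensor_relations A N M)"

definition tensor_group ::
    "'a ring \<Rightarrow> ('a, 'b) module \<Rightarrow> ('a, 'c) module \<Rightarrow> ('b \<times> 'c \<Rightarrow>\<^sub>0 int) set monoid" where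
  "tensor_group A N M = tensor_free N M Mod tensor_kernel A N M"

definition pure_tensor ::
    "'a ring \<Rightarrow> ('a, 'b) module \<Rightarrow> ('a, 'c) module \<Rightarrow> 'b \<Rightarrow> 'c \<Rightarrow> ('b \<times> 'c \<Rightarrow>\<^sub>0 int) set" where
  "pure_tensor A N M x m = tensor_kernel A N M #>\<^bsub>tensor_free N M\<^esub> frag_of (x, m)"

section \<open>The Frobenius functor\<close>

definition frobenius_module :: "'a ring \<Rightarrow> nat \<Rightarrow> nat \<Rightarrow> ('a, 'a) module" where
  "frobenius_module A p e =
     \<lparr>carrier = carrier A, monoid.mult = monoid.mult A, monoid.one = monoid.one A,
      ring.zero = ring.zero A, ring.add = ring.add A,
      smult = (\<lambda>a x. (a [^]\<^bsub>A\<^esub> (p ^ e)) \<otimes>\<^bsub>A\<^esub> x)\<rparr>"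

text \<open>
  The tensor product of the Frobenius module with \<open>M\<close>, with the ring acting through
  multiplication on the left factor: \<open>b\<close> sends the class of \<open>x \<otimes> m\<close> to that of
  \<open>(b x) \<otimes> m\<close>.  The cosets in the union below coincide.  The fields \<open>mult\<close> and \<open>one\<close> of
  a module record carry no meaning.
\<close>

definition frobenius_functor ::
    "'a ring \<Rightarrow> nat \<Rightarrow> nat \<Rightarrow> ('a, 'c) module \<Rightarrow> ('a, ('a \<times> 'c \<Rightarrow>\<^sub>0 int) set) module" where
  "frobenius_functor A p e M =
     (let N = frobenius_module A p e; T = tensor_group A N M
      in \<lparr>carrier = carrier T, monoid.mult = undefined, monoid.one = undefined,
          ring.zero = monoid.one T, ring.add = monoid.mult T,
          smult = (\<lambda>b U. \<Union>u\<in>U. tensor_kernel A N M #>\<^bsub>tensor_free N M\<^esub>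
                      frag_extend (\<lambda>(x, m). frag_of (b \<otimes>\<^bsub>A\<^esub> x, m)) u)\<rparr>)"

definition frobenius_map ::
    "'a ring \<Rightarrow> nat \<Rightarrow> nat \<Rightarrow> ('a, 'c) module \<Rightarrow> 'c \<Rightarrow> ('a \<times> 'c \<Rightarrow>\<^sub>0 int) set" where
  "frobenius_map A p e M x = pure_tensor A (frobenius_module A p e) M \<one>\<^bsub>A\<^esub> x"

definition annihilator :: "'a ring \<Rightarrow> ('a, 'b) module \<Rightarrow> 'b \<Rightarrow> 'a set" where
  "annihilator A M x = {a \<in> carrier A. a \<odot>\<^bsub>M\<^esub> x = \<zero>\<^bsub>M\<^esub>}"

section \<open>Hilbert-Kunz invariants of a local ring\<close>

definition krull_dim :: "'a ring \<Rightarrow> enat" where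
  "krull_dim A =
     Sup {enat n | n. \<exists>P :: nat \<Rightarrow> 'a set.
       (\<forall>i\<le>n. primeideal (P i) A) \<and> (\<forall>i<n. P i \<subset> P (Suc i))}"

definition max_ideal :: "'a ring \<Rightarrow> 'a set" where
  "max_ideal A = (THE \<mm>. maximalideal \<mm> A)"

definition frobenius_power :: "'a ring \<Rightarrow> 'a set \<Rightarrow> nat \<Rightarrow> 'a set" where
  "frobenius_power A I q = Idl\<^bsub>A\<^esub> {a [^]\<^bsub>A\<^esub> q | a. a \<in> I}"

definition e_HK :: "nat \<Rightarrow> 'a ring \<Rightarrow> ereal" where
  "e_HK p A =
     lim (\<lambda>e. ereal_of_enat
                 (module_length A (quotient_module A (frobenius_power A (max_ideal A) (p ^ e))))
              / ereal (real p ^ (the_enat (krull_dim A) * e)))"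

definition socle :: "'a ring \<Rightarrow> ('a, 'e) module \<Rightarrow> 'e set" where
  "socle A E = {x \<in> carrier E. \<forall>a\<in>max_ideal A. a \<odot>\<^bsub>E\<^esub> x = \<zero>\<^bsub>E\<^esub>}"

definition socle_generator :: "'a ring \<Rightarrow> ('a, 'e) module \<Rightarrow> 'e \<Rightarrow> bool" where
  "socle_generator A E z \<longleftrightarrow> z \<in> socle A E \<and> socle A E = (\<lambda>a. a \<odot>\<^bsub>E\<^esub> z) ` carrier A"

text \<open>
  \<open>E\<close> is to be an injective hull of the residue field of the local ring and \<open>z\<close> a
  generator of its socle.  An injective hull is determined only up to isomorphism, so it
  is an argument and not chosen.
\<close>

definition m_HK :: "nat \<Rightarrow> 'a ring \<Rightarrow> ('a, 'e) module \<Rightarrow> 'e \<Rightarrow> ereal" where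
  "m_HK p A E z =
     liminf (\<lambda>e. ereal_of_enat
                 (module_length A (quotient_module A
                    (annihilator A (frobenius_functor A p e E) (frobenius_map A p e E z))))
              / ereal (real p ^ (e * the_enat (krull_dim A))))"

section \<open>Segre products of polynomial rings\<close>

text \<open>
  Polynomials with coefficients in \<open>'k\<close> in variables indexed by the natural numbers,
  as finitely supported functions on exponent vectors.
\<close>

type_synonym 'k poly_ring = "(nat \<Rightarrow>\<^sub>0 nat) \<Rightarrow>\<^sub>0 'k"

text \<open>The homogeneous polynomials of degree \<open>n\<close> in the variables from \<open>V\<close>.\<close>

definition homogeneous_part :: "nat set \<Rightarrow> nat \<Rightarrow> 'k::field poly_ring set" where
  "homogeneous_part V n =
     {f. \<forall>t\<in>Poly_Mapping.keys f. Poly_Mapping.keys t \<subseteq> V \<and>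
           (\<Sum>i\<in>Poly_Mapping.keys t. Poly_Mapping.lookup t i) = n}"

text \<open>
  The variables \<open>x\<^sub>1, \<dots>, x\<^sub>r\<close> have the indices \<open>0, \<dots>, r - 1\<close> and \<open>y\<^sub>1, \<dots>, y\<^sub>s\<close> the
  indices \<open>r, \<dots>, r + s - 1\<close>.  The tensor product of the two polynomial rings over the
  field is the polynomial ring in all \<open>r + s\<close> variables, \<open>f \<otimes> g\<close> being the product
  \<open>f * g\<close>; so the tensor product of the parts of degree \<open>n\<close> consists of the finite sums
  of such products.
\<close>

definition segre_part :: "nat \<Rightarrow> nat \<Rightarrow> nat \<Rightarrow> 'k::field poly_ring set" where
  "segre_part r s n =
     {sum_list (map (\<lambda>(f, g). f * g) fgs) | fgs.
        set fgs \<subseteq> homogeneous_part {0..<r} n \<times> homogeneous_part {r..<r + s} n}"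

definition segre_product :: "nat \<Rightarrow> nat \<Rightarrow> 'k::field poly_ring set" where
  "segre_product r s = {\<Sum>n=0..N. h n | h N. \<forall>n. h n \<in> segre_part r s n}"

definition segre_irrelevant_ideal :: "nat \<Rightarrow> nat \<Rightarrow> 'k::field poly_ring set" where
  "segre_irrelevant_ideal r s = {\<Sum>n=1..N. h n | h N. \<forall>n. h n \<in> segre_part r s n}"

text \<open>
  The localization of a subring \<open>A\<close> of an integral domain at a prime ideal \<open>P\<close> of \<open>A\<close>,
  as a subring of the fraction field.
\<close>

definition localization_at :: "'a::idom set \<Rightarrow> 'a set \<Rightarrow> 'a fract ring" where
  "localization_at A P =
     \<lparr>carrier = {Fract a b | a b. a \<in> A \<and> b \<in> A - P},
      monoid.mult = (*), monoid.one = 1, ring.zero = 0, ring.add = (+)\<rparr>"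

definition segre_local_ring :: "nat \<Rightarrow> nat \<Rightarrow> 'k::field poly_ring fract ring" where
  "segre_local_ring r s = localization_at (segre_product r s) (segre_irrelevant_ideal r s)"

text \<open>Perfectness of a field of positive characteristic \<open>p\<close>.\<close>

definition perfect_char :: "'k::field itself \<Rightarrow> nat \<Rightarrow> bool" where
  "perfect_char _ p \<longleftrightarrow> p > 0 \<and> CHAR('k) = p \<and> (\<forall>a::'k. \<exists>b. b ^ p = a)"

end

theory Submission
  imports Defs "HOL-Computational_Algebra.Primes"
begin

text \<open>
  A polynomial in the Segre product is a combination of the monomials \<open>x\<^sup>\<alpha> y\<^sup>\<beta>\<close> with
  \<open>|\<alpha>| = |\<beta>|\<close>, so the ring is the algebra of a monoid \<open>Q\<close> of exponent vectors, localized
  at the polynomials without constant term (\<open>segre_local_ring_eq\<close>). For an ideal generated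
  by monomials the length of the quotient of the localization is the number of vectors of
  \<open>Q\<close> outside the corresponding monoid ideal (\<open>length_loc\<close>). With \<open>q = p ^ e\<close>, both
  invariants become counting problems once two ideals are known to be monomial.

  The Frobenius power of the maximal ideal is generated by the monomials \<open>(x\<^sub>i y\<^sub>j) ^ q\<close>,
  and the vectors it misses are those in which all \<open>x\<close>-exponents or all \<open>y\<close>-exponents are
  below \<open>q\<close> (\<open>frobenius_power_max\<close>, \<open>complement_frob_exps\<close>). The annihilator of \<open>1 \<otimes> z\<close> in
  the Frobenius image of the injective hull consists of the monomials with some exponent
  at least \<open>q\<close> (\<open>ann_socle_eq\<close>). That such a monomial annihilates is seen by writing \<open>z\<close>
  as a multiple \<open>(x\<^bsub>i'\<^esub> y\<^sub>j) w\<close> with \<open>(x\<^sub>i y\<^sub>j) w = 0\<close>, which injectivity permits, and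
  moving \<open>q\<close> units of the exponent from \<open>x\<^sub>i\<close> to \<open>x\<^bsub>i'\<^esub>\<close>. Conversely, if all exponents in
  \<open>x\<^sup>\<alpha> y\<^sup>\<beta>\<close> are below \<open>q\<close>, then the \<open>q\<close>-th root of the coordinate at \<open>x\<^sup>\<alpha> y\<^sup>\<beta>\<close>
  (coordinates over the \<open>q\<close>-th powers, with \<open>k\<close> perfect) is a map \<open>\<phi>\<close> of the ring to
  itself with \<open>\<phi> (b ^ q * a) = b * \<phi> a\<close>, and \<open>a \<otimes> m \<mapsto> \<phi> a m\<close> detects the tensor.

  So the length for \<open>m_HK\<close> counts the vectors of \<open>Q\<close> with all exponents below \<open>q\<close>, and the
  length for \<open>e_HK\<close> counts the union of two sets of which these vectors are the
  intersection; adding the two invariants cancels this term. Complementing the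
  \<open>x\<close>-exponents to \<open>q - 1\<close> turns the equality of degrees into a fixed total degree
  \<open>r * (q - 1)\<close> (\<open>card_balanced\<close>), and inclusion-exclusion over the bounded coordinates
  gives the leading term in \<open>q\<close> (\<open>tendsto_card_bounded_exps\<close>). If only the \<open>x\<close>-exponents
  are bounded, the result is the explicit formula for a Stirling number; if all are, the
  sum of the theorem appears by Vandermonde's identity.

  The exponent in the normalization is the Krull dimension (\<open>krull_dim_segre\<close>). A chain of
  primes generated by variables has length \<open>d\<close>. No chain is longer, because elements
  chosen along a chain of primes have linearly independent monomials
  (\<open>prime_chain_independent\<close>), while the dimension of the space of polynomials of degree
  at most \<open>N\<close> in the Segre product grows only like \<open>N ^ d\<close>.
\<close>

abbreviation keys :: "('a \<Rightarrow>\<^sub>0 'b::zero) \<Rightarrow> 'a set" where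
  "keys \<equiv> Poly_Mapping.keys"

abbreviation lookup :: "('a \<Rightarrow>\<^sub>0 'b::zero) \<Rightarrow> 'a \<Rightarrow> 'b" where
  "lookup \<equiv> Poly_Mapping.lookup"

abbreviation single :: "'a \<Rightarrow> 'b \<Rightarrow> 'a \<Rightarrow>\<^sub>0 'b::zero" where
  "single \<equiv> Poly_Mapping.single"

section \<open>Local rings inside a field\<close>

definition field_subring :: "'f::field set \<Rightarrow> 'f ring" where
  "field_subring B = \<lparr>carrier = B, monoid.mult = (*), monoid.one = 1, ring.zero = 0, ring.add = (+)\<rparr>"

lemma field_subring_simps [simp]:
  "carrier (field_subring B) = B"
  "x \<otimes>\<^bsub>field_subring B\<^esub> y = x * y"
  "\<one>\<^bsub>field_subring B\<^esub> = 1"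
  "\<zero>\<^bsub>field_subring B\<^esub> = 0"
  "x \<oplus>\<^bsub>field_subring B\<^esub> y = x + y"
  by (simp_all add: field_subring_def)

lemma field_subring_pow [simp]: "x [^]\<^bsub>field_subring B\<^esub> (n::nat) = x ^ n"
  by (induction n) (simp_all add: nat_pow_def mult.commute)

text \<open>
  A ring and a module have additive monoids of different record types; whether a set is a
  subgroup depends only on the fields shared by both.
\<close>

lemma subgroup_cong:
  fixes G :: "('a, 'c) monoid_scheme" and G' :: "('a, 'd) monoid_scheme"
  assumes "subgroup H G" "carrier G' = carrier G" "monoid.mult G' = monoid.mult G" "monoid.one G' = monoid.one G"
  shows "subgroup H G'"
  using assms by (simp add: subgroup_def m_inv_def)

text \<open>
  The rings considered here lie in a field of fractions, so the operations are those of
  the field and only the carrier varies. By the last assumption the elements outside \<open>\<mm>\<close>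
  are units, which makes \<open>B\<close> a local ring with maximal ideal \<open>\<mm>\<close>.
\<close>

locale local_subring =
  fixes B \<mm> :: "'f::field set"
  assumes one_in: "1 \<in> B"
    and diff_in: "x \<in> B \<Longrightarrow> y \<in> B \<Longrightarrow> x - y \<in> B"
    and mult_in: "x \<in> B \<Longrightarrow> y \<in> B \<Longrightarrow> x * y \<in> B"
    and mm_subset: "\<mm> \<subseteq> B"
    and zero_mm: "0 \<in> \<mm>"
    and one_notin_mm: "1 \<notin> \<mm>"
    and add_mm: "x \<in> \<mm> \<Longrightarrow> y \<in> \<mm> \<Longrightarrow> x + y \<in> \<mm>"
    and mult_mm: "b \<in> B \<Longrightarrow> x \<in> \<mm> \<Longrightarrow> b * x \<in> \<mm>"
    and inverse_in: "x \<in> B \<Longrightarrow> x \<notin> \<mm> \<Longrightarrow> inverse x \<in> B"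
begin

abbreviation "R \<equiv> field_subring B"

lemma zero_in: "0 \<in> B"
  using diff_in[OF one_in one_in] by simp

lemma uminus_in: "x \<in> B \<Longrightarrow> - x \<in> B"
  using diff_in[OF zero_in] by simp

lemma add_in: "x \<in> B \<Longrightarrow> y \<in> B \<Longrightarrow> x + y \<in> B"
  using diff_in[of x "- y"] uminus_in by simp

lemma power_in: "x \<in> B \<Longrightarrow> x ^ n \<in> B"
  by (induction n) (auto simp: one_in mult_in)

lemma cring_R: "cring R"
proof (rule cringI)
  show "abelian_group R"
    by (rule abelian_groupI) (auto simp: add_in zero_in add.assoc add.commute intro: bexI[of _ "- _"] uminus_in)
  show "Group.comm_monoid R"
    by (rule comm_monoidI) (auto simp: mult_in one_in mult.assoc mult.commute)
qed (auto simp: distrib_right)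

lemma a_inv_R [simp]: "x \<in> B \<Longrightarrow> \<ominus>\<^bsub>R\<^esub> x = - x"
proof -
  assume x: "x \<in> B"
  interpret cring R by (rule cring_R)
  have "- x \<oplus>\<^bsub>R\<^esub> x = \<zero>\<^bsub>R\<^esub>" by simp
  then show ?thesis using x uminus_in by (metis field_subring_simps(1) minus_equality)
qed

text \<open>
  The closure conditions in the operations of the field; by \<open>ideal_iff\<close> below these sets
  are the ideals of the ring \<open>R\<close>.
\<close>

definition is_ideal :: "'f set \<Rightarrow> bool" where
  "is_ideal J \<longleftrightarrow> J \<subseteq> B \<and> 0 \<in> J \<and> (\<forall>x\<in>J. \<forall>y\<in>J. x + y \<in> J) \<and> (\<forall>b\<in>B. \<forall>x\<in>J. b * x \<in> J)"

lemma is_idealD: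
  assumes "is_ideal J"
  shows "J \<subseteq> B" "0 \<in> J" "\<And>x y. x \<in> J \<Longrightarrow> y \<in> J \<Longrightarrow> x + y \<in> J"
    "\<And>b x. b \<in> B \<Longrightarrow> x \<in> J \<Longrightarrow> b * x \<in> J"
    "\<And>x. x \<in> J \<Longrightarrow> - x \<in> J" "\<And>x y. x \<in> J \<Longrightarrow> y \<in> J \<Longrightarrow> x - y \<in> J"
proof -
  show "J \<subseteq> B" "0 \<in> J" and a: "\<And>x y. x \<in> J \<Longrightarrow> y \<in> J \<Longrightarrow> x + y \<in> J"
    and m: "\<And>b x. b \<in> B \<Longrightarrow> x \<in> J \<Longrightarrow> b * x \<in> J"
    using assms by (auto simp: is_ideal_def)
  show u: "- x \<in> J" if "x \<in> J" for x
    using m[OF uminus_in[OF one_in] that] by simp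
  show "x - y \<in> J" if "x \<in> J" "y \<in> J" for x y
    using a[OF that(1) u[OF that(2)]] by simp
qed

lemma ideal_iff: "ideal J R \<longleftrightarrow> is_ideal J"
proof
  assume "ideal J R"
  then interpret ideal J R .
  show "is_ideal J"
    unfolding is_ideal_def
    using a_subset additive_subgroup.zero_closed[OF is_additive_subgroup]
      additive_subgroup.a_closed[OF is_additive_subgroup] I_l_closed by auto
next
  assume J: "is_ideal J"
  interpret cring R by (rule cring_R)
  note J = is_idealD[OF J]
  show "ideal J R"
  proof (rule idealI)
    show "subgroup J (add_monoid R)"
    proof (rule add.subgroupI)
      show "\<And>a. a \<in> J \<Longrightarrow> \<ominus>\<^bsub>R\<^esub> a \<in> J" using J by (metis a_inv_R subsetD)
    qed (use J in auto)
  next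
    fix a x assume "a \<in> J" "x \<in> carrier R"
    then show "x \<otimes>\<^bsub>R\<^esub> a \<in> J" "a \<otimes>\<^bsub>R\<^esub> x \<in> J"
      using J(4)[of x a] by (simp_all add: mult.commute[of a x])
  qed (rule ring_axioms)
qed

lemma is_ideal_mm: "is_ideal \<mm>"
  unfolding is_ideal_def using mm_subset zero_mm add_mm mult_mm by blast

lemma is_ideal_whole: "is_ideal B"
  unfolding is_ideal_def using zero_in add_in mult_in by blast

lemma proper_ideal_le_mm:
  assumes "is_ideal J" "1 \<notin> J"
  shows "J \<subseteq> \<mm>"
proof
  fix x assume x: "x \<in> J"
  show "x \<in> \<mm>"
  proof (rule ccontr)
    assume "x \<notin> \<mm>"
    then have "inverse x * x \<in> J"
      using is_idealD(1,4)[OF assms(1)] x inverse_in[of x] by auto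
    moreover have "x \<noteq> 0" using \<open>x \<notin> \<mm>\<close> zero_mm by auto
    ultimately show False using assms(2) by simp
  qed
qed

lemma max_ideal_R: "max_ideal R = \<mm>"
  unfolding max_ideal_def
proof (rule the_equality)
  show "maximalideal \<mm> R"
  proof (rule maximalidealI)
    show "ideal \<mm> R" by (simp add: ideal_iff is_ideal_mm)
    show "carrier R \<noteq> \<mm>" using one_in one_notin_mm by auto
    fix J assume J: "ideal J R" "\<mm> \<subseteq> J" "J \<subseteq> carrier R"
    show "J = \<mm> \<or> J = carrier R"
    proof (cases "1 \<in> J")
      case True
      have "b \<in> J" if "b \<in> B" for b
        using is_idealD(4)[of J b 1] J(1) that True by (simp add: ideal_iff)
      then have "J = B" using J(3) by auto
      then show ?thesis by simp
    next
      case False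
      then show ?thesis using J proper_ideal_le_mm by (auto simp: ideal_iff)
    qed
  qed
next
  fix J assume "maximalideal J R"
  then interpret maximalideal J R .
  have J: "is_ideal J" using is_ideal ideal_iff by blast
  have "1 \<notin> J" using one_imp_carrier I_notcarr by auto
  then have "J \<subseteq> \<mm>" using J proper_ideal_le_mm by blast
  then show "J = \<mm>"
    using I_maximal[of \<mm>] mm_subset one_in one_notin_mm by (auto simp: ideal_iff is_ideal_mm)
qed

subsection \<open>Lengths\<close>

lemma quotient_module_simps:
  "carrier (quotient_module A I) = carrier (A Quot I)"
  "ring.add (quotient_module A I) = ring.add (A Quot I)"
  "ring.zero (quotient_module A I) = ring.zero (A Quot I)"
  by (simp_all add: quotient_module_def)

lemma quotient_coset_eq:
  assumes I: "is_ideal I" and x: "x \<in> B" and y: "y \<in> B"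
  shows "I +>\<^bsub>R\<^esub> x = I +>\<^bsub>R\<^esub> y \<longleftrightarrow> x - y \<in> I"
proof -
  have "x \<ominus>\<^bsub>R\<^esub> y \<in> I \<longleftrightarrow> I +>\<^bsub>R\<^esub> x = I +>\<^bsub>R\<^esub> y"
    by (rule ring.quotient_eq_iff_same_a_r_cos[OF cring.axioms(1)[OF cring_R] iffD2[OF ideal_iff I]])
      (simp_all add: x y)
  moreover have "x \<ominus>\<^bsub>R\<^esub> y = x - y" by (simp add: a_minus_def y)
  ultimately show ?thesis by simp
qed

lemma quotient_hom:
  assumes I: "is_ideal I" and x: "x \<in> B" and y: "y \<in> B"
  shows "I +>\<^bsub>R\<^esub> x \<in> carrier (R Quot I)"
    "(I +>\<^bsub>R\<^esub> x) \<oplus>\<^bsub>R Quot I\<^esub> (I +>\<^bsub>R\<^esub> y) = I +>\<^bsub>R\<^esub> (x + y)"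
    "(I +>\<^bsub>R\<^esub> x) \<otimes>\<^bsub>R Quot I\<^esub> (I +>\<^bsub>R\<^esub> y) = I +>\<^bsub>R\<^esub> (x * y)"
    "\<ominus>\<^bsub>R Quot I\<^esub> (I +>\<^bsub>R\<^esub> x) = I +>\<^bsub>R\<^esub> (- x)"
proof -
  interpret h: ring_hom_ring R "R Quot I" "(+>\<^bsub>R\<^esub>) I"
    by (rule ideal.rcos_ring_hom_ring[OF iffD2[OF ideal_iff I]])
  have xy: "x \<in> carrier R" "y \<in> carrier R" using x y by simp_all
  show "I +>\<^bsub>R\<^esub> x \<in> carrier (R Quot I)" by (rule h.hom_closed[OF xy(1)])
  show "(I +>\<^bsub>R\<^esub> x) \<oplus>\<^bsub>R Quot I\<^esub> (I +>\<^bsub>R\<^esub> y) = I +>\<^bsub>R\<^esub> (x + y)"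
    by (rule h.hom_add[OF xy, symmetric, unfolded field_subring_simps])
  show "(I +>\<^bsub>R\<^esub> x) \<otimes>\<^bsub>R Quot I\<^esub> (I +>\<^bsub>R\<^esub> y) = I +>\<^bsub>R\<^esub> (x * y)"
    by (rule h.hom_mult[OF xy, symmetric, unfolded field_subring_simps])
  show "\<ominus>\<^bsub>R Quot I\<^esub> (I +>\<^bsub>R\<^esub> x) = I +>\<^bsub>R\<^esub> (- x)"
    by (rule h.hom_a_inv[OF xy(1), symmetric, unfolded a_inv_R[OF x]])
qed

lemma submodule_preimage:
  assumes I: "is_ideal I" and N: "submodule N R (quotient_module R I)"
  shows "is_ideal {x\<in>B. I +>\<^bsub>R\<^esub> x \<in> N}" "I \<subseteq> {x\<in>B. I +>\<^bsub>R\<^esub> x \<in> N}"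
    "N = (\<lambda>x. I +>\<^bsub>R\<^esub> x) ` {x\<in>B. I +>\<^bsub>R\<^esub> x \<in> N}"
proof -
  interpret ideal I R by (rule iffD2[OF ideal_iff I])
  interpret N: submodule N R "quotient_module R I" by fact
  have zero: "I \<in> N"
    using N.one_closed by (simp add: quotient_module_simps FactRing_def)
  have z: "I +>\<^bsub>R\<^esub> x = I" if "x \<in> I" for x
    using that a_rcos_zero[OF iffD2[OF ideal_iff I]] by simp
  show sub: "I \<subseteq> {x\<in>B. I +>\<^bsub>R\<^esub> x \<in> N}"
    using is_idealD(1)[OF I] z zero by auto
  have add: "I +>\<^bsub>R\<^esub> (x + y) \<in> N"
    if "x \<in> B" "y \<in> B" "I +>\<^bsub>R\<^esub> x \<in> N" "I +>\<^bsub>R\<^esub> y \<in> N" for x y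
    using N.m_closed[OF that(3,4)] a_rcos_sum[of x y] that
    by (simp add: quotient_module_simps FactRing_def)
  have mult: "I +>\<^bsub>R\<^esub> (b * x) \<in> N" if "x \<in> B" "b \<in> B" "I +>\<^bsub>R\<^esub> x \<in> N" for x b
    using N.smult_closed[of b "I +>\<^bsub>R\<^esub> x"] rcoset_mult_add[of b x] that
    by (simp add: quotient_module_def FactRing_def)
  show "is_ideal {x\<in>B. I +>\<^bsub>R\<^esub> x \<in> N}"
    unfolding is_ideal_def
    using sub is_idealD(2)[OF I] add mult by (auto simp: add_in mult_in)
  have "N \<subseteq> carrier (R Quot I)"
    using N.subset by (simp add: quotient_module_simps)
  then show "N = (\<lambda>x. I +>\<^bsub>R\<^esub> x) ` {x\<in>B. I +>\<^bsub>R\<^esub> x \<in> N}"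
    by (auto simp: FactRing_def A_RCOSETS_def')
qed

lemma submodule_image:
  assumes I: "is_ideal I" and J: "is_ideal J"
  shows "submodule ((\<lambda>x. I +>\<^bsub>R\<^esub> x) ` J) R (quotient_module R I)"
proof -
  note JD = is_idealD[OF J]
  note hom = quotient_hom[OF I]
  have ag: "group (add_monoid (R Quot I))"
    using ideal.quotient_is_ring[OF iffD2[OF ideal_iff I]] by (rule abelian_group.a_group[OF ring.is_abelian_group])
  have "subgroup ((\<lambda>x. I +>\<^bsub>R\<^esub> x) ` J) (add_monoid (R Quot I))"
  proof (rule group.subgroupI[OF ag])
    show "(+>\<^bsub>R\<^esub>) I ` J \<subseteq> carrier (add_monoid (R Quot I))" using JD(1) hom(1) by auto
    show "(+>\<^bsub>R\<^esub>) I ` J \<noteq> {}" using JD(2) by auto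
  next
    fix a assume "a \<in> (+>\<^bsub>R\<^esub>) I ` J"
    then obtain x where x: "x \<in> J" "a = I +>\<^bsub>R\<^esub> x" by auto
    then have "\<ominus>\<^bsub>R Quot I\<^esub> a = I +>\<^bsub>R\<^esub> (- x)" using hom(4) JD(1) by auto
    then show "inv\<^bsub>add_monoid (R Quot I)\<^esub> a \<in> (+>\<^bsub>R\<^esub>) I ` J"
      using x JD(5) by (simp add: a_inv_def)
  next
    fix a b assume "a \<in> (+>\<^bsub>R\<^esub>) I ` J" "b \<in> (+>\<^bsub>R\<^esub>) I ` J"
    then obtain x y where xy: "x \<in> J" "a = I +>\<^bsub>R\<^esub> x" "y \<in> J" "b = I +>\<^bsub>R\<^esub> y" by auto
    then have "a \<oplus>\<^bsub>R Quot I\<^esub> b = I +>\<^bsub>R\<^esub> (x + y)" using hom(2) JD(1) by auto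
    then show "a \<otimes>\<^bsub>add_monoid (R Quot I)\<^esub> b \<in> (+>\<^bsub>R\<^esub>) I ` J"
      using xy JD(3) by simp
  qed
  then have sg: "subgroup ((\<lambda>x. I +>\<^bsub>R\<^esub> x) ` J) (add_monoid (quotient_module R I))"
    by (rule subgroup_cong) (simp_all add: quotient_module_def)
  show ?thesis
  proof (intro submodule.intro sg submodule_axioms.intro)
    fix a x assume a: "a \<in> carrier R" "x \<in> (+>\<^bsub>R\<^esub>) I ` J"
    then obtain y where y: "y \<in> J" "x = I +>\<^bsub>R\<^esub> y" by auto
    then have "a \<odot>\<^bsub>quotient_module R I\<^esub> x = I +>\<^bsub>R\<^esub> (a * y)"
      using hom(3) JD(1) a by (auto simp: quotient_module_def)
    then show "a \<odot>\<^bsub>quotient_module R I\<^esub> x \<in> (+>\<^bsub>R\<^esub>) I ` J"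
      using JD(4) a y by simp
  qed
qed

text \<open>
  The ideals \<open>J k\<close> are a composition series: \<open>J (Suc k)\<close> is generated over \<open>J k\<close> by \<open>u k\<close>,
  which is killed by \<open>\<mm>\<close>. For any other ideal \<open>N\<close> consider the set \<open>v N\<close> of levels \<open>k\<close> at
  which \<open>N\<close> has an element of \<open>J (Suc k)\<close> outside \<open>J k\<close>. Among ideals containing \<open>J 0\<close> it
  grows strictly with \<open>N\<close>, so a strict chain has at most as many steps as there are
  levels.
\<close>

lemma module_length_quotient:
  assumes chain: "\<And>k. k \<le> n \<Longrightarrow> is_ideal (J k)" and top: "J n = B"
    and step: "\<And>k. k < n \<Longrightarrow> J k \<subseteq> J (Suc k)"
      "\<And>k x. k < n \<Longrightarrow> x \<in> J (Suc k) \<Longrightarrow> \<exists>b\<in>B. x - b * u k \<in> J k"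
    and u: "\<And>k. k < n \<Longrightarrow> u k \<in> J (Suc k) - J k"
    and mm_u: "\<And>k a. k < n \<Longrightarrow> a \<in> \<mm> \<Longrightarrow> a * u k \<in> J k"
  shows "module_length R (quotient_module R (J 0)) = enat n"
proof -
  define v where "v N = {k. k < n \<and> (\<exists>x\<in>N. x \<in> J (Suc k) - J k)}" for N
  have v_mono: "v N \<subseteq> v N'" if "N \<subseteq> N'" for N N' using that by (auto simp: v_def)
  have v_eq: "N' \<subseteq> N" if N: "is_ideal N" and N': "is_ideal N'" and le: "J 0 \<subseteq> N" "N \<subseteq> N'"
    and v: "v N = v N'" for N N'
  proof -
    \<comment> \<open>An element \<open>x\<close> of \<open>N'\<close> new at level \<open>k\<close> is congruent modulo \<open>J k\<close> to a multiple of
    an element \<open>y\<close> of \<open>N\<close> new at the same level, since the coefficient \<open>b\<close> of \<open>y\<close> at \<open>u k\<close>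
    is a unit.\<close>
    have "N' \<inter> J k \<subseteq> N" if "k \<le> n" for k
      using that
    proof (induction k)
      case 0
      then show ?case using le by auto
    next
      case (Suc k)
      then have k: "k < n" and IH: "N' \<inter> J k \<subseteq> N" by auto
      show ?case
      proof
        fix x assume x: "x \<in> N' \<inter> J (Suc k)"
        show "x \<in> N"
        proof (cases "x \<in> J k")
          case True
          then show ?thesis using x IH by auto
        next
          case False
          then have "k \<in> v N'" using x k by (auto simp: v_def)
          then obtain y where y: "y \<in> N" "y \<in> J (Suc k)" "y \<notin> J k" using v by (auto simp: v_def)
          obtain a where a: "a \<in> B" "x - a * u k \<in> J k" using step(2)[OF k] x by auto
          obtain b where b: "b \<in> B" "y - b * u k \<in> J k" using step(2)[OF k y(2)] by auto
          note Jk = is_idealD[OF chain[of k]]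
          have "b \<notin> \<mm>"
          proof
            assume "b \<in> \<mm>"
            then have "b * u k \<in> J k" using mm_u k by auto
            from Jk(3)[OF _ b(2) this] k have "(y - b * u k) + b * u k \<in> J k" by simp
            then have "y \<in> J k" by simp
            then show False using y by auto
          qed
          then have ib: "inverse b \<in> B" "b \<noteq> 0" using b inverse_in zero_mm by auto
          define c where "c = a * inverse b"
          have c: "c \<in> B" using a ib by (auto simp: c_def mult_in)
          have cb: "c * b = a" using ib by (simp add: c_def)
          have "x - c * y = (x - a * u k) - c * (y - b * u k)"
            using cb by (auto simp: algebra_simps)
          also have "\<dots> \<in> J k"
            by (rule Jk(6)[OF _ a(2) Jk(4)[OF _ c b(2)]]) (use k in auto)
          finally have "x - c * y \<in> J k" .
          moreover have cy: "c * y \<in> N" by (rule is_idealD(4)[OF N c y(1)])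
          moreover have "x - c * y \<in> N'"
            by (rule is_idealD(6)[OF N']) (use x cy le in auto)
          ultimately have "x - c * y \<in> N" using IH by auto
          from is_idealD(3)[OF N this cy] have "(x - c * y) + c * y \<in> N" .
          then show ?thesis by simp
        qed
      qed
    qed
    from this[of n] top is_idealD(1)[OF N'] show ?thesis by auto
  qed
  have I: "is_ideal (J 0)" using chain by simp
  have upper: "m \<le> n" if N: "\<forall>i\<le>m. submodule (N i) R (quotient_module R (J 0))"
    "\<forall>i<m. N i \<subset> N (Suc i)" for m and N :: "nat \<Rightarrow> 'f set set"
  proof -
    define P where "P i = {x\<in>B. J 0 +>\<^bsub>R\<^esub> x \<in> N i}" for i
    have P: "is_ideal (P i)" "J 0 \<subseteq> P i" "N i = (\<lambda>x. J 0 +>\<^bsub>R\<^esub> x) ` P i" if "i \<le> m" for i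
    proof -
      have Ni: "submodule (N i) R (quotient_module R (J 0))" using N(1) that by simp
      show "is_ideal (P i)" "J 0 \<subseteq> P i" "N i = (\<lambda>x. J 0 +>\<^bsub>R\<^esub> x) ` P i"
        unfolding P_def by (rule submodule_preimage[OF I Ni])+
    qed
    have vlt: "v (P i) \<subset> v (P (Suc i))" if "i < m" for i
    proof -
      have le: "P i \<subseteq> P (Suc i)" using N(2) that by (auto simp: P_def)
      have "\<not> P (Suc i) \<subseteq> P i"
      proof
        assume "P (Suc i) \<subseteq> P i"
        then have "N (Suc i) \<subseteq> N i" using P(3)[of i] P(3)[of "Suc i"] that by auto
        then show False using N(2) that by auto
      qed
      then have "v (P i) \<noteq> v (P (Suc i))"
        using v_eq[of "P i" "P (Suc i)"] le P(1)[of i] P(1)[of "Suc i"] P(2)[of i] that by auto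
      then show ?thesis using v_mono[OF le] by auto
    qed
    have "i \<le> m \<Longrightarrow> i \<le> card (v (P i))" for i
    proof (induction i)
      case (Suc i)
      have "finite (v (P (Suc i)))" by (auto simp: v_def)
      then have "card (v (P i)) < card (v (P (Suc i)))" using vlt[of i] Suc.prems by (intro psubset_card_mono) auto
      then show ?case using Suc by simp
    qed simp
    from this[of m] have "m \<le> card (v (P m))" by simp
    also have "\<dots> \<le> card {..<n}" by (rule card_mono) (auto simp: v_def)
    finally show ?thesis by simp
  qed
  have J0: "J 0 \<subseteq> J k" if "k \<le> n" for k
    using that
  proof (induction k)
    case (Suc k)
    then show ?case using step(1)[of k] by auto
  qed simp
  have lower: "\<exists>N :: nat \<Rightarrow> 'f set set. (\<forall>i\<le>n. submodule (N i) R (quotient_module R (J 0))) \<and>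
     (\<forall>i<n. N i \<subset> N (Suc i))"
  proof (rule exI[of _ "\<lambda>i. (\<lambda>x. J 0 +>\<^bsub>R\<^esub> x) ` J i"], intro conjI allI impI)
    fix i assume "i \<le> n"
    then show "submodule ((\<lambda>x. J 0 +>\<^bsub>R\<^esub> x) ` J i) R (quotient_module R (J 0))"
      using submodule_image[OF I] chain by auto
  next
    fix i assume i: "i < n"
    have "J 0 +>\<^bsub>R\<^esub> u i \<notin> (\<lambda>x. J 0 +>\<^bsub>R\<^esub> x) ` J i"
    proof
      assume "J 0 +>\<^bsub>R\<^esub> u i \<in> (\<lambda>x. J 0 +>\<^bsub>R\<^esub> x) ` J i"
      then obtain x where x: "x \<in> J i" "J 0 +>\<^bsub>R\<^esub> u i = J 0 +>\<^bsub>R\<^esub> x" by auto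
      have "u i \<in> B" "x \<in> B" using i x u[of i] is_idealD(1)[OF chain[of "Suc i"]] is_idealD(1)[OF chain[of i]] by auto
      then have "u i - x \<in> J 0" using quotient_coset_eq[OF I] x by auto
      then have "u i - x \<in> J i" using J0[of i] i by auto
      from is_idealD(3)[OF chain[of i] this x(1)] i have "(u i - x) + x \<in> J i" by simp
      then show False using u i by auto
    qed
    then show "(\<lambda>x. J 0 +>\<^bsub>R\<^esub> x) ` J i \<subset> (\<lambda>x. J 0 +>\<^bsub>R\<^esub> x) ` J (Suc i)"
      using step(1)[OF i] u[OF i] by blast
  qed
  show ?thesis
    unfolding module_length_def
  proof (rule antisym)
    show "Sup {enat k |k. \<exists>N :: nat \<Rightarrow> 'f set set. (\<forall>i\<le>k. submodule (N i) R (quotient_module R (J 0))) \<and>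
        (\<forall>i<k. N i \<subset> N (Suc i))} \<le> enat n"
      by (rule Sup_least) (use upper in auto)
    show "enat n \<le> Sup {enat k |k. \<exists>N :: nat \<Rightarrow> 'f set set. (\<forall>i\<le>k. submodule (N i) R (quotient_module R (J 0))) \<and>
        (\<forall>i<k. N i \<subset> N (Suc i))}"
      by (rule Sup_upper) (use lower in auto)
  qed
qed

end

section \<open>Injective modules and the Frobenius functor\<close>

definition field_submodule :: "'f::field set \<Rightarrow> ('f, 'f) module" where
  "field_submodule I = \<lparr>carrier = I, monoid.mult = (*), monoid.one = 1, ring.zero = 0,
     ring.add = (+), smult = (*)\<rparr>"

lemma field_submodule_simps [simp]:
  "carrier (field_submodule I) = I"
  "x \<oplus>\<^bsub>field_submodule I\<^esub> y = x + y"
  "\<zero>\<^bsub>field_submodule I\<^esub> = 0"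
  "x \<odot>\<^bsub>field_submodule I\<^esub> y = x * y"
  by (simp_all add: field_submodule_def)

context local_subring
begin

lemma module_field_submodule:
  assumes I: "is_ideal I"
  shows "module R (field_submodule I)"
proof (rule moduleI)
  note I = is_idealD[OF I]
  show "abelian_group (field_submodule I)"
    by (rule abelian_groupI)
      (auto simp: I add.assoc add.commute intro: bexI[of _ "- _"])
qed (auto simp: is_idealD[OF I] cring_R algebra_simps)

text \<open>
  Modulo \<open>J\<close> the element \<open>u\<close> spans a copy of the residue field. As \<open>z\<close> is killed by \<open>\<mm>\<close>,
  there is a linear map on \<open>J + B u\<close> that vanishes on \<open>J\<close> and sends \<open>u\<close> to \<open>z\<close>; it extends
  to \<open>B\<close> by injectivity, and \<open>w\<close> is the image of \<open>1\<close>.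
\<close>

lemma injective_divide:
  assumes inj: "injective_module R E" and J: "is_ideal J" and uB: "u \<in> B" and uJ: "u \<notin> J"
    and mm_u: "\<And>a. a \<in> \<mm> \<Longrightarrow> a * u \<in> J"
    and z: "z \<in> carrier E" "\<And>a. a \<in> \<mm> \<Longrightarrow> a \<odot>\<^bsub>E\<^esub> z = \<zero>\<^bsub>E\<^esub>"
  shows "\<exists>w\<in>carrier E. u \<odot>\<^bsub>E\<^esub> w = z \<and> (\<forall>x\<in>J. x \<odot>\<^bsub>E\<^esub> w = \<zero>\<^bsub>E\<^esub>)"
proof -
  interpret E: module R E using inj by (simp add: injective_module_def)
  note JD = is_idealD[OF J]
  define I where "I = {y\<in>B. \<exists>b\<in>B. y - b * u \<in> J}"
  define f where "f y = (SOME b. b \<in> B \<and> y - b * u \<in> J) \<odot>\<^bsub>E\<^esub> z" for y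
  have unique: "b \<odot>\<^bsub>E\<^esub> z = c \<odot>\<^bsub>E\<^esub> z"
    if bc: "b \<in> B" "c \<in> B" "y - b * u \<in> J" "y - c * u \<in> J" for b c y
  proof -
    have "(y - c * u) - (y - b * u) \<in> J" by (rule JD(6)) (use that in auto)
    then have "(b - c) * u \<in> J" by (simp add: algebra_simps)
    moreover have "b - c \<in> B" using bc diff_in by auto
    have "b - c \<in> \<mm>"
    proof (rule ccontr)
      assume unit: "b - c \<notin> \<mm>"
      then have "inverse (b - c) * ((b - c) * u) \<in> J"
        using JD(4) inverse_in \<open>b - c \<in> B\<close> \<open>(b - c) * u \<in> J\<close> by auto
      moreover have "b - c \<noteq> 0" using unit zero_mm by auto
      ultimately show False using uJ by (simp add: mult.assoc[symmetric])
    qed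
    then have "(b - c) \<odot>\<^bsub>E\<^esub> z = \<zero>\<^bsub>E\<^esub>" by (rule z)
    moreover have "((b - c) + c) \<odot>\<^bsub>E\<^esub> z = (b - c) \<odot>\<^bsub>E\<^esub> z \<oplus>\<^bsub>E\<^esub> c \<odot>\<^bsub>E\<^esub> z"
      using E.smult_l_distr[of "b - c" c z] \<open>b - c \<in> B\<close> bc z by simp
    ultimately show ?thesis using bc z E.smult_closed[of c z] by simp
  qed
  have f_eq: "f y = b \<odot>\<^bsub>E\<^esub> z" if "b \<in> B" "y - b * u \<in> J" for y b
    unfolding f_def by (rule someI2[of _ b]) (use that unique in blast)+
  have I: "is_ideal I"
    unfolding is_ideal_def
  proof (intro conjI ballI)
    show "0 \<in> I" using JD(2) zero_in by (auto simp: I_def intro!: bexI[of _ 0])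
    fix x y assume xy: "x \<in> I" "y \<in> I"
    then obtain b c where "b \<in> B" "x - b * u \<in> J" "c \<in> B" "y - c * u \<in> J" by (auto simp: I_def)
    then show "x + y \<in> I"
      using xy JD(3)[of "x - b * u" "y - c * u"]
      by (auto simp: I_def add_in algebra_simps intro!: bexI[of _ "b + c"])
  next
    fix a x assume ax: "a \<in> B" "x \<in> I"
    then obtain b where "b \<in> B" "x - b * u \<in> J" by (auto simp: I_def)
    then show "a * x \<in> I"
      using ax JD(4)[of a "x - b * u"]
      by (auto simp: I_def mult_in algebra_simps intro!: bexI[of _ "a * b"])
  qed (auto simp: I_def)
  have f: "linear_map R (field_submodule I) E f"
    unfolding linear_map_def
  proof (intro conjI ballI funcsetI)
    fix x assume "x \<in> carrier (field_submodule I)"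
    then obtain b where "b \<in> B" "x - b * u \<in> J" by (auto simp: I_def)
    then show "f x \<in> carrier E" using f_eq z by simp
  next
    fix x y assume "x \<in> carrier (field_submodule I)" "y \<in> carrier (field_submodule I)"
    then obtain b c where bc: "b \<in> B" "x - b * u \<in> J" "c \<in> B" "y - c * u \<in> J" by (auto simp: I_def)
    then have "(x + y) - (b + c) * u \<in> J" using JD(3)[of "x - b * u" "y - c * u"] by (simp add: algebra_simps)
    then have "f (x + y) = (b + c) \<odot>\<^bsub>E\<^esub> z" using f_eq add_in bc by blast
    then show "f (x \<oplus>\<^bsub>field_submodule I\<^esub> y) = f x \<oplus>\<^bsub>E\<^esub> f y"
      using f_eq bc E.smult_l_distr[of b c z] z by simp
  next
    fix a x assume a: "a \<in> carrier R" and "x \<in> carrier (field_submodule I)"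
    then obtain b where b: "b \<in> B" "x - b * u \<in> J" by (auto simp: I_def)
    then have "a * x - (a * b) * u \<in> J" using JD(4)[of a "x - b * u"] a by (simp add: algebra_simps)
    then have "f (a * x) = (a * b) \<odot>\<^bsub>E\<^esub> z" using f_eq mult_in a b by simp
    then show "f (a \<odot>\<^bsub>field_submodule I\<^esub> x) = a \<odot>\<^bsub>E\<^esub> f x"
      using f_eq b E.smult_assoc1[of a b z] a z by simp
  qed
  have "linear_map R (field_submodule I) (field_submodule B) id"
    using is_idealD(1)[OF I] by (auto simp: linear_map_def)
  then obtain g where g: "linear_map R (field_submodule B) E g" "\<And>x. x \<in> I \<Longrightarrow> g x = f x"
    using inj f module_field_submodule[OF I] module_field_submodule[OF is_ideal_whole]
    unfolding injective_module_def by (metis field_submodule_simps(1) id_apply inj_on_id)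
  have w: "g 1 \<in> carrier E" using g one_in by (auto simp: linear_map_def)
  have g_eq: "x \<odot>\<^bsub>E\<^esub> g 1 = g x" if "x \<in> B" for x
  proof -
    have "\<forall>a\<in>B. \<forall>y\<in>B. g (a * y) = a \<odot>\<^bsub>E\<^esub> g y"
      using g(1) unfolding linear_map_def field_submodule_simps field_subring_simps by (elim conjE)
    from this[rule_format, OF that one_in] show ?thesis by simp
  qed
  have "u \<in> I" using uB JD(2) one_in by (auto simp: I_def intro!: bexI[of _ 1])
  then have "u \<odot>\<^bsub>E\<^esub> g 1 = z"
    using g_eq[OF uB] g(2) f_eq[of 1 u] one_in JD(2) z E.smult_one[of z] by simp
  moreover have "x \<odot>\<^bsub>E\<^esub> g 1 = \<zero>\<^bsub>E\<^esub>" if "x \<in> J" for x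
  proof -
    have "x \<in> B" using that JD by auto
    have "x \<in> I" using that JD zero_in by (auto simp: I_def intro!: bexI[of _ 0])
    then have "x \<odot>\<^bsub>E\<^esub> g 1 = \<zero>\<^bsub>R\<^esub> \<odot>\<^bsub>E\<^esub> z"
      using g_eq \<open>x \<in> B\<close> g(2) f_eq[of 0 x] zero_in that by simp
    then show ?thesis using E.smult_l_null z by simp
  qed
  ultimately show ?thesis using w by blast
qed

end

subsection \<open>The tensor product with the Frobenius module\<close>

lemma keys_frag_of_diff:
  "a \<in> S \<Longrightarrow> b \<in> S \<Longrightarrow> keys (frag_of a - frag_of b) \<subseteq> S"
  "a \<in> S \<Longrightarrow> b \<in> S \<Longrightarrow> c \<in> S \<Longrightarrow> keys (frag_of a - frag_of b - frag_of c) \<subseteq> S"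
proof -
  show *: "a \<in> S \<Longrightarrow> b \<in> S \<Longrightarrow> keys (frag_of a - frag_of b) \<subseteq> S" for a b
    using keys_diff[of "frag_of a" "frag_of b"] by (auto simp: keys_frag_of)
  show "a \<in> S \<Longrightarrow> b \<in> S \<Longrightarrow> c \<in> S \<Longrightarrow> keys (frag_of a - frag_of b - frag_of c) \<subseteq> S"
    using keys_diff[of "frag_of a - frag_of b" "frag_of c"] *[of a b] by (auto simp: keys_frag_of)
qed

locale frobenius_tensor = local_subring B \<mm> + E: module "field_subring B" E
  for B \<mm> :: "'f::field set" and E :: "('f, 'e) module" (structure) +
  fixes p e :: nat
begin

abbreviation "Fe \<equiv> frobenius_module R p e"
abbreviation "K \<equiv> tensor_kernel R Fe E"
abbreviation "T \<equiv> tensor_free Fe E"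

lemma Fe_simps [simp]:
  "carrier Fe = B" "x \<oplus>\<^bsub>Fe\<^esub> y = x + y" "b \<odot>\<^bsub>Fe\<^esub> x = b ^ (p ^ e) * x"
  by (simp_all add: frobenius_module_def)

lemma relations_in_carrier: "tensor_relations R Fe E \<subseteq> carrier T"
proof
  fix h assume "h \<in> tensor_relations R Fe E"
  then consider
      x y m where "h = frag_of (x + y, m) - frag_of (x, m) - frag_of (y, m)"
        "x \<in> B" "y \<in> B" "m \<in> carrier E"
    | x m n where "h = frag_of (x, m \<oplus> n) - frag_of (x, m) - frag_of (x, n)"
        "x \<in> B" "m \<in> carrier E" "n \<in> carrier E"
    | b x m where "h = frag_of (b ^ (p ^ e) * x, m) - frag_of (x, b \<odot> m)"
        "b \<in> B" "x \<in> B" "m \<in> carrier E"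
    by (auto simp: tensor_relations_def)
  then show "h \<in> carrier T"
  proof cases
    case 1
    then show ?thesis using keys_frag_of_diff(2)[of _ "B \<times> carrier E"] by (simp add: add_in)
  next
    case 2
    then show ?thesis using keys_frag_of_diff(2)[of _ "B \<times> carrier E"] by simp
  next
    case 3
    then show ?thesis using keys_frag_of_diff(1)[of _ "B \<times> carrier E"]
      by (simp add: mult_in power_in)
  qed
qed

lemma subgroup_K: "subgroup K T"
  unfolding tensor_kernel_def
  by (rule group.generate_is_subgroup) (use relations_in_carrier in auto)

lemma K_zero: "0 \<in> K" and K_add: "x \<in> K \<Longrightarrow> y \<in> K \<Longrightarrow> x + y \<in> K"
  and K_minus: "x \<in> K \<Longrightarrow> - x \<in> K" and K_carrier: "x \<in> K \<Longrightarrow> keys x \<subseteq> B \<times> carrier E"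
proof -
  interpret subgroup K T by (rule subgroup_K)
  show "0 \<in> K" using one_closed by simp
  show "x \<in> K \<Longrightarrow> y \<in> K \<Longrightarrow> x + y \<in> K" using m_closed by simp
  show c: "keys x \<subseteq> B \<times> carrier E" if "x \<in> K" for x
  proof -
    have "x \<in> carrier T" using subset that by blast
    then show ?thesis by simp
  qed
  show "x \<in> K \<Longrightarrow> - x \<in> K" using m_inv_closed[of x] c[of x] by simp
qed

lemma K_diff: "x \<in> K \<Longrightarrow> y \<in> K \<Longrightarrow> x - y \<in> K"
  using K_add[of x "- y"] K_minus by simp

lemma K_relations:
  "x \<in> B \<Longrightarrow> y \<in> B \<Longrightarrow> m \<in> carrier E \<Longrightarrow> frag_of (x + y, m) - frag_of (x, m) - frag_of (y, m) \<in> K"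
  "x \<in> B \<Longrightarrow> m \<in> carrier E \<Longrightarrow> n \<in> carrier E \<Longrightarrow>
     frag_of (x, m \<oplus> n) - frag_of (x, m) - frag_of (x, n) \<in> K"
  "b \<in> B \<Longrightarrow> x \<in> B \<Longrightarrow> m \<in> carrier E \<Longrightarrow> frag_of (b ^ (p ^ e) * x, m) - frag_of (x, b \<odot> m) \<in> K"
  unfolding tensor_kernel_def tensor_relations_def Fe_simps field_subring_simps
  by (rule generate.incl, blast)+

text \<open>
  Every statement about the kernel below, that it is stable under multiplication or that a
  map vanishes on it, comes down to the three kinds of bilinearity relations.
\<close>

lemma K_induct [consumes 1, case_names zero add1 add2 smult minus add]:
  assumes k: "k \<in> K" and zero: "P 0"
    and add1: "\<And>x y m. x \<in> B \<Longrightarrow> y \<in> B \<Longrightarrow> m \<in> carrier E \<Longrightarrow>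
       P (frag_of (x + y, m) - frag_of (x, m) - frag_of (y, m))"
    and add2: "\<And>x m n. x \<in> B \<Longrightarrow> m \<in> carrier E \<Longrightarrow> n \<in> carrier E \<Longrightarrow>
       P (frag_of (x, m \<oplus> n) - frag_of (x, m) - frag_of (x, n))"
    and smult: "\<And>b x m. b \<in> B \<Longrightarrow> x \<in> B \<Longrightarrow> m \<in> carrier E \<Longrightarrow>
       P (frag_of (b ^ (p ^ e) * x, m) - frag_of (x, b \<odot> m))"
    and minus: "\<And>x. x \<in> K \<Longrightarrow> P x \<Longrightarrow> P (- x)"
    and add: "\<And>x y. x \<in> K \<Longrightarrow> y \<in> K \<Longrightarrow> P x \<Longrightarrow> P y \<Longrightarrow> P (x + y)"
  shows "P k"
proof -
  have rel: "P h \<and> h \<in> K" if "h \<in> tensor_relations R Fe E" for h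
    using that add1 add2 smult K_relations unfolding tensor_relations_def by auto
  have "k \<in> generate T (tensor_relations R Fe E)" using k by (simp add: tensor_kernel_def)
  then have "P k \<and> k \<in> K"
  proof (induction rule: generate.induct)
    case one
    then show ?case using zero K_zero by simp
  next
    case (incl h)
    then show ?case using rel by simp
  next
    case (inv h)
    then have "keys h \<subseteq> B \<times> carrier E" using rel K_carrier by blast
    then show ?case using rel[OF inv] minus K_minus by simp
  next
    case (eng h1 h2)
    then show ?case using add K_add by simp
  qed
  then show ?thesis by simp
qed

text \<open>
  Multiplication on the left tensor factor, before passing to the quotient.
\<close>

definition scale :: "'f \<Rightarrow> ('f \<times> 'e \<Rightarrow>\<^sub>0 int) \<Rightarrow> ('f \<times> 'e \<Rightarrow>\<^sub>0 int)" where
  "scale b = frag_extend (\<lambda>(x, m). frag_of (b * x, m))"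

lemma scale_simps [simp]:
  "scale b (frag_of (x, m)) = frag_of (b * x, m)"
  "scale b (u + v) = scale b u + scale b v"
  "scale b (u - v) = scale b u - scale b v"
  "scale b (- u) = - scale b u"
  "scale b 0 = 0"
  by (simp_all add: scale_def frag_extend_add frag_extend_diff frag_extend_minus)

lemma scale_K:
  assumes b: "b \<in> B" and k: "k \<in> K"
  shows "scale b k \<in> K"
  using k
proof (induction rule: K_induct)
  case (add1 x y m)
  then show ?case using K_relations(1)[of "b * x" "b * y" m] b by (simp add: mult_in distrib_left)
next
  case (add2 x m n)
  then show ?case using K_relations(2)[of "b * x" m n] b by (simp add: mult_in)
next
  case (smult c x m)
  then show ?case using K_relations(3)[of c "b * x" m] b by (simp add: mult_in mult.left_commute)
qed (auto simp: K_zero K_add K_minus)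

text \<open>
  The product with \<open>a\<close> is the union of the cosets of \<open>scale a u\<close>, with \<open>u\<close> in the coset of
  \<open>1 \<otimes> z\<close>; they all agree because \<open>scale a\<close> preserves the kernel.
\<close>

lemma annihilator_iff:
  assumes a: "a \<in> B" and z: "z \<in> carrier E"
  shows "a \<in> annihilator R (frobenius_functor R p e E) (frobenius_map R p e E z)
     \<longleftrightarrow> frag_of (a, z) \<in> K"
proof -
  have coset: "K #>\<^bsub>T\<^esub> x = {k + x | k. k \<in> K}" for x
    by (auto simp: r_coset_def)
  have coset_add: "K #>\<^bsub>T\<^esub> (k + x) = K #>\<^bsub>T\<^esub> x" if "k \<in> K" for k x
    unfolding coset
  proof safe
    fix l assume "l \<in> K"
    then show "\<exists>k'. l + (k + x) = k' + x \<and> k' \<in> K" using K_add[of l k] that by (auto simp: add.assoc[symmetric])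
    show "\<exists>k'. l + x = k' + (k + x) \<and> k' \<in> K"
      using K_diff[OF \<open>l \<in> K\<close> that] by (intro exI[of _ "l - k"]) (auto simp: algebra_simps)
  qed
  have coset_K: "K #>\<^bsub>T\<^esub> x = K \<longleftrightarrow> x \<in> K" for x
  proof
    assume "K #>\<^bsub>T\<^esub> x = K"
    moreover have "0 + x \<in> K #>\<^bsub>T\<^esub> x" unfolding coset using K_zero by blast
    ultimately show "x \<in> K" by simp
  next
    assume "x \<in> K"
    then have "K #>\<^bsub>T\<^esub> x = K #>\<^bsub>T\<^esub> 0" using coset_add[of x 0] by simp
    also have "\<dots> = K" unfolding coset by simp
    finally show "K #>\<^bsub>T\<^esub> x = K" .
  qed
  have "a \<odot>\<^bsub>frobenius_functor R p e E\<^esub> frobenius_map R p e E z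
      = (\<Union>u\<in>K #>\<^bsub>T\<^esub> frag_of (1, z). K #>\<^bsub>T\<^esub> scale a u)"
    by (simp add: frobenius_functor_def frobenius_map_def pure_tensor_def scale_def Let_def)
  also have "\<dots> = (\<Union>u\<in>K #>\<^bsub>T\<^esub> frag_of (1, z). K #>\<^bsub>T\<^esub> frag_of (a, z))"
  proof (rule SUP_cong[OF refl])
    fix u assume "u \<in> K #>\<^bsub>T\<^esub> frag_of (1, z)"
    then obtain k where k: "k \<in> K" "u = k + frag_of (1, z)" unfolding coset by blast
    show "K #>\<^bsub>T\<^esub> scale a u = K #>\<^bsub>T\<^esub> frag_of (a, z)"
      using coset_add[OF scale_K[OF a k(1)], of "frag_of (a, z)"] k(2) by simp
  qed
  also have "\<dots> = K #>\<^bsub>T\<^esub> frag_of (a, z)"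
  proof -
    have "0 + frag_of (1, z) \<in> K #>\<^bsub>T\<^esub> frag_of (1, z)" unfolding coset using K_zero by blast
    then show ?thesis by blast
  qed
  finally have smult: "a \<odot>\<^bsub>frobenius_functor R p e E\<^esub> frobenius_map R p e E z = K #>\<^bsub>T\<^esub> frag_of (a, z)" .
  have "\<zero>\<^bsub>frobenius_functor R p e E\<^esub> = K"
    by (simp add: frobenius_functor_def Let_def tensor_group_def FactGroup_def)
  then show ?thesis
    using a unfolding annihilator_def mem_Collect_eq smult coset_K[symmetric] by simp
qed

definition ann_ideal :: "'e \<Rightarrow> 'f set" where
  "ann_ideal z = {a\<in>B. frag_of (a, z) \<in> K}"

lemma annihilator_eq:
  assumes "z \<in> carrier E"
  shows "annihilator R (frobenius_functor R p e E) (frobenius_map R p e E z) = ann_ideal z"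
  using annihilator_iff[OF _ assms] by (auto simp: ann_ideal_def annihilator_def)

lemma is_ideal_ann_ideal:
  assumes z: "z \<in> carrier E"
  shows "is_ideal (ann_ideal z)"
  unfolding is_ideal_def
proof (intro conjI ballI)
  have "frag_of (0, z) \<in> K"
    using K_minus[OF K_relations(1)[of 0 0 z]] zero_in z by simp
  then show "0 \<in> ann_ideal z" using zero_in by (simp add: ann_ideal_def)
  fix x y assume xy: "x \<in> ann_ideal z" "y \<in> ann_ideal z"
  have "(frag_of (x + y, z) - frag_of (x, z) - frag_of (y, z)) + frag_of (x, z) + frag_of (y, z) \<in> K"
    by (intro K_add K_relations) (use xy z in \<open>auto simp: ann_ideal_def\<close>)
  then show "x + y \<in> ann_ideal z" using xy by (simp add: ann_ideal_def add_in)
next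
  fix b x assume "b \<in> B" "x \<in> ann_ideal z"
  then show "b * x \<in> ann_ideal z" using scale_K[of b "frag_of (x, z)"]
    by (simp add: ann_ideal_def mult_in)
qed (auto simp: ann_ideal_def)

text \<open>
  With \<open>q = p ^ e\<close>, the computation is
  \<open>a \<otimes> z = a \<otimes> b w = a b\<^sup>q \<otimes> w = c b'\<^sup>q \<otimes> w = c \<otimes> b' w = 0\<close>.
\<close>

lemma ann_idealI:
  assumes w: "w \<in> carrier E" and c: "c \<in> B" and b: "b \<in> B" "b' \<in> B"
    and z: "b \<odot> w = z" and null: "b' \<odot> w = \<zero>"
    and a: "a \<in> B" "a * b ^ (p ^ e) = c * b' ^ (p ^ e)"
  shows "a \<in> ann_ideal z"
proof -
  let ?q = "p ^ e"
  have "frag_of (b ^ ?q * a, w) - frag_of (a, z) \<in> K"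
    using K_relations(3)[OF b(1) a(1) w] z by simp
  moreover have "frag_of (b' ^ ?q * c, w) - frag_of (c, \<zero>) \<in> K"
    using K_relations(3)[OF b(2) c w] null by simp
  moreover have c0: "frag_of (c, \<zero>) \<in> K"
    using K_minus[OF K_relations(2)[of c \<zero> \<zero>]] c by simp
  ultimately have "(frag_of (b' ^ ?q * c, w) - frag_of (c, \<zero>)) + frag_of (c, \<zero>)
      - (frag_of (b ^ ?q * a, w) - frag_of (a, z)) \<in> K"
    using K_diff K_add by meson
  then show ?thesis using a by (simp add: ann_ideal_def mult.commute)
qed

text \<open>
  The third property of \<open>\<phi>\<close> makes \<open>x \<otimes> m \<mapsto> \<phi> x m\<close> compatible with the tensor relations, so
  this is a map to \<open>E\<close>. It takes \<open>a \<otimes> z\<close> to the product of \<open>z\<close> with the unit \<open>\<phi> a\<close>.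
\<close>

lemma not_in_ann_ideal:
  assumes z: "z \<in> carrier E" "z \<noteq> \<zero>"
    and phi: "\<And>x. x \<in> B \<Longrightarrow> \<phi> x \<in> B" "\<And>x y. x \<in> B \<Longrightarrow> y \<in> B \<Longrightarrow> \<phi> (x + y) = \<phi> x + \<phi> y"
      "\<And>b x. b \<in> B \<Longrightarrow> x \<in> B \<Longrightarrow> \<phi> (b ^ (p ^ e) * x) = b * \<phi> x"
    and a: "a \<in> B" "\<phi> a \<notin> \<mm>"
  shows "a \<notin> ann_ideal z"
proof
  assume "a \<in> ann_ideal z"
  then have aK: "frag_of (a, z) \<in> K" by (simp add: ann_ideal_def)
  have "(\<lambda>(x, m). \<phi> x \<odot> m) ` (B \<times> carrier E) \<subseteq> carrier (add_monoid E)"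
    using phi(1) by auto
  from comm_group.free_Abelian_group_universal[OF E.a_comm_group this] obtain h
    where h: "h \<in> hom T (add_monoid E)"
      and hf': "\<And>x. x \<in> B \<times> carrier E \<Longrightarrow> h (frag_of x) = (\<lambda>(x, m). \<phi> x \<odot> m) x"
    unfolding Fe_simps by blast
  have hf: "h (frag_of (x, m)) = \<phi> x \<odot> m" if "x \<in> B" "m \<in> carrier E" for x m
    using hf'[of "(x, m)"] that by simp
  interpret h: group_hom T "add_monoid E" h
    by (intro group_hom.intro group_hom_axioms.intro h group_free_Abelian_group E.a_group)
  have hadd: "h (x + y) = h x \<oplus> h y" if "keys x \<subseteq> B \<times> carrier E" "keys y \<subseteq> B \<times> carrier E" for x y
    using h.hom_mult[of x y] that by simp
  have hminus: "h (- x) = \<ominus> h x" if "keys x \<subseteq> B \<times> carrier E" for x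
    using h.hom_inv[of x] that by (simp add: a_inv_def)
  have hdiff: "h (x - y) = h x \<ominus> h y" if "keys x \<subseteq> B \<times> carrier E" "keys y \<subseteq> B \<times> carrier E" for x y
    using hadd[of x "- y"] hminus[of y] that by (simp add: a_minus_def)
  have cancel: "(x \<oplus> y) \<ominus> x \<ominus> y = \<zero>" if "x \<in> carrier E" "y \<in> carrier E" for x y
  proof -
    have "(x \<oplus> y) \<ominus> x \<ominus> y = (x \<oplus> y) \<oplus> (\<ominus> x \<oplus> \<ominus> y)"
      using that by (simp add: a_minus_def E.a_assoc)
    also have "\<dots> = \<zero>" using that E.r_neg[of "x \<oplus> y"] by (simp add: E.minus_add)
    finally show ?thesis .
  qed
  have ker: "h k = \<zero>" if "k \<in> K" for k
    using that
  proof (induction rule: K_induct)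
    case zero
    then show ?case using h.hom_one by simp
  next
    case (add1 x y m)
    have "\<phi> x \<odot> m \<in> carrier E" "\<phi> y \<odot> m \<in> carrier E" using add1 phi(1) by auto
    moreover have "h (frag_of (x + y, m) - frag_of (x, m) - frag_of (y, m))
       = (\<phi> x \<odot> m \<oplus> \<phi> y \<odot> m) \<ominus> \<phi> x \<odot> m \<ominus> \<phi> y \<odot> m"
      using add1 E.smult_l_distr[of "\<phi> x" "\<phi> y" m] phi
      by (simp add: hdiff hf keys_frag_of_diff keys_frag_of add_in)
    ultimately show ?case using cancel by simp
  next
    case (add2 x m n)
    have "\<phi> x \<odot> m \<in> carrier E" "\<phi> x \<odot> n \<in> carrier E" using add2 phi(1) by auto
    moreover have "h (frag_of (x, m \<oplus> n) - frag_of (x, m) - frag_of (x, n))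
       = (\<phi> x \<odot> m \<oplus> \<phi> x \<odot> n) \<ominus> \<phi> x \<odot> m \<ominus> \<phi> x \<odot> n"
      using add2 E.smult_r_distr[of "\<phi> x" m n] phi
      by (simp add: hdiff hf keys_frag_of_diff keys_frag_of add_in)
    ultimately show ?case using cancel by simp
  next
    case (smult b x m)
    have "\<phi> x \<odot> (b \<odot> m) = (b * \<phi> x) \<odot> m"
      using E.smult_assoc1[of "\<phi> x" b m] smult phi(1) by (simp add: mult.commute)
    then show ?case
      using smult phi by (simp add: hdiff hf keys_frag_of_diff keys_frag_of mult_in power_in a_minus_def E.r_neg)
  next
    case (minus x)
    then show ?case using hminus[of x] K_carrier[of x] by simp
  next
    case (add x y)
    then show ?case using hadd[of x y] K_carrier by simp
  qed
  have "\<phi> a \<odot> z = \<zero>" using ker[OF aK] hf a z by simp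
  then have "(inverse (\<phi> a) * \<phi> a) \<odot> z = \<zero>"
    using E.smult_assoc1[of "inverse (\<phi> a)" "\<phi> a" z] inverse_in[of "\<phi> a"] phi(1) a z E.smult_r_null by simp
  moreover have "\<phi> a \<noteq> 0" using a zero_mm by auto
  ultimately show False using z E.smult_one[of z] by simp
qed

end

section \<open>Localized monoid algebras\<close>

type_synonym expv = "nat \<Rightarrow>\<^sub>0 nat"

lemma lookup_single_mult:
  fixes t w :: "'m::cancel_comm_monoid_add" and g :: "'m \<Rightarrow>\<^sub>0 'k::comm_semiring_1"
  shows "lookup (single t c * g) (t + w) = c * lookup g w"
    and "(\<And>w. k \<noteq> t + w) \<Longrightarrow> lookup (single t c * g) k = 0"
proof -
  have *: "lookup (single t c * g) k
      = c * (\<Sum>q. lookup g q when k = t + q)" for k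
    by (simp add: lookup_mult lookup_single when_mult)
  show "lookup (single t c * g) (t + w) = c * lookup g w"
    by (simp add: *)
  show "(\<And>w. k \<noteq> t + w) \<Longrightarrow> lookup (single t c * g) k = 0"
    by (simp add: *)
qed

lemma expv_add_eq_0 [simp]: "s + t = 0 \<longleftrightarrow> s = 0 \<and> t = (0 :: expv)"
  by (auto simp: poly_mapping_eq_iff fun_eq_iff lookup_add)

lemma lookup_mult_zero:
  fixes f g :: "'k::field poly_ring"
  shows "lookup (f * g) 0 = lookup f 0 * lookup g 0"
proof -
  define f' where "f' = f - single 0 (lookup f 0)"
  have f: "f = single 0 (lookup f 0) + f'" by (simp add: f'_def)
  have "0 \<notin> keys f'" by (simp add: in_keys_iff f'_def lookup_minus)
  then have "0 \<notin> keys (f' * g)" using keys_mult[of f' g] by auto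
  then have "lookup (f' * g) 0 = 0" by (simp add: in_keys_iff)
  moreover have "lookup (single 0 (lookup f 0) * g) (0 + 0)
     = lookup f 0 * lookup g 0"
    by (rule lookup_single_mult)
  moreover have "f * g = single 0 (lookup f 0) * g + f' * g"
    by (subst f) (simp add: distrib_right)
  ultimately show ?thesis by (simp add: lookup_add)
qed

lemma keys_add_expv: "keys (t + u :: expv) = keys t \<union> keys u"
  by (auto simp: in_keys_iff lookup_add)

definition expv_deg :: "expv \<Rightarrow> nat" where
  "expv_deg t = (\<Sum>i\<in>keys t. lookup t i)"

lemma expv_deg_add: "expv_deg (s + t) = expv_deg s + expv_deg t"
  unfolding expv_deg_def by (rule setsum_keys_plus_distrib) auto

lemma expv_deg_pos: "t \<noteq> 0 \<Longrightarrow> expv_deg t > 0"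
  unfolding expv_deg_def by (rule sum_pos) (auto simp: in_keys_iff)

locale affine_monoid =
  fixes Q :: "expv set"
  assumes zero_Q: "0 \<in> Q" and add_Q: "s \<in> Q \<Longrightarrow> t \<in> Q \<Longrightarrow> s + t \<in> Q"
begin

text \<open>
  The fractions whose numerators are spanned by the monomials in \<open>S\<close>. For \<open>S = Q\<close> this is
  the localized monoid algebra, for \<open>S = Q - {0}\<close> its maximal ideal, and for a monoid
  ideal \<open>S\<close> the ideal generated by the monomials in \<open>S\<close>.
\<close>

definition loc :: "expv set \<Rightarrow> 'k::field poly_ring fract set" where
  "loc S = {Fract f g | f g. keys f \<subseteq> S \<and> keys g \<subseteq> Q \<and> lookup g 0 \<noteq> 0}"

definition monoid_ideal :: "expv set \<Rightarrow> bool" where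
  "monoid_ideal S \<longleftrightarrow> S \<subseteq> Q \<and> (\<forall>s\<in>S. \<forall>t\<in>Q. s + t \<in> S)"

definition monom_fract :: "expv \<Rightarrow> 'k::field poly_ring fract" where
  "monom_fract u = Fract (single u 1) 1"

lemma denominator_nonzero: "lookup g 0 \<noteq> 0 \<Longrightarrow> g \<noteq> 0"
  by auto

lemma locI:
  "keys f \<subseteq> S \<Longrightarrow> keys g \<subseteq> Q \<Longrightarrow> lookup g 0 \<noteq> 0 \<Longrightarrow> Fract f g \<in> loc S"
  by (auto simp: loc_def)

lemma locE:
  assumes "x \<in> loc S"
  obtains f g where "x = Fract f g" "keys f \<subseteq> S" "keys g \<subseteq> Q"
    "lookup g 0 \<noteq> 0" "g \<noteq> 0"
  using assms denominator_nonzero unfolding loc_def by blast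

lemma loc_subset: "S \<subseteq> S' \<Longrightarrow> loc S \<subseteq> loc S'"
  by (auto simp: loc_def)

lemma keys_mult_monoid_ideal:
  fixes f g :: "'k::field poly_ring"
  assumes "monoid_ideal S" "keys f \<subseteq> S" "keys g \<subseteq> Q"
  shows "keys (f * g) \<subseteq> S" "keys (g * f) \<subseteq> S"
proof -
  show "keys (f * g) \<subseteq> S"
    using keys_mult[of f g] assms unfolding monoid_ideal_def by blast
  then show "keys (g * f) \<subseteq> S" by (simp add: mult.commute)
qed

lemma monoid_ideal_Q: "monoid_ideal Q"
  by (auto simp: monoid_ideal_def add_Q)

lemma monoid_ideal_max: "monoid_ideal (Q - {0})"
  by (auto simp: monoid_ideal_def add_Q)

lemma keys_mult_Q:
  fixes f g :: "'k::field poly_ring"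
  shows "keys f \<subseteq> Q \<Longrightarrow> keys g \<subseteq> Q \<Longrightarrow> keys (f * g) \<subseteq> Q"
  by (rule keys_mult_monoid_ideal[OF monoid_ideal_Q])

lemma keys_power_Q:
  fixes f :: "'k::field poly_ring"
  shows "keys f \<subseteq> Q \<Longrightarrow> keys (f ^ n) \<subseteq> Q"
  by (induction n) (auto simp: zero_Q keys_mult_Q)

lemma lookup_power_zero:
  "lookup (f ^ n :: 'k::field poly_ring) 0 = lookup f 0 ^ n"
  by (induction n) (auto simp: lookup_mult_zero)

lemma fract_diff_in_loc:
  assumes S: "monoid_ideal S" and xy: "x \<in> loc S" "y \<in> loc S"
  shows "x - y \<in> loc S"
proof -
  obtain f g where x: "x = Fract f g" and f: "keys f \<subseteq> S" and g: "keys g \<subseteq> Q"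
    "lookup g 0 \<noteq> 0" "g \<noteq> 0" by (rule locE[OF xy(1)])
  obtain f' g' where y: "y = Fract f' g'" and f': "keys f' \<subseteq> S" and g': "keys g' \<subseteq> Q"
    "lookup g' 0 \<noteq> 0" "g' \<noteq> 0" by (rule locE[OF xy(2)])
  have "x - y = Fract (f * g' - f' * g) (g * g')" using x y g g' by simp
  moreover have "keys (f * g' - f' * g) \<subseteq> S"
  proof -
    have "lookup (f * g' - f' * g) k = 0" if "k \<notin> S" for k
    proof -
      have "k \<notin> keys (f * g')" "k \<notin> keys (f' * g)"
        using keys_mult_monoid_ideal(1)[OF S f g'(1)] keys_mult_monoid_ideal(1)[OF S f' g(1)] that by blast+
      then show ?thesis by (simp add: in_keys_iff lookup_minus)
    qed
    then show ?thesis by (auto simp: in_keys_iff)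
  qed
  ultimately show ?thesis
    using keys_mult_Q[OF g(1) g'(1)] g(2) g'(2) by (auto intro!: locI simp: lookup_mult_zero)
qed

lemma fract_mult_in_loc:
  assumes S: "monoid_ideal S" and xy: "x \<in> loc Q" "y \<in> loc S"
  shows "x * y \<in> loc S"
proof -
  obtain f g where x: "x = Fract f g" and f: "keys f \<subseteq> Q" and g: "keys g \<subseteq> Q"
    "lookup g 0 \<noteq> 0" "g \<noteq> 0" by (rule locE[OF xy(1)])
  obtain f' g' where y: "y = Fract f' g'" and f': "keys f' \<subseteq> S" and g': "keys g' \<subseteq> Q"
    "lookup g' 0 \<noteq> 0" "g' \<noteq> 0" by (rule locE[OF xy(2)])
  have "x * y = Fract (f * f') (g * g')" using x y by simp
  then show ?thesis
    using keys_mult_Q[OF g(1) g'(1)] keys_mult_monoid_ideal(2)[OF S f' f] g(2) g'(2)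
    by (auto intro!: locI simp: lookup_mult_zero)
qed

lemma zero_loc: "0 \<in> loc S"
  unfolding Zero_fract_def by (rule locI) (use zero_Q in auto)

lemma monom_fract_in_loc: "u \<in> S \<Longrightarrow> monom_fract u \<in> loc S"
  unfolding monom_fract_def by (rule locI) (use zero_Q in auto)

text \<open>
  If the monomial equals \<open>f / g\<close>, then its exponent \<open>u\<close> has in \<open>f\<close> the constant term of
  \<open>g\<close> as coefficient, and this is not zero.
\<close>

lemma monom_fract_in_loc_iff: "(monom_fract u :: 'k::field poly_ring fract) \<in> loc S \<longleftrightarrow> u \<in> S"
proof
  assume "(monom_fract u :: 'k poly_ring fract) \<in> loc S"
  then obtain f g :: "'k poly_ring" where "monom_fract u = Fract f g" and f: "keys f \<subseteq> S"
    and g: "lookup g 0 \<noteq> 0" "g \<noteq> 0" by (elim locE)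
  then have "single u 1 * g = f" by (simp add: monom_fract_def eq_fract)
  then have "lookup f u = lookup g 0"
    using lookup_single_mult(1)[of u 1 g 0] by simp
  then show "u \<in> S" using f g by (auto simp: in_keys_iff)
qed (rule monom_fract_in_loc)

sublocale LR: local_subring "loc Q :: 'k::field poly_ring fract set" "loc (Q - {0})"
proof
  show "1 \<in> loc Q" unfolding One_fract_def by (rule locI) (use zero_Q in auto)
  show "x - y \<in> loc Q" if "x \<in> loc Q" "y \<in> loc Q" for x y :: "'k poly_ring fract"
    using that by (rule fract_diff_in_loc[OF monoid_ideal_Q])
  show "x * y \<in> loc Q" if "x \<in> loc Q" "y \<in> loc Q" for x y :: "'k poly_ring fract"
    using that by (rule fract_mult_in_loc[OF monoid_ideal_Q])
  show "loc (Q - {0}) \<subseteq> loc Q" by (rule loc_subset) auto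
  show "0 \<in> loc (Q - {0})" by (rule zero_loc)
  show "1 \<notin> loc (Q - {0})"
    using monom_fract_in_loc_iff[of 0 "Q - {0}"] by (simp add: monom_fract_def One_fract_def)
  show "b * x \<in> loc (Q - {0})" if "b \<in> loc Q" "x \<in> loc (Q - {0})" for b x :: "'k poly_ring fract"
    using that by (rule fract_mult_in_loc[OF monoid_ideal_max])
  show "x + y \<in> loc (Q - {0})" if "x \<in> loc (Q - {0})" "y \<in> loc (Q - {0})" for x y :: "'k poly_ring fract"
    using fract_diff_in_loc[OF monoid_ideal_max that(1) fract_diff_in_loc[OF monoid_ideal_max zero_loc that(2)]] by simp
  show "inverse x \<in> loc Q" if xQ: "x \<in> loc Q" and xM: "x \<notin> loc (Q - {0})" for x :: "'k poly_ring fract"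
  proof -
    obtain f g where x: "x = Fract f g" and f: "keys f \<subseteq> Q" and g: "keys g \<subseteq> Q"
      "lookup g 0 \<noteq> 0" "g \<noteq> 0" by (rule locE[OF xQ])
    have "lookup f 0 \<noteq> 0"
    proof
      assume "lookup f 0 = 0"
      then have "keys f \<subseteq> Q - {0}" using f by (auto simp: in_keys_iff)
      then show False using locI[OF _ g(1,2)] x xM by blast
    qed
    then show ?thesis using x f g by (auto intro!: locI)
  qed
qed

lemma is_ideal_loc:
  assumes "monoid_ideal S"
  shows "LR.is_ideal (loc S :: 'k::field poly_ring fract set)"
  unfolding LR.is_ideal_def
proof (intro conjI ballI)
  show "loc S \<subseteq> loc Q" using assms by (intro loc_subset) (auto simp: monoid_ideal_def)
  fix x y :: "'k poly_ring fract" assume "x \<in> loc S" "y \<in> loc S"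
  then show "x + y \<in> loc S"
    using fract_diff_in_loc[OF assms _ fract_diff_in_loc[OF assms zero_loc], of x y] by simp
qed (use fract_mult_in_loc[OF assms] zero_loc in auto)

text \<open>
  This lemma and the next show that enlarging \<open>S\<close> by one exponent \<open>u\<close> enlarges the ideal
  by a module generated by one element and killed by the maximal ideal.
\<close>

lemma loc_insert:
  assumes "x \<in> loc (insert u S)"
  shows "\<exists>b\<in>loc Q. x - b * monom_fract u \<in> loc S"
proof -
  obtain f g where x: "x = Fract f g" and f: "keys f \<subseteq> insert u S" and g: "keys g \<subseteq> Q"
    "lookup g 0 \<noteq> 0" "g \<noteq> 0" by (rule locE[OF assms])
  define c where "c = lookup f u"
  define f' where "f' = f - single u c"
  have keys: "keys f' \<subseteq> S"
  proof
    fix t assume t: "t \<in> keys f'"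
    have "t \<noteq> u" using t by (auto simp: f'_def c_def in_keys_iff lookup_minus)
    then have "t \<in> keys f" using t by (auto simp: f'_def in_keys_iff lookup_minus lookup_single_not_eq)
    then show "t \<in> S" using f \<open>t \<noteq> u\<close> by auto
  qed
  have "single 0 c * single u 1 = single u c"
    by (simp add: mult_single)
  then have "x - Fract (single 0 c) g * monom_fract u = Fract f' g"
    using g(3) by (simp add: x monom_fract_def f'_def eq_fract algebra_simps)
  moreover have "Fract (single 0 c) g \<in> loc Q"
    by (rule locI) (use g zero_Q in auto)
  ultimately show ?thesis using locI[OF keys g(1,2)] by metis
qed

lemma max_times_monom:
  assumes S: "monoid_ideal (insert u S)" and a: "a \<in> loc (Q - {0})" and u: "u \<in> Q"
  shows "a * monom_fract u \<in> loc S"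
proof -
  obtain f g where x: "a = Fract f g" and f: "keys f \<subseteq> Q - {0}" and g: "keys g \<subseteq> Q"
    "lookup g 0 \<noteq> 0" "g \<noteq> 0" by (rule locE[OF a])
  have "a * monom_fract u = Fract (f * single u 1) g" by (simp add: x monom_fract_def)
  moreover have "keys (f * single u 1) \<subseteq> S"
  proof
    fix t assume "t \<in> keys (f * single u 1)"
    then obtain b where b: "t = b + u" "b \<in> keys f"
      using keys_mult[of f "single u 1"] by auto
    then have "u + b \<in> insert u S" "b \<noteq> 0" using S f by (auto simp: monoid_ideal_def)
    then show "t \<in> S" using b by (auto simp: add.commute)
  qed
  ultimately show ?thesis using locI g by metis
qed

text \<open>
  The missing exponents are added in the order of decreasing degree. Adding a nonzero
  element of \<open>Q\<close> raises the degree, so every intermediate set is a monoid ideal, and the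
  steps form a composition series.
\<close>

lemma length_loc:
  assumes S: "monoid_ideal S" and fin: "finite (Q - S)"
  shows "module_length LR.R (quotient_module LR.R (loc S :: 'k::field poly_ring fract set)) = enat (card (Q - S))"
proof -
  obtain ys where ys: "set ys = Q - S" "distinct ys" using finite_distinct_list[OF fin] by auto
  define xs where "xs = sort_key (\<lambda>t. - int (expv_deg t)) ys"
  have xs: "set xs = Q - S" "distinct xs" using ys by (auto simp: xs_def)
  have sorted: "expv_deg (xs ! j) \<ge> expv_deg (xs ! i)" if "j \<le> i" "i < length xs" for i j
    using sorted_nth_mono[OF sorted_sort_key[of "\<lambda>t. - int (expv_deg t)" ys], of j i] that
    by (simp add: xs_def)
  define U where "U k = S \<union> set (take k xs)" for k
  have up: "monoid_ideal (U k)" for k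
    unfolding monoid_ideal_def
  proof (intro conjI ballI)
    show "U k \<subseteq> Q" using S xs set_take_subset[of k xs] by (auto simp: U_def monoid_ideal_def)
    fix s t assume s: "s \<in> U k" and t: "t \<in> Q"
    show "s + t \<in> U k"
    proof (cases "s \<in> S \<or> s + t \<in> S \<or> t = 0")
      case True
      then show ?thesis using S s t by (auto simp: U_def monoid_ideal_def)
    next
      case False
      then obtain j where j: "j < k" "j < length xs" "s = xs ! j"
        using s by (auto simp: U_def in_set_conv_nth)
      have "s \<in> Q - S" using xs j nth_mem by blast
      then have "s + t \<in> set xs" using False xs t add_Q by auto
      then obtain i where i: "i < length xs" "s + t = xs ! i" by (metis in_set_conv_nth)
      have "\<not> j \<le> i"
        using sorted[of j i] i j expv_deg_add[of s t] expv_deg_pos[of t] False by auto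
      then have "i < k" using j by simp
      then show ?thesis using i by (auto simp: U_def in_set_conv_nth intro!: exI[of _ i])
    qed
  qed
  have U_Suc: "U (Suc k) = insert (xs ! k) (U k)" "xs ! k \<notin> U k" "xs ! k \<in> Q" if "k < length xs" for k
  proof -
    show "U (Suc k) = insert (xs ! k) (U k)" using that by (simp add: U_def take_Suc_conv_app_nth)
    have "xs ! k \<in> set xs" using that by simp
    moreover have "xs ! k \<notin> set (take k xs)"
      using xs(2) that by (auto simp: in_set_conv_nth nth_eq_iff_index_eq)
    ultimately show "xs ! k \<notin> U k" "xs ! k \<in> Q" using xs by (auto simp: U_def)
  qed
  have "module_length LR.R (quotient_module LR.R (loc (U 0) :: 'k poly_ring fract set)) = enat (length xs)"
  proof (rule LR.module_length_quotient[where J = "\<lambda>k. loc (U k)" and u = "\<lambda>k. monom_fract (xs ! k)"])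
    show "LR.is_ideal (loc (U k) :: 'k poly_ring fract set)" for k by (rule is_ideal_loc[OF up])
    show "loc (U (length xs)) = loc Q"
      using S xs by (auto simp: U_def monoid_ideal_def intro!: arg_cong[where f=loc])
    show "loc (U k) \<subseteq> loc (U (Suc k))" if "k < length xs" for k
      by (rule loc_subset) (use U_Suc[OF that] in auto)
    show "\<exists>b\<in>loc Q. x - b * monom_fract (xs ! k) \<in> loc (U k)"
      if "k < length xs" "x \<in> loc (U (Suc k))" for k and x :: "'k poly_ring fract"
      using loc_insert that U_Suc by simp
    show "monom_fract (xs ! k) \<in> loc (U (Suc k)) - loc (U k)" if "k < length xs" for k
      using U_Suc[OF that] by (simp add: monom_fract_in_loc_iff)
    show "a * monom_fract (xs ! k) \<in> loc (U k)"
      if "k < length xs" "a \<in> loc (Q - {0})" for k and a :: "'k poly_ring fract"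
      using max_times_monom[of "xs ! k" "U k" a] up[of "Suc k"] U_Suc[OF that(1)] that by simp
  qed
  then show ?thesis using xs distinct_card[of xs] by (simp add: U_def)
qed

end

section \<open>Frobenius roots of polynomials\<close>

lemma poly_mapping_eq_sum_single:
  "f = (\<Sum>t\<in>keys f. single t (lookup f t))"
proof (rule poly_mapping_eqI)
  fix k
  show "lookup f k =
    lookup (\<Sum>t\<in>keys f. single t (lookup f t)) k"
    by (simp add: lookup_sum lookup_single when_def in_keys_iff)
qed

definition expv_scale :: "nat \<Rightarrow> expv \<Rightarrow> expv" where
  "expv_scale n t = Poly_Mapping.map ((*) n) t"

lemma lookup_expv_scale [simp]: "lookup (expv_scale n t) i = n * lookup t i"
  by (simp add: expv_scale_def Poly_Mapping.map.rep_eq when_def)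

lemma expv_scale_add: "expv_scale n (s + t) = expv_scale n s + expv_scale n t"
  by (rule poly_mapping_eqI) (simp add: lookup_add algebra_simps)

lemma expv_scale_zero [simp]: "expv_scale 0 t = 0" "expv_scale n 0 = 0"
  by (rule poly_mapping_eqI, simp)+

lemma expv_scale_Suc: "expv_scale (Suc n) t = t + expv_scale n t"
  by (rule poly_mapping_eqI) (simp add: lookup_add)

lemma single_power:
  "single t c ^ n = single (expv_scale n t) (c ^ n :: 'k::field)"
  by (induction n) (simp_all add: mult_single expv_scale_Suc single_one)

lemma CHAR_poly_ring: "CHAR('k::field poly_ring) = CHAR('k)"
proof (rule CHAR_eqI)
  have "(of_nat CHAR('k) :: 'k poly_ring) = single 0 (of_nat CHAR('k))"
    by (simp add: of_nat_single)
  then show "of_nat CHAR('k) = (0 :: 'k poly_ring)" by simp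
  fix n assume "of_nat n = (0 :: 'k poly_ring)"
  then have "lookup (of_nat n :: 'k poly_ring) 0 = 0" by simp
  then have "(of_nat n :: 'k) = 0" by (simp add: lookup_of_nat)
  then show "CHAR('k) dvd n" by (simp add: of_nat_eq_0_iff_char_dvd)
qed

lemma perfect_char_prime:
  assumes "perfect_char TYPE('k::field) p"
  shows "prime p" "CHAR('k) = p" "CHAR('k poly_ring) = p"
  using assms prime_CHAR_semidom[where 'a = 'k] by (auto simp: perfect_char_def CHAR_poly_ring)

lemma poly_power_eq_sum:
  fixes f :: "'k::field poly_ring"
  assumes "perfect_char TYPE('k) p"
  shows "f ^ (p ^ e) = (\<Sum>t\<in>keys f.
     single (expv_scale (p ^ e) t) (lookup f t ^ (p ^ e)))"
proof -
  have "f ^ (p ^ e) = (\<Sum>t\<in>keys f. single t (lookup f t)) ^ (p ^ e)"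
    by (subst (1) poly_mapping_eq_sum_single) simp
  also have "\<dots> = (\<Sum>t\<in>keys f. single t (lookup f t) ^ (p ^ e))"
    by (rule freshmans_dream_sum'[of _ e]) (use perfect_char_prime[OF assms] in simp_all)
  finally show ?thesis by (simp add: single_power)
qed

definition frob_root :: "nat \<Rightarrow> 'k::field \<Rightarrow> 'k" where
  "frob_root q c = (SOME b. b ^ q = c)"

locale perfect_frobenius =
  fixes p e :: nat and K :: "'k::field itself"
  assumes perfect: "perfect_char TYPE('k) p"
begin

abbreviation "q \<equiv> p ^ e"

lemma q_pos: "q > 0"
  using perfect_char_prime(1)[OF perfect] by (simp add: prime_gt_0_nat)

lemma power_q_add: "(x + y :: 'k) ^ q = x ^ q + y ^ q"
  by (rule freshmans_dream'[of _ e]) (use perfect_char_prime[OF perfect] in simp_all)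

lemma power_q_inj: "x ^ q = y ^ q \<Longrightarrow> x = (y :: 'k)"
proof -
  assume eq: "x ^ q = y ^ q"
  have "((x - y) + y) ^ q = (x - y) ^ q + y ^ q" by (rule power_q_add)
  then have "(x - y) ^ q = 0" using eq by simp
  then show "x = y" by simp
qed

lemma frob_root_power [simp]: "frob_root q c ^ q = (c :: 'k)"
proof -
  have "\<exists>b. b ^ (p ^ n) = (c :: 'k)" for n c
  proof (induction n arbitrary: c)
    case (Suc n)
    obtain b where "b ^ p = c" using perfect by (auto simp: perfect_char_def)
    moreover obtain a where "a ^ (p ^ n) = b" using Suc by blast
    ultimately have "(a ^ (p ^ n)) ^ p = c" by simp
    then show ?case by (auto simp: power_mult[symmetric] mult.commute)
  qed auto
  then show ?thesis unfolding frob_root_def by (rule someI_ex)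
qed

lemma frob_root_simps [simp]:
  "frob_root q (x + y) = frob_root q x + frob_root q (y :: 'k)"
  "frob_root q (c ^ q * x) = c * frob_root q (x :: 'k)"
  "frob_root q (0 :: 'k) = 0"
  "frob_root q x = 0 \<longleftrightarrow> x = (0 :: 'k)"
proof -
  show "frob_root q (x + y) = frob_root q x + frob_root q y"
    by (rule power_q_inj) (simp add: power_q_add)
  show "frob_root q (c ^ q * x) = c * frob_root q x"
    by (rule power_q_inj) (simp add: power_mult_distrib)
  show z: "frob_root q (0 :: 'k) = 0"
    using frob_root_power[of 0] q_pos by (simp del: frob_root_power)
  show "frob_root q x = 0 \<longleftrightarrow> x = 0"
    using frob_root_power[of x] z q_pos by (cases "x = 0") (auto simp: zero_power simp del: frob_root_power)
qed

text \<open>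
  If all entries of \<open>a\<close> are below \<open>q\<close>, the monomial with exponent \<open>a\<close> belongs to a basis
  of the polynomial ring over its \<open>q\<close>-th powers, and this is the \<open>q\<close>-th root of the
  coordinate at that basis element.
\<close>

definition poly_root :: "expv \<Rightarrow> 'k poly_ring \<Rightarrow> 'k poly_ring" where
  "poly_root a f = Poly_Mapping.map (frob_root q) (Poly_Mapping.map_key (\<lambda>w. a + expv_scale q w) f)"

lemma inj_expv_scale: "inj (\<lambda>w. a + expv_scale q w)"
proof (rule injI)
  fix v w :: expv assume "a + expv_scale q v = a + expv_scale q w"
  then have "expv_scale q v = expv_scale q w" by simp
  then have "q * lookup v i = q * lookup w i" for i
    by (metis lookup_expv_scale)
  then have "lookup v i = lookup w i" for i
    using nat_mult_eq_cancel1[OF q_pos] by blast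
  then show "v = w" by (rule poly_mapping_eqI)
qed

lemma lookup_poly_root:
  "lookup (poly_root a f) w = frob_root q (lookup f (a + expv_scale q w))"
  by (simp add: poly_root_def Poly_Mapping.map.rep_eq map_key.rep_eq[OF inj_expv_scale] when_def)

lemma poly_root_add: "poly_root a (f + g) = poly_root a f + poly_root a g"
  by (rule poly_mapping_eqI) (simp add: lookup_poly_root lookup_add)

lemma poly_root_zero: "poly_root a 0 = 0"
  by (rule poly_mapping_eqI) (simp add: lookup_poly_root)

lemma poly_root_sum: "poly_root a (sum f I) = (\<Sum>i\<in>I. poly_root a (f i))"
  by (induction I rule: infinite_finite_induct) (simp_all add: poly_root_zero poly_root_add)

lemma poly_root_single_mult:
  assumes a: "\<And>i. lookup a i < q"
  shows "poly_root a (single (expv_scale q t) (c ^ q) * f) = single t c * poly_root a f"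
proof (rule poly_mapping_eqI)
  fix w
  show "lookup (poly_root a (single (expv_scale q t) (c ^ q) * f)) w
      = lookup (single t c * poly_root a f) w"
  proof (cases "\<exists>v. w = t + v")
    case True
    then obtain v where v: "w = t + v" by auto
    have "a + expv_scale q w = expv_scale q t + (a + expv_scale q v)"
      by (simp add: v expv_scale_add add_ac)
    then show ?thesis
      by (simp add: lookup_poly_root lookup_single_mult(1)) (simp add: v lookup_single_mult(1) lookup_poly_root)
  next
    case False
    have "a + expv_scale q w \<noteq> expv_scale q t + v" for v
    proof
      assume eq: "a + expv_scale q w = expv_scale q t + v"
      have "lookup t i \<le> lookup w i" for i
      proof -
        have "lookup a i + q * lookup w i = q * lookup t i + lookup v i"
          using arg_cong[OF eq, of "\<lambda>x. lookup x i"] by (simp add: lookup_add)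
        then have "q * lookup t i < q * (lookup w i + 1)"
          using a[of i] by (simp add: algebra_simps)
        then show ?thesis using q_pos by (simp only: mult_less_cancel1) simp
      qed
      then have "w = t + (w - t)"
        by (intro poly_mapping_eqI) (simp add: lookup_add lookup_minus)
      then show False using False by blast
    qed
    then show ?thesis using False by (simp add: lookup_poly_root lookup_single_mult(2))
  qed
qed

text \<open>
  By the identity \<open>(f + g) ^ q = f ^ q + g ^ q\<close> of characteristic \<open>p\<close>, it suffices to
  multiply by the \<open>q\<close>-th power of a single term.
\<close>

lemma poly_root_power_mult:
  assumes a: "\<And>i. lookup a i < q"
  shows "poly_root a (g ^ q * f) = g * poly_root a f"
proof -
  have "poly_root a (g ^ q * f) = (\<Sum>t\<in>keys g.
      single t (lookup g t) * poly_root a f)"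
    by (simp add: poly_power_eq_sum[OF perfect] sum_distrib_right poly_root_sum poly_root_single_mult[OF a])
  also have "\<dots> = g * poly_root a f"
    by (subst (3) poly_mapping_eq_sum_single) (simp add: sum_distrib_right)
  finally show ?thesis .
qed

text \<open>
  The extension to fractions forced by \<open>f / g = f g\<^sup>q\<^sup>-\<^sup>1 / g\<^sup>q\<close>; \<open>fract_root_Fract\<close> shows
  that the choice of the representative does not matter.
\<close>

definition fract_root :: "expv \<Rightarrow> 'k poly_ring fract \<Rightarrow> 'k poly_ring fract" where
  "fract_root a x = (SOME y. \<exists>f g. g \<noteq> 0 \<and> x = Fract f g \<and> y = Fract (poly_root a (f * g ^ (q - 1))) g)"

lemma fract_root_Fract:
  assumes a: "\<And>i. lookup a i < q" and g: "g \<noteq> 0"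
  shows "fract_root a (Fract f g) = Fract (poly_root a (f * g ^ (q - 1))) g"
proof -
  have "y = Fract (poly_root a (f * g ^ (q - 1))) g"
    if y: "g' \<noteq> 0" "Fract f g = Fract f' g'" "y = Fract (poly_root a (f' * g' ^ (q - 1))) g'" for y f' g'
  proof -
    have eq: "f * g' = f' * g" using y g by (simp add: eq_fract)
    have pw: "h ^ q = h * h ^ (q - 1)" for h :: "'k poly_ring"
      using q_pos by (metis power_eq_if less_not_refl2)
    have "g' * poly_root a (f * g ^ (q - 1)) = poly_root a (g' ^ q * (f * g ^ (q - 1)))"
      by (rule poly_root_power_mult[OF a, symmetric])
    also have "g' ^ q * (f * g ^ (q - 1)) = (f * g') * (g' ^ (q - 1) * g ^ (q - 1))"
      by (simp only: pw[of g']) (simp only: mult_ac)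
    also have "\<dots> = g ^ q * (f' * g' ^ (q - 1))"
      unfolding eq by (simp only: pw[of g]) (simp only: mult_ac)
    also have "poly_root a \<dots> = g * poly_root a (f' * g' ^ (q - 1))"
      by (rule poly_root_power_mult[OF a])
    finally show ?thesis using y g by (simp add: eq_fract mult.commute)
  qed
  then show ?thesis
    unfolding fract_root_def using g by (intro some_equality) blast+
qed

lemma fract_root_add:
  assumes a: "\<And>i. lookup a i < q"
  shows "fract_root a (x + y) = fract_root a x + fract_root a y"
proof -
  obtain f g where x: "x = Fract f g" "g \<noteq> 0" by (cases x) auto
  obtain f' g' where y: "y = Fract f' g'" "g' \<noteq> 0" by (cases y) auto
  define h where "h = g * g'"
  have h: "h \<noteq> 0" using x y by (simp add: h_def)
  have x': "x = Fract (f * g') h" and y': "y = Fract (f' * g) h"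
    using x y by (simp_all add: h_def eq_fract)
  have add: "Fract u h + Fract v h = Fract (u + v) h" for u v
    using h by (simp add: eq_fract algebra_simps)
  show ?thesis
    unfolding x' y' add using h
    by (simp add: fract_root_Fract[OF a] add distrib_right poly_root_add)
qed

lemma fract_root_power_mult:
  assumes a: "\<And>i. lookup a i < q"
  shows "fract_root a (b ^ q * x) = b * fract_root a x"
proof -
  obtain f g where x: "x = Fract f g" "g \<noteq> 0" by (cases x) auto
  obtain h k where b: "b = Fract h k" "k \<noteq> 0" by (cases b) auto
  have pw: "b ^ n = Fract (h ^ n) (k ^ n)" for n
    by (induction n) (simp_all add: b One_fract_def)
  have *: "h ^ q * f * (k ^ q * g) ^ (q - 1) = h ^ q * ((k ^ (q - 1)) ^ q * (f * g ^ (q - 1)))"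
    by (simp add: power_mult_distrib power_mult[symmetric] mult_ac)
  have kq: "k ^ q = k * k ^ (q - 1)" using q_pos by (metis power_eq_if less_not_refl2)
  have "b ^ q * x = Fract (h ^ q * f) (k ^ q * g)" unfolding pw x(1) by simp
  then have "fract_root a (b ^ q * x) = Fract (poly_root a (h ^ q * f * (k ^ q * g) ^ (q - 1))) (k ^ q * g)"
    using x(2) b(2) fract_root_Fract[OF a, of "k ^ q * g"] by simp
  also have "poly_root a (h ^ q * f * (k ^ q * g) ^ (q - 1)) = h * (k ^ (q - 1) * poly_root a (f * g ^ (q - 1)))"
    unfolding * poly_root_power_mult[OF a] ..
  also have "Fract \<dots> (k ^ q * g) = Fract h k * Fract (poly_root a (f * g ^ (q - 1))) g"
    using x(2) b(2) unfolding kq by (simp add: eq_fract)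
  also have "\<dots> = b * fract_root a x"
    unfolding b(1) x(1) fract_root_Fract[OF a x(2)] ..
  finally show ?thesis .
qed

end

section \<open>Segre products as monoid algebras\<close>

context affine_monoid
begin

lemma localization_eq:
  "localization_at {f :: 'k::field poly_ring. keys f \<subseteq> Q}
     {f. keys f \<subseteq> Q \<and> lookup f 0 = 0} = field_subring (loc Q)"
proof -
  have "{Fract a b | a b. a \<in> {f :: 'k poly_ring. keys f \<subseteq> Q} \<and>
      b \<in> {f. keys f \<subseteq> Q} - {f. keys f \<subseteq> Q \<and> lookup f 0 = 0}} = loc Q"
    by (auto simp: loc_def)
  then show ?thesis by (simp add: localization_at_def field_subring_def)
qed

text \<open>
  Numerators are finite sums of terms, and coefficients and inverses of denominators lie
  in the local ring.
\<close>

lemma loc_le_ideal: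
  fixes J :: "'k::field poly_ring fract set"
  assumes J: "LR.is_ideal J" and S: "\<And>t. t \<in> S \<Longrightarrow> monom_fract t \<in> J"
  shows "loc S \<subseteq> J"
proof
  fix x :: "'k poly_ring fract" assume "x \<in> loc S"
  then obtain f g :: "'k poly_ring" where x: "x = Fract f g" and f: "keys f \<subseteq> S"
    and g: "keys g \<subseteq> Q" "lookup g 0 \<noteq> 0" "g \<noteq> 0" by (rule locE)
  have single: "Fract (single t c) 1 \<in> J" if "t \<in> S" for t and c :: 'k
  proof -
    have "Fract (single 0 c) 1 * monom_fract t \<in> J"
      by (intro LR.is_idealD(4)[OF J] S that locI) (use zero_Q in auto)
    then show ?thesis by (simp add: monom_fract_def mult_single)
  qed
  have "Fract (\<Sum>t\<in>T. single t (c t)) 1 \<in> J" if "finite T" "T \<subseteq> S" for T and c :: "expv \<Rightarrow> 'k"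
    using that
  proof (induction T)
    case empty
    then show ?case using LR.is_idealD(2)[OF J] by (simp add: Zero_fract_def)
  next
    case (insert t T)
    then have "Fract (single t (c t)) 1 + Fract (\<Sum>t\<in>T. single t (c t)) 1 \<in> J"
      by (intro LR.is_idealD(3)[OF J] single) auto
    then show ?case using insert by simp
  qed
  from this[OF _ f, of "lookup f"] have "Fract f 1 \<in> J"
    using poly_mapping_eq_sum_single[of f] by simp
  moreover have "Fract 1 g \<in> loc Q" by (rule locI) (use g zero_Q in auto)
  ultimately have "Fract 1 g * Fract f 1 \<in> J" by (intro LR.is_idealD(4)[OF J])
  then show "x \<in> J" by (simp add: x)
qed

lemma monom_fract_add: "monom_fract (s + t) = monom_fract s * monom_fract t"
  by (simp add: monom_fract_def mult_single)

lemma monom_fract_power: "monom_fract t ^ n = monom_fract (expv_scale n t)"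
  by (induction n) (simp_all add: expv_scale_Suc monom_fract_add, simp add: monom_fract_def One_fract_def)

end

definition deg_on :: "nat set \<Rightarrow> expv \<Rightarrow> nat" where
  "deg_on V t = (\<Sum>i\<in>V. lookup t i)"

lemma deg_on_add: "deg_on V (s + t) = deg_on V s + deg_on V t"
  by (simp add: deg_on_def lookup_add sum.distrib)

lemma deg_on_zero [simp]: "deg_on V 0 = 0"
  by (simp add: deg_on_def)

lemma deg_on_scale: "deg_on V (expv_scale n t) = n * deg_on V t"
  by (simp add: deg_on_def sum_distrib_left)

lemma deg_on_single: "finite V \<Longrightarrow> deg_on V (single i n) = (if i \<in> V then n else 0)"
  by (simp add: deg_on_def lookup_single when_def)

lemma deg_on_disjoint: "keys t \<inter> V = {} \<Longrightarrow> deg_on V t = 0"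
  unfolding deg_on_def by (rule sum.neutral) (auto simp: in_keys_iff)

lemma deg_on_keys:
  assumes "finite V" "keys t \<subseteq> V"
  shows "(\<Sum>i\<in>keys t. lookup t i) = deg_on V t"
  unfolding deg_on_def using assms by (intro sum.mono_neutral_left) (auto simp: in_keys_iff)

definition segre_monoid :: "nat \<Rightarrow> nat \<Rightarrow> expv set" where
  "segre_monoid r s = {t. keys t \<subseteq> {0..<r + s} \<and> deg_on {0..<r} t = deg_on {r..<r + s} t}"

lemma affine_monoid_segre: "affine_monoid (segre_monoid r s)"
proof
  fix t u assume "t \<in> segre_monoid r s" "u \<in> segre_monoid r s"
  then show "t + u \<in> segre_monoid r s"
    using keys_add[of t u] by (auto simp: segre_monoid_def deg_on_add)
qed (simp add: segre_monoid_def)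

definition expv_restrict :: "nat set \<Rightarrow> expv \<Rightarrow> expv" where
  "expv_restrict V t = Poly_Mapping.mapp (\<lambda>i n. if i \<in> V then n else 0) t"

lemma lookup_expv_restrict: "lookup (expv_restrict V t) i = (if i \<in> V then lookup t i else 0)"
  by (simp add: expv_restrict_def lookup_mapp when_def in_keys_iff)

lemma keys_expv_restrict: "keys (expv_restrict V t) = keys t \<inter> V"
  by (auto simp: in_keys_iff lookup_expv_restrict split: if_splits)

lemma keys_sum_list_subset:
  "(\<And>f. f \<in> set fs \<Longrightarrow> keys f \<subseteq> S) \<Longrightarrow> keys (sum_list fs) \<subseteq> S"
proof (induction fs)
  case (Cons f fs)
  then show ?case using keys_add[of f "sum_list fs"] by auto
qed simp

lemma keys_sum_subset:
  "(\<And>i. i \<in> I \<Longrightarrow> keys (f i) \<subseteq> S) \<Longrightarrow> keys (sum f I) \<subseteq> S"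
proof (induction I rule: infinite_finite_induct)
  case (insert i I)
  then show ?case using keys_add[of "f i" "sum f I"] by auto
qed auto

text \<open>
  A balanced monomial is the product of its part in the \<open>x\<close>-variables and its part in the
  \<open>y\<close>-variables, which have the same degree.
\<close>

lemma segre_part_eq:
  "(segre_part r s n :: 'k::field poly_ring set) =
     {f. keys f \<subseteq> {t \<in> segre_monoid r s. deg_on {0..<r} t = n}}"
proof (intro equalityI subsetI)
  fix h :: "'k poly_ring"
  assume "h \<in> segre_part r s n"
  then obtain fgs where h: "h = sum_list (map (\<lambda>(f, g). f * g) fgs)"
    and fgs: "set fgs \<subseteq> homogeneous_part {0..<r} n \<times> homogeneous_part {r..<r + s} n"
    unfolding segre_part_def by blast
  have "keys (f * g) \<subseteq> {t \<in> segre_monoid r s. deg_on {0..<r} t = n}"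
    if fg: "(f, g) \<in> set fgs" for f g
  proof
    fix t assume "t \<in> keys (f * g)"
    then obtain a b where t: "t = a + b" "a \<in> keys f" "b \<in> keys g"
      using keys_mult[of f g] by blast
    have fg': "f \<in> homogeneous_part {0..<r} n" "g \<in> homogeneous_part {r..<r + s} n"
      using fgs fg by auto
    have a: "keys a \<subseteq> {0..<r}" "deg_on {0..<r} a = n"
      using fg'(1) t(2) deg_on_keys[of "{0..<r}" a] unfolding homogeneous_part_def by auto
    have b: "keys b \<subseteq> {r..<r + s}" "deg_on {r..<r + s} b = n"
      using fg'(2) t(3) deg_on_keys[of "{r..<r + s}" b] unfolding homogeneous_part_def by auto
    have "deg_on {r..<r + s} a = 0" "deg_on {0..<r} b = 0"
      by (rule deg_on_disjoint, use a b in fastforce)+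
    moreover have "keys t \<subseteq> {0..<r + s}"
      using keys_add[of a b] a b t by fastforce
    ultimately show "t \<in> {t \<in> segre_monoid r s. deg_on {0..<r} t = n}"
      using a b t by (simp add: segre_monoid_def deg_on_add)
  qed
  then show "h \<in> {f. keys f \<subseteq> {t \<in> segre_monoid r s. deg_on {0..<r} t = n}}"
    unfolding h mem_Collect_eq by (intro keys_sum_list_subset) auto
next
  fix f :: "'k poly_ring"
  assume "f \<in> {f. keys f \<subseteq> {t \<in> segre_monoid r s. deg_on {0..<r} t = n}}"
  then have f: "t \<in> keys f \<Longrightarrow> t \<in> segre_monoid r s \<and> deg_on {0..<r} t = n" for t by auto
  obtain ts where ts: "set ts = keys f" "distinct ts"
    using finite_distinct_list[of "keys f"] by auto
  define F where "F t = (single (expv_restrict {0..<r} t) (lookup f t),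
     single (expv_restrict {r..<r + s} t) (1 :: 'k))" for t
  have split: "expv_restrict {0..<r} t + expv_restrict {r..<r + s} t = t" if "t \<in> segre_monoid r s" for t
  proof (rule poly_mapping_eqI)
    fix i
    have "lookup t i = 0" if "i \<ge> r + s"
      using that \<open>t \<in> segre_monoid r s\<close> in_keys_iff[of i t] by (auto simp: segre_monoid_def)
    then show "lookup (expv_restrict {0..<r} t + expv_restrict {r..<r + s} t) i = lookup t i"
      by (auto simp: lookup_add lookup_expv_restrict)
  qed
  have deg: "deg_on V (expv_restrict V t) = deg_on V t" for V t
    by (simp add: deg_on_def lookup_expv_restrict)
  have "f = (\<Sum>t\<in>keys f. single t (lookup f t))"
    by (rule poly_mapping_eq_sum_single)
  also have "\<dots> = (\<Sum>t\<in>keys f. case F t of (f, g) \<Rightarrow> f * g)"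
    by (rule sum.cong) (use f split in \<open>auto simp: F_def mult_single\<close>)
  also have "\<dots> = sum_list (map (\<lambda>(f, g). f * g) (map F ts))"
    using sum_list_distinct_conv_sum_set[OF ts(2), of "\<lambda>t. case F t of (f, g) \<Rightarrow> f * g"] ts(1)
    by (simp add: o_def)
  finally have "f = sum_list (map (\<lambda>(f, g). f * g) (map F ts))" .
  moreover have "set (map F ts) \<subseteq> homogeneous_part {0..<r} n \<times> homogeneous_part {r..<r + s} n"
  proof
    fix y assume "y \<in> set (map F ts)"
    then obtain t where t: "y = F t" "t \<in> keys f" using ts by auto
    have "(\<Sum>i\<in>keys (expv_restrict V t). lookup (expv_restrict V t) i) = deg_on V t"
      if "finite V" for V
      using deg_on_keys[OF that, of "expv_restrict V t"] by (simp add: keys_expv_restrict deg)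
    then show "y \<in> homogeneous_part {0..<r} n \<times> homogeneous_part {r..<r + s} n"
      using f[OF t(2)] by (auto simp: t(1) F_def homogeneous_part_def keys_expv_restrict segre_monoid_def split: if_splits)
  qed
  ultimately show "f \<in> segre_part r s n" unfolding segre_part_def by blast
qed

definition homogeneous_component :: "nat \<Rightarrow> nat \<Rightarrow> 'k::field poly_ring \<Rightarrow> 'k poly_ring" where
  "homogeneous_component r n f = Poly_Mapping.mapp (\<lambda>t c. if deg_on {0..<r} t = n then c else 0) f"

lemma lookup_homogeneous_component:
  "lookup (homogeneous_component r n f) t = (if deg_on {0..<r} t = n then lookup f t else 0)"
  by (simp add: homogeneous_component_def lookup_mapp when_def in_keys_iff)

lemma homogeneous_component_in_segre_part:
  "keys f \<subseteq> segre_monoid r s \<Longrightarrow> homogeneous_component r n f \<in> segre_part r s n"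
  by (auto simp: segre_part_eq in_keys_iff lookup_homogeneous_component split: if_splits)

lemma sum_homogeneous_component:
  assumes "\<And>t. t \<in> keys f \<Longrightarrow> deg_on {0..<r} t \<ge> m"
  shows "f = (\<Sum>n=m..Max (insert 0 (deg_on {0..<r} ` keys f)). homogeneous_component r n f)"
proof (rule poly_mapping_eqI)
  fix t
  define N where "N = Max (insert 0 (deg_on {0..<r} ` keys f))"
  show "lookup f t = lookup (\<Sum>n=m..N. homogeneous_component r n f) t"
  proof (cases "t \<in> keys f")
    case True
    then have "deg_on {0..<r} t \<in> {m..N}"
      using assms by (auto simp: N_def intro!: Max_ge)
    then show ?thesis by (simp add: lookup_sum lookup_homogeneous_component)
  next
    case False
    then show ?thesis by (simp add: lookup_sum lookup_homogeneous_component in_keys_iff)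
  qed
qed

lemma segre_monoid_deg_zero:
  assumes "t \<in> segre_monoid r s" "deg_on {0..<r} t = 0"
  shows "t = 0"
proof (rule poly_mapping_eqI)
  fix i
  have "\<forall>i\<in>{0..<r}. lookup t i = 0" "\<forall>i\<in>{r..<r+s}. lookup t i = 0"
    using assms by (auto simp: segre_monoid_def deg_on_def)
  moreover have "lookup t i = 0" if "i \<ge> r + s"
    using that assms(1) in_keys_iff[of i t] by (auto simp: segre_monoid_def)
  ultimately show "lookup t i = lookup 0 i"
    by (metis atLeastLessThan_iff lookup_zero not_le zero_le)
qed

lemma segre_product_eq:
  "(segre_product r s :: 'k::field poly_ring set) = {f. keys f \<subseteq> segre_monoid r s}"
proof (intro equalityI subsetI)
  fix f :: "'k poly_ring" assume "f \<in> segre_product r s"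
  then obtain h N where f: "f = (\<Sum>n=0..N. h n)" and h: "\<And>n. h n \<in> segre_part r s n"
    unfolding segre_product_def by blast
  have "keys f \<subseteq> segre_monoid r s"
    unfolding f
  proof (rule keys_sum_subset)
    fix n
    show "keys (h n) \<subseteq> segre_monoid r s"
      using h[of n] by (auto simp: segre_part_eq)
  qed
  then show "f \<in> {f. keys f \<subseteq> segre_monoid r s}" by simp
next
  fix f :: "'k poly_ring" assume "f \<in> {f. keys f \<subseteq> segre_monoid r s}"
  then show "f \<in> segre_product r s"
    unfolding segre_product_def
    using sum_homogeneous_component[of f 0 r] homogeneous_component_in_segre_part[of f r s] by blast
qed

lemma segre_irrelevant_ideal_eq:
  "(segre_irrelevant_ideal r s :: 'k::field poly_ring set) =
     {f. keys f \<subseteq> segre_monoid r s \<and> lookup f 0 = 0}"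
proof (intro equalityI subsetI)
  fix f :: "'k poly_ring" assume "f \<in> segre_irrelevant_ideal r s"
  then obtain h N where f: "f = (\<Sum>n=1..N. h n)" and h: "\<And>n. h n \<in> segre_part r s n"
    unfolding segre_irrelevant_ideal_def by blast
  have "keys f \<subseteq> segre_monoid r s - {0}"
    unfolding f
  proof (rule keys_sum_subset)
    fix n assume "n \<in> {1..N}"
    then show "keys (h n) \<subseteq> segre_monoid r s - {0}"
      using h[of n] by (auto simp: segre_part_eq)
  qed
  then show "f \<in> {f. keys f \<subseteq> segre_monoid r s \<and> lookup f 0 = 0}"
    by (auto simp: in_keys_iff)
next
  fix f :: "'k poly_ring" assume f: "f \<in> {f. keys f \<subseteq> segre_monoid r s \<and> lookup f 0 = 0}"
  have "deg_on {0..<r} t \<ge> 1" if t: "t \<in> keys f" for t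
  proof (rule ccontr)
    assume "\<not> deg_on {0..<r} t \<ge> 1"
    then have "t = 0" using f t by (intro segre_monoid_deg_zero[of t r s]) auto
    then show False using f t by (simp add: in_keys_iff)
  qed
  from sum_homogeneous_component[OF this] show "f \<in> segre_irrelevant_ideal r s"
    unfolding segre_irrelevant_ideal_def mem_Collect_eq
    using f homogeneous_component_in_segre_part[of f r s]
    by (intro exI[of _ "\<lambda>n. homogeneous_component r n f"] exI conjI) auto
qed

locale segre =
  fixes r s :: nat
  assumes r2: "2 \<le> r" and s2: "2 \<le> s"
begin

abbreviation "X \<equiv> {0..<r}"
abbreviation "Y \<equiv> {r..<r + s}"
abbreviation "Q \<equiv> segre_monoid r s"

sublocale affine_monoid Q
  by (rule affine_monoid_segre)

lemma segre_local_ring_eq: "(segre_local_ring r s :: 'k::field poly_ring fract ring) = field_subring (loc Q)"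
  unfolding segre_local_ring_def segre_product_eq segre_irrelevant_ideal_eq by (rule localization_eq)

lemma max_ideal_segre: "max_ideal (segre_local_ring r s :: 'k::field poly_ring fract ring) = loc (Q - {0})"
  unfolding segre_local_ring_eq by (rule LR.max_ideal_R)

lemma nonzero_variables:
  assumes "t \<in> Q" "t \<noteq> 0"
  obtains i j where "i \<in> X" "j \<in> Y" "lookup t i \<ge> 1" "lookup t j \<ge> 1"
proof -
  have "deg_on X t \<noteq> 0" using segre_monoid_deg_zero assms by blast
  moreover from this have "deg_on Y t \<noteq> 0" using assms by (simp add: segre_monoid_def)
  ultimately obtain i j where "i \<in> X" "j \<in> Y" "lookup t i \<noteq> 0" "lookup t j \<noteq> 0"
    unfolding deg_on_def by (meson sum.neutral)
  then show thesis by (intro that[of i j]) auto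
qed

text \<open>
  The exponent of \<open>x\<^sub>i y\<^sub>j\<close>; these vectors generate \<open>Q\<close>.
\<close>

definition pair :: "nat \<Rightarrow> nat \<Rightarrow> expv" where
  "pair i j = single i 1 + single j 1"

lemma pair_in_Q: "i \<in> X \<Longrightarrow> j \<in> Y \<Longrightarrow> pair i j \<in> Q"
  using keys_add[of "single i (1::nat)" "single j 1"]
  by (auto simp: pair_def segre_monoid_def deg_on_add deg_on_single)

text \<open>
  The exponents divisible in \<open>Q\<close> by some \<open>(x\<^sub>i y\<^sub>j) ^ q\<close>: what is left after the division
  is again balanced.
\<close>

definition frob_exps :: "nat \<Rightarrow> expv set" where
  "frob_exps q = {t \<in> Q. \<exists>i\<in>X. \<exists>j\<in>Y. q \<le> lookup t i \<and> q \<le> lookup t j}"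

definition large_exps :: "nat \<Rightarrow> expv set" where
  "large_exps q = {t \<in> Q. \<exists>i\<in>X \<union> Y. q \<le> lookup t i}"

lemma monoid_ideal_frob_exps: "monoid_ideal (frob_exps q)"
  unfolding monoid_ideal_def
proof (intro conjI ballI)
  fix t u assume "t \<in> frob_exps q" "u \<in> Q"
  then show "t + u \<in> frob_exps q"
    using add_Q[of t u] by (force simp: frob_exps_def lookup_add)
qed (auto simp: frob_exps_def)

lemma monoid_ideal_large_exps: "monoid_ideal (large_exps q)"
  unfolding monoid_ideal_def
proof (intro conjI ballI)
  fix t u assume "t \<in> large_exps q" "u \<in> Q"
  then show "t + u \<in> large_exps q"
    using add_Q[of t u] by (force simp: large_exps_def lookup_add)
qed (auto simp: large_exps_def)

end

section \<open>The Frobenius power of the maximal ideal and the annihilator of the socle\<close>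

lemma power_fract: "(Fract f g :: 'k::field poly_ring fract) ^ n = Fract (f ^ n) (g ^ n)"
  by (induction n) (simp_all add: One_fract_def)

locale segre_frobenius = segre r s + perfect_frobenius p e K
  for r s p e :: nat and K :: "'k::field itself"
begin

lemma lookup_pair: "lookup (pair i j) k = (if k = i then 1 else 0) + (if k = j then 1 else 0)"
  by (auto simp: pair_def lookup_add lookup_single when_def)

lemma deg_on_pair: "i \<in> X \<Longrightarrow> j \<in> Y \<Longrightarrow> deg_on X (pair i j) = 1"
  "i \<in> X \<Longrightarrow> j \<in> Y \<Longrightarrow> deg_on Y (pair i j) = 1"
  by (auto simp: pair_def deg_on_add deg_on_single)

lemma Q_cancel:
  assumes "u \<in> Q" "u + v \<in> Q"
  shows "v \<in> Q"
proof -
  have "keys v \<subseteq> keys (u + v)" by (auto simp: in_keys_iff lookup_add)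
  then show ?thesis using assms by (auto simp: segre_monoid_def deg_on_add)
qed

lemma scale_in_Q: "t \<in> Q \<Longrightarrow> expv_scale n t \<in> Q"
  by (induction n) (auto simp: zero_Q expv_scale_Suc add_Q)

lemma scale_in_frob_exps:
  assumes "t \<in> Q - {0}"
  shows "expv_scale n t \<in> frob_exps n"
proof -
  obtain i j where "i \<in> X" "j \<in> Y" "lookup t i \<ge> 1" "lookup t j \<ge> 1"
    using nonzero_variables[of t] assms by blast
  moreover have "expv_scale n t \<in> Q" using scale_in_Q assms by blast
  ultimately show ?thesis
    unfolding frob_exps_def lookup_expv_scale mem_Collect_eq
    by (intro conjI bexI[of _ i] bexI[of _ j]) simp_all
qed

lemma keys_power_subset:
  fixes f :: "'k poly_ring"
  shows "keys (f ^ q) \<subseteq> expv_scale q ` keys f"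
  unfolding poly_power_eq_sum[OF perfect] by (rule keys_sum_subset) auto

text \<open>
  The exponents in \<open>f ^ q\<close> are \<open>q\<close> times those in \<open>f\<close>, and a nonzero vector of \<open>Q\<close>
  involves variables of both kinds. In the other direction, a monomial with exponent in
  \<open>frob_exps q\<close> is the product of some \<open>(x\<^sub>i y\<^sub>j) ^ q\<close> with a monomial of the ring.
\<close>

lemma frobenius_power_max:
  "frobenius_power (field_subring (loc Q :: 'k poly_ring fract set)) (loc (Q - {0})) q = loc (frob_exps q)"
proof
  have "{a [^]\<^bsub>LR.R\<^esub> q | a :: 'k poly_ring fract. a \<in> loc (Q - {0})} \<subseteq> loc (frob_exps q)"
  proof
    fix y :: "'k poly_ring fract"
    assume "y \<in> {a [^]\<^bsub>LR.R\<^esub> q | a :: 'k poly_ring fract. a \<in> loc (Q - {0})}"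
    then obtain a :: "'k poly_ring fract" where a: "a \<in> loc (Q - {0})" and y: "y = a ^ q" by auto
    obtain f g :: "'k poly_ring" where x: "a = Fract f g" and f: "keys f \<subseteq> Q - {0}"
      and g: "keys g \<subseteq> Q" "lookup g 0 \<noteq> 0" "g \<noteq> 0" by (rule locE[OF a])
    have "keys (f ^ q) \<subseteq> frob_exps q"
      using keys_power_subset[of f] f scale_in_frob_exps by blast
    then show "y \<in> loc (frob_exps q)"
      unfolding y x power_fract using g by (intro locI keys_power_Q) (auto simp: lookup_power_zero)
  qed
  moreover have "ideal (loc (frob_exps q) :: 'k poly_ring fract set) LR.R"
    unfolding LR.ideal_iff by (rule is_ideal_loc[OF monoid_ideal_frob_exps])
  ultimately show "frobenius_power LR.R (loc (Q - {0}) :: 'k poly_ring fract set) q \<subseteq> loc (frob_exps q)"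
    unfolding frobenius_power_def genideal_def by blast
next
  have "loc (frob_exps q) \<subseteq> J"
    if J: "ideal J LR.R" and gen: "{a [^]\<^bsub>LR.R\<^esub> q | a. a \<in> loc (Q - {0})} \<subseteq> J" for J :: "'k poly_ring fract set"
  proof (rule loc_le_ideal)
    show J': "LR.is_ideal J" using J by (simp add: LR.ideal_iff)
    fix t assume t: "t \<in> frob_exps q"
    then obtain i j where ij: "i \<in> X" "j \<in> Y" "q \<le> lookup t i" "q \<le> lookup t j" and tQ: "t \<in> Q"
      by (auto simp: frob_exps_def)
    define u where "u = t - expv_scale q (pair i j)"
    have "i \<noteq> j" using ij by auto
    then have tu: "t = expv_scale q (pair i j) + u"
      using ij by (intro poly_mapping_eqI) (simp add: u_def lookup_add lookup_minus lookup_pair)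
    then have uQ: "u \<in> Q" using Q_cancel[OF scale_in_Q[OF pair_in_Q[OF ij(1,2)]], of q u] tQ by simp
    have "pair i j \<noteq> 0"
      using lookup_pair[of i j i] by auto
    then have "(monom_fract (pair i j) :: 'k poly_ring fract) \<in> loc (Q - {0})"
      using pair_in_Q[OF ij(1,2)] by (intro monom_fract_in_loc) simp
    then have "monom_fract (pair i j) ^ q \<in> J" using gen by auto
    moreover have "(monom_fract u :: 'k poly_ring fract) \<in> loc Q" by (rule monom_fract_in_loc[OF uQ])
    ultimately have "monom_fract u * monom_fract (pair i j) ^ q \<in> J" by (intro LR.is_idealD(4)[OF J'])
    then show "monom_fract t \<in> J" unfolding tu monom_fract_add monom_fract_power by (simp add: mult.commute)
  qed
  then show "loc (frob_exps q) \<subseteq> frobenius_power LR.R (loc (Q - {0}) :: 'k poly_ring fract set) q"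
    unfolding frobenius_power_def genideal_def by blast
qed

lemma keys_poly_root:
  assumes "a \<in> Q" "keys f \<subseteq> Q"
  shows "keys (poly_root a f) \<subseteq> Q"
proof
  fix w assume "w \<in> keys (poly_root a f)"
  then have "a + expv_scale q w \<in> Q" using assms by (auto simp: in_keys_iff lookup_poly_root)
  then have "expv_scale q w \<in> Q" by (rule Q_cancel[OF assms(1)])
  moreover have "keys (expv_scale q w) = keys w"
    using q_pos by (auto simp: in_keys_iff)
  ultimately show "w \<in> Q" using q_pos by (auto simp: segre_monoid_def deg_on_scale)
qed

text \<open>
  Taking roots keeps exponents balanced because \<open>a\<close> is balanced: \<open>a + q w\<close> lies in \<open>Q\<close>
  only if \<open>w\<close> does.
\<close>

lemma fract_root_in_loc:
  assumes a: "a \<in> Q" "\<And>i. lookup a i < q" and x: "x \<in> loc Q"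
  shows "fract_root a x \<in> loc Q"
proof -
  obtain f g :: "'k poly_ring" where x: "x = Fract f g" and f: "keys f \<subseteq> Q"
    and g: "keys g \<subseteq> Q" "lookup g 0 \<noteq> 0" "g \<noteq> 0" by (rule locE[OF x])
  have "keys (f * g ^ (q - 1)) \<subseteq> Q" by (rule keys_mult_Q[OF f keys_power_Q[OF g(1)]])
  then show ?thesis
    unfolding x fract_root_Fract[OF a(2) g(3)] by (intro locI keys_poly_root[OF a(1)] g)
qed

text \<open>
  Here \<open>k\<close> is the variable with the large exponent and \<open>k'\<close> another variable of the same
  kind; the monomials \<open>u\<close> and \<open>v\<close> combine \<open>k'\<close> and \<open>k\<close> with one common variable of the
  other kind. Since \<open>u\<close> is not a product of two nonconstant monomials of the ring, there
  is \<open>w\<close> with \<open>u w = z\<close> that is killed by all other nonconstant monomials, in particular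
  by \<open>v\<close>.
\<close>

lemma large_monom_in_ann:
  fixes E :: "('k poly_ring fract, 'e) module"
  assumes inj: "injective_module (field_subring (loc Q)) E"
    and z: "z \<in> carrier E" "\<And>a. a \<in> loc (Q - {0}) \<Longrightarrow> a \<odot>\<^bsub>E\<^esub> z = \<zero>\<^bsub>E\<^esub>"
    and FT: "frobenius_tensor (loc Q) (loc (Q - {0})) E"
    and t: "t \<in> Q" and ij: "i \<in> X" "j \<in> Y" "i' \<in> X" "j' \<in> Y"
    and k: "k = i \<and> k' = i' \<and> j = j' \<or> k = j \<and> k' = j' \<and> i = i'" "k \<noteq> k'" "q \<le> lookup t k"
  shows "monom_fract t \<in> frobenius_tensor.ann_ideal (loc Q) E p e z"
proof -
  interpret FT: frobenius_tensor "loc Q" "loc (Q - {0})" E p e by (rule FT)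
  define u where "u = pair i' j'"
  define v where "v = pair i j"
  define S where "S = Q - {0, u}"
  have u: "u \<in> Q" "u \<noteq> 0" "v \<in> Q" "v \<noteq> 0"
    using pair_in_Q ij lookup_pair[of i j i] lookup_pair[of i' j' i'] by (auto simp: u_def v_def)
  have uv: "u \<noteq> v"
  proof
    assume "u = v"
    then have "lookup u k = lookup v k" by simp
    then show False using k ij by (auto simp: u_def v_def lookup_pair)
  qed
  have S: "monoid_ideal S"
    unfolding monoid_ideal_def
  proof (intro conjI ballI)
    fix a b assume a: "a \<in> S" and b: "b \<in> Q"
    have "a + b \<noteq> u"
    proof
      assume eq: "a + b = u"
      have "deg_on X a + deg_on X b = 1"
        using arg_cong[OF eq, of "deg_on X"] deg_on_pair ij by (simp add: u_def deg_on_add)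
      moreover have "deg_on X a \<noteq> 0" using segre_monoid_deg_zero[of a r s] a by (auto simp: S_def)
      ultimately have "deg_on X b = 0" by simp
      then have "b = 0" using segre_monoid_deg_zero b by blast
      then show False using eq a by (simp add: S_def)
    qed
    then show "a + b \<in> S" using a b add_Q by (auto simp: S_def)
  qed (auto simp: S_def)
  have insS: "insert u S = Q - {0}" using u by (auto simp: S_def)
  have "\<exists>w\<in>carrier E. monom_fract u \<odot>\<^bsub>E\<^esub> w = z \<and> (\<forall>x\<in>loc S. x \<odot>\<^bsub>E\<^esub> w = \<zero>\<^bsub>E\<^esub>)"
  proof (rule LR.injective_divide[OF inj is_ideal_loc[OF S] monom_fract_in_loc[OF u(1)] _ _ z])
    show "(monom_fract u :: 'k poly_ring fract) \<notin> loc S" by (simp add: monom_fract_in_loc_iff S_def)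
    show "a * monom_fract u \<in> loc S" if "a \<in> loc (Q - {0})" for a :: "'k poly_ring fract"
      using max_times_monom[of u S a] insS monoid_ideal_max that u by simp
  qed
  then obtain w where w: "w \<in> carrier E" "monom_fract u \<odot>\<^bsub>E\<^esub> w = z"
    and wS: "\<And>x. x \<in> loc S \<Longrightarrow> x \<odot>\<^bsub>E\<^esub> w = \<zero>\<^bsub>E\<^esub>" by blast
  have "(monom_fract v :: 'k poly_ring fract) \<in> loc S"
    by (rule monom_fract_in_loc) (use u uv in \<open>auto simp: S_def\<close>)
  then have wv: "monom_fract v \<odot>\<^bsub>E\<^esub> w = \<zero>\<^bsub>E\<^esub>" by (rule wS)
  \<comment> \<open>This moves \<open>q\<close> units from the exponent of \<open>k\<close> to that of \<open>k'\<close>; the subtraction does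
  not truncate because the exponent of \<open>k\<close> in \<open>t\<close> is at least \<open>q\<close>.\<close>
  define t' where "t' = (t + expv_scale q u) - expv_scale q v"
  have eq: "t + expv_scale q u = expv_scale q v + t'"
  proof (rule poly_mapping_eqI)
    fix l
    have "i \<noteq> j'" "i' \<noteq> j" "i \<noteq> j" "i' \<noteq> j'" using ij by auto
    then show "lookup (t + expv_scale q u) l = lookup (expv_scale q v + t') l"
      using k by (auto simp: t'_def lookup_add lookup_minus u_def v_def lookup_pair)
  qed
  have t': "t' \<in> Q"
    by (rule Q_cancel[OF scale_in_Q[OF u(3), of q]]) (simp only: eq[symmetric] add_Q[OF t scale_in_Q[OF u(1)]])
  show ?thesis
  proof (rule FT.ann_idealI[OF w(1) _ _ _ w(2) wv])
    show "monom_fract t' \<in> loc Q" "monom_fract u \<in> loc Q" "monom_fract v \<in> loc Q" "monom_fract t \<in> loc Q"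
      using t t' u by (auto intro: monom_fract_in_loc)
    show "(monom_fract t :: 'k poly_ring fract) * monom_fract u ^ q = monom_fract t' * monom_fract v ^ q"
      unfolding monom_fract_power monom_fract_add[symmetric] eq by (simp add: add.commute)
  qed
qed

text \<open>
  A fraction in the annihilator may be replaced by its numerator \<open>f\<close>. If \<open>f\<close> had a term
  with exponent \<open>a\<close> outside \<open>large_exps q\<close>, the root map at \<open>a\<close> would take it to a
  polynomial with nonzero constant term, a unit of the local ring.
\<close>

lemma ann_socle_eq:
  fixes E :: "('k poly_ring fract, 'e) module"
  assumes inj: "injective_module (field_subring (loc Q)) E"
    and z: "z \<in> carrier E" "z \<noteq> \<zero>\<^bsub>E\<^esub>" "\<And>a. a \<in> loc (Q - {0}) \<Longrightarrow> a \<odot>\<^bsub>E\<^esub> z = \<zero>\<^bsub>E\<^esub>"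
  shows "annihilator (field_subring (loc Q)) (frobenius_functor (field_subring (loc Q)) p e E)
     (frobenius_map (field_subring (loc Q)) p e E z) = loc (large_exps q)"
proof -
  have FT: "frobenius_tensor (loc Q) (loc (Q - {0})) E"
    using inj by (intro frobenius_tensor.intro LR.local_subring_axioms) (simp add: injective_module_def)
  interpret FT: frobenius_tensor "loc Q" "loc (Q - {0})" E p e by (rule FT)
  have "loc (large_exps q) \<subseteq> FT.ann_ideal z"
  proof (rule loc_le_ideal[OF FT.is_ideal_ann_ideal[OF z(1)]])
    fix t assume "t \<in> large_exps q"
    then obtain k where k: "k \<in> X \<union> Y" "q \<le> lookup t k" and t: "t \<in> Q"
      unfolding large_exps_def by blast
    have two: "\<exists>i'\<in>X. i' \<noteq> i" "\<exists>j'\<in>Y. j' \<noteq> j" for i j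
      using r2 s2 by (intro bexI[of _ "if i = 0 then 1 else 0"], simp_all)
        (intro bexI[of _ "if j = r then r + 1 else r"], simp_all)
    show "monom_fract t \<in> FT.ann_ideal z"
    proof (cases "k \<in> X")
      case True
      then obtain k' j where "k' \<in> X" "k' \<noteq> k" "j \<in> Y" using two by blast
      then show ?thesis
        using large_monom_in_ann[OF inj z(1,3) FT t, of k j k' j k k'] True k by blast
    next
      case False
      then have "k \<in> Y" using k by blast
      then obtain k' i where "k' \<in> Y" "k' \<noteq> k" "i \<in> X" using two by blast
      then show ?thesis
        using large_monom_in_ann[OF inj z(1,3) FT t, of i k i k' k k'] \<open>k \<in> Y\<close> k by blast
    qed
  qed
  moreover have "FT.ann_ideal z \<subseteq> loc (large_exps q)"
  proof
    fix x assume x: "x \<in> FT.ann_ideal z"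
    then have "x \<in> loc Q" by (simp add: FT.ann_ideal_def)
    then obtain f g :: "'k poly_ring" where xfg: "x = Fract f g" and f: "keys f \<subseteq> Q"
      and g: "keys g \<subseteq> Q" "lookup g 0 \<noteq> 0" "g \<noteq> 0" by (rule locE)
    have "keys f \<subseteq> large_exps q"
    proof (rule ccontr)
      assume "\<not> keys f \<subseteq> large_exps q"
      then obtain a where a: "a \<in> keys f" "a \<in> Q" "a \<notin> large_exps q" using f by blast
      have small: "lookup a i < q" for i
      proof (cases "i \<in> X \<union> Y")
        case True
        then show ?thesis using a by (auto simp: large_exps_def not_le)
      next
        case False
        then have "i \<notin> keys a" using a(2) by (auto simp: segre_monoid_def)
        then show ?thesis using q_pos by (simp add: in_keys_iff)
      qed
      have "Fract g 1 * x \<in> FT.ann_ideal z"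
        by (rule LR.is_idealD(4)[OF FT.is_ideal_ann_ideal[OF z(1)] _ x]) (rule locI, use g zero_Q in auto)
      moreover have "Fract g 1 * x = Fract f 1" using g by (simp add: xfg eq_fract)
      ultimately have ann: "Fract f 1 \<in> FT.ann_ideal z" by simp
      have "fract_root a (Fract f 1) \<notin> loc (Q - {0})"
      proof
        assume "fract_root a (Fract f 1) \<in> loc (Q - {0})"
        then obtain f' g' :: "'k poly_ring" where fg': "fract_root a (Fract f 1) = Fract f' g'"
          and f': "keys f' \<subseteq> Q - {0}" and g': "lookup g' 0 \<noteq> 0" "g' \<noteq> 0" by (rule locE)
        then have "poly_root a f * g' = f'"
          using fract_root_Fract[OF small, of 1 f] by (simp add: eq_fract)
        then have "lookup (poly_root a f) 0 * lookup g' 0 = lookup f' 0"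
          by (metis lookup_mult_zero)
        moreover have "lookup f' 0 = 0" using f' by (auto simp: in_keys_iff)
        ultimately show False using g' a(1) by (simp add: lookup_poly_root in_keys_iff)
      qed
      moreover have "Fract f 1 \<in> loc Q" by (rule locI) (use f zero_Q in auto)
      ultimately have "Fract f 1 \<notin> FT.ann_ideal z"
        using fract_root_in_loc[OF a(2) small] fract_root_add[OF small] fract_root_power_mult[OF small]
        by (intro FT.not_in_ann_ideal[OF z(1,2), where \<phi> = "fract_root a"]) simp_all
      then show False using ann by simp
    qed
    then show "x \<in> loc (large_exps q)" unfolding xfg by (rule locI[OF _ g(1,2)])
  qed
  ultimately show ?thesis using FT.annihilator_eq[OF z(1)] by simp
qed

end

section \<open>Counting exponent vectors\<close>

definition expv_of :: "nat set \<Rightarrow> (nat \<Rightarrow> nat) \<Rightarrow> expv" where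
  "expv_of V f = Abs_poly_mapping (\<lambda>i. if i \<in> V then f i else 0)"

lemma lookup_expv_of: "finite V \<Longrightarrow> lookup (expv_of V f) i = (if i \<in> V then f i else 0)"
proof -
  assume "finite V"
  then have "finite {i. (if i \<in> V then f i else 0) \<noteq> 0}" by (rule rev_finite_subset) auto
  then show ?thesis by (simp add: expv_of_def)
qed

lemma keys_expv_of: "finite V \<Longrightarrow> keys (expv_of V f) \<subseteq> V"
  by (metis in_keys_iff lookup_expv_of subsetI)

lemma deg_on_expv_of: "finite V \<Longrightarrow> W \<subseteq> V \<Longrightarrow> deg_on W (expv_of V f) = sum f W"
  unfolding deg_on_def by (rule sum.cong) (auto simp: lookup_expv_of)

definition bounded_exps :: "nat set \<Rightarrow> nat set \<Rightarrow> nat \<Rightarrow> nat \<Rightarrow> expv set" where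
  "bounded_exps V T q N = {t. keys t \<subseteq> V \<and> deg_on V t = N \<and> (\<forall>i\<in>T. lookup t i < q)}"

lemma lookup_le_deg_on: "finite V \<Longrightarrow> i \<in> V \<Longrightarrow> lookup t i \<le> deg_on V t"
  unfolding deg_on_def by (rule member_le_sum) auto

lemma finite_bounded_expv:
  assumes "finite V"
  shows "finite {t :: expv. keys t \<subseteq> V \<and> (\<forall>i\<in>V. lookup t i \<le> N)}"
proof (rule finite_imageD)
  let ?S = "{t :: expv. keys t \<subseteq> V \<and> (\<forall>i\<in>V. lookup t i \<le> N)}"
  show "inj_on lookup ?S"
    unfolding inj_on_def poly_mapping_eq_iff by blast
  have "lookup ` ?S \<subseteq> {f. \<forall>x. (x \<in> V \<longrightarrow> f x \<in> {..N}) \<and> (x \<notin> V \<longrightarrow> f x = 0)}"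
  proof
    fix f assume "f \<in> lookup ` ?S"
    then obtain t where t: "f = lookup t" "keys t \<subseteq> V" "\<forall>i\<in>V. lookup t i \<le> N"
      by blast
    have "lookup t x = 0" if "x \<notin> V" for x
      using t(2) that by (meson in_keys_iff subsetD)
    then show "f \<in> {f. \<forall>x. (x \<in> V \<longrightarrow> f x \<in> {..N}) \<and> (x \<notin> V \<longrightarrow> f x = 0)}"
      using t by simp
  qed
  moreover have "finite {f :: nat \<Rightarrow> nat. \<forall>x. (x \<in> V \<longrightarrow> f x \<in> {..N}) \<and> (x \<notin> V \<longrightarrow> f x = 0)}"
    by (rule finite_set_of_finite_funs) (use assms in auto)
  ultimately show "finite (lookup ` ?S)" by (rule finite_subset)
qed

lemma finite_bounded_exps: "finite V \<Longrightarrow> finite (bounded_exps V T q N)"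
  by (rule finite_subset[OF _ finite_bounded_expv[of V N]])
    (auto simp: bounded_exps_def intro: lookup_le_deg_on)

text \<open>
  Without bounds these are the weak compositions of \<open>N\<close> into \<open>d + 1\<close> parts.
\<close>

lemma card_bounded_exps_empty:
  "card (bounded_exps {0..<Suc d} {} q N) = (N + d) choose d"
proof -
  have "bij_betw (\<lambda>t. map (lookup t) [0..<Suc d]) (bounded_exps {0..<Suc d} {} q N)
      {l. length l = Suc d \<and> sum_list l = N}"
  proof (rule bij_betw_byWitness[where f' = "\<lambda>l. expv_of {0..<Suc d} (\<lambda>i. l ! i)"])
    show "\<forall>t\<in>bounded_exps {0..<Suc d} {} q N. expv_of {0..<Suc d} (\<lambda>i. map (lookup t) [0..<Suc d] ! i) = t"
    proof
      fix t assume t: "t \<in> bounded_exps {0..<Suc d} {} q N"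
      show "expv_of {0..<Suc d} (\<lambda>i. map (lookup t) [0..<Suc d] ! i) = t"
      proof (rule poly_mapping_eqI)
        fix i
        have "i \<notin> {0..<Suc d} \<Longrightarrow> lookup t i = 0"
          using t by (auto simp: bounded_exps_def in_keys_iff subset_iff)
        then show "lookup (expv_of {0..<Suc d} (\<lambda>i. map (lookup t) [0..<Suc d] ! i)) i
            = lookup t i"
          by (auto simp: lookup_expv_of simp del: upt_Suc)
      qed
    qed
    show "\<forall>l\<in>{l. length l = Suc d \<and> sum_list l = N}. map (lookup (expv_of {0..<Suc d} ((!) l))) [0..<Suc d] = l"
      by (auto simp: lookup_expv_of simp del: upt_Suc intro!: nth_equalityI)
    show "(\<lambda>t. map (lookup t) [0..<Suc d]) ` bounded_exps {0..<Suc d} {} q N \<subseteq> {l. length l = Suc d \<and> sum_list l = N}"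
      by (auto simp: bounded_exps_def deg_on_def sum_set_upt_conv_sum_list_nat[symmetric] interv_sum_list_conv_sum_set_nat simp del: upt_Suc)
    show "(\<lambda>l. expv_of {0..<Suc d} ((!) l)) ` {l. length l = Suc d \<and> sum_list l = N} \<subseteq> bounded_exps {0..<Suc d} {} q N"
      using keys_expv_of[of "{0..<Suc d}"]
      by (auto simp: bounded_exps_def deg_on_expv_of sum_list_sum_nth subset_iff)
  qed
  then have "card (bounded_exps {0..<Suc d} {} q N) = (N + Suc d - 1) choose N"
    by (simp add: bij_betw_same_card card_length_sum_list)
  then show ?thesis using binomial_symmetric[of N "N + d"] by simp
qed

text \<open>
  The vectors violating the new bound are the translates by \<open>q\<close> in direction \<open>i\<close> of the
  vectors of degree \<open>N - q\<close>; as \<open>i\<close> is not in \<open>T\<close>, the other bounds are unaffected.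
\<close>

lemma card_bounded_exps_insert:
  assumes V: "finite V" and i: "i \<in> V" "i \<notin> T"
  shows "card (bounded_exps V T q N) = card (bounded_exps V (insert i T) q N)
     + (if q \<le> N then card (bounded_exps V T q (N - q)) else 0)"
proof -
  define L where "L = {t \<in> bounded_exps V T q N. q \<le> lookup t i}"
  have split: "bounded_exps V T q N = bounded_exps V (insert i T) q N \<union> L"
    by (auto simp: bounded_exps_def L_def)
  have "card (bounded_exps V T q N) = card (bounded_exps V (insert i T) q N) + card L"
    unfolding split
  proof (rule card_Un_disjoint)
    show "finite (bounded_exps V (insert i T) q N)" by (rule finite_bounded_exps[OF V])
    show "finite L" by (rule finite_subset[OF _ finite_bounded_exps[OF V, of T q N]]) (auto simp: L_def)
    show "bounded_exps V (insert i T) q N \<inter> L = {}" by (auto simp: L_def bounded_exps_def)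
  qed
  also have "card L = (if q \<le> N then card (bounded_exps V T q (N - q)) else 0)"
  proof (cases "q \<le> N")
    case True
    have deg: "deg_on V (single i q) = q" using i V by (simp add: deg_on_single)
    have "bij_betw (\<lambda>t. t + single i q) (bounded_exps V T q (N - q)) L"
    proof (rule bij_betw_byWitness[where f' = "\<lambda>t. t - single i q"])
      have sub: "t - single i q + single i q = t" if "q \<le> lookup t i" for t :: expv
        using that by (intro poly_mapping_eqI) (auto simp: lookup_add lookup_minus lookup_single when_def)
      then show "\<forall>t\<in>L. t - single i q + single i q = t" by (auto simp: L_def)
      show "(\<lambda>t. t + single i q) ` bounded_exps V T q (N - q) \<subseteq> L"
      proof
        fix u assume "u \<in> (\<lambda>t. t + single i q) ` bounded_exps V T q (N - q)"
        then obtain t where t: "t \<in> bounded_exps V T q (N - q)" "u = t + single i q" by auto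
        have "keys u \<subseteq> V" using keys_add[of t "single i q"] t i
          by (auto simp: bounded_exps_def split: if_splits)
        moreover have "\<forall>j\<in>T. lookup u j < q"
          using t i by (auto simp: bounded_exps_def lookup_add lookup_single when_def)
        ultimately show "u \<in> L"
          using t True by (auto simp: L_def bounded_exps_def deg_on_add deg lookup_add)
      qed
      show "(\<lambda>t. t - single i q) ` L \<subseteq> bounded_exps V T q (N - q)"
      proof
        fix u assume "u \<in> (\<lambda>t. t - single i q) ` L"
        then obtain t where t: "t \<in> L" "u = t - single i q" by auto
        have ut: "u + single i q = t" using t sub by (auto simp: L_def)
        have le: "lookup u j \<le> lookup t j" for j by (simp add: t(2) lookup_minus)
        have tV: "keys t \<subseteq> V" "\<forall>j\<in>T. lookup t j < q"
          using t(1) by (auto simp: L_def bounded_exps_def)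
        have "keys u \<subseteq> keys t"
        proof
          fix j assume "j \<in> keys u"
          then show "j \<in> keys t" using le[of j] by (simp add: in_keys_iff)
        qed
        then have "keys u \<subseteq> V" using tV by blast
        moreover have "\<forall>j\<in>T. lookup u j < q"
          using tV(2) le le_less_trans by blast
        moreover have "deg_on V u + q = N" using t(1) deg_on_add[of V u "single i q"]
          by (simp add: ut deg L_def bounded_exps_def)
        ultimately show "u \<in> bounded_exps V T q (N - q)" by (auto simp: bounded_exps_def)
      qed
    qed auto
    then show ?thesis using True by (simp add: bij_betw_same_card)
  next
    case False
    have "t \<notin> L" for t
      using lookup_le_deg_on[OF V i(1), of t] False by (auto simp: L_def bounded_exps_def)
    then have "L = {}" by blast
    then show ?thesis using False by simp
  qed
  finally show ?thesis .
qed

subsection \<open>Asymptotics\<close>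

text \<open>
  Divided by \<open>fact n\<close>, this is the inclusion-exclusion formula for the \<open>n\<close>-dimensional
  volume, after projecting away one coordinate, of the points with coordinate sum \<open>m\<close>
  among those with \<open>n + 1\<close> nonnegative coordinates of which \<open>t\<close> are at most \<open>1\<close>.
\<close>

definition alternating_sum :: "nat \<Rightarrow> nat \<Rightarrow> nat \<Rightarrow> real" where
  "alternating_sum t m n = (\<Sum>i\<le>m. (-1) ^ i * real (t choose i) * real (m - i) ^ n)"

lemma alternating_sum_Suc:
  assumes "m > 0"
  shows "alternating_sum (Suc t) m n = alternating_sum t m n - alternating_sum t (m - 1) n"
proof -
  obtain k where m: "m = Suc k" using assms by (cases m) auto
  have "alternating_sum (Suc t) m n = real m ^ n + (\<Sum>i\<le>k. (-1) ^ Suc i * real (Suc t choose Suc i) * real (k - i) ^ n)"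
    by (simp add: alternating_sum_def m sum.atMost_Suc_shift del: sum.atMost_Suc binomial_Suc_Suc)
  also have "\<dots> = real m ^ n + (\<Sum>i\<le>k. (-1) ^ Suc i * real (t choose Suc i) * real (k - i) ^ n)
      - (\<Sum>i\<le>k. (-1) ^ i * real (t choose i) * real (k - i) ^ n)"
    unfolding add_diff_eq[symmetric] sum_subtractf[symmetric]
    by (intro arg_cong2[of _ _ _ _ "(+)"] sum.cong refl) (simp add: algebra_simps)
  also have "\<dots> = alternating_sum t m n - alternating_sum t (m - 1) n"
    by (simp add: alternating_sum_def m sum.atMost_Suc_shift del: sum.atMost_Suc binomial_Suc_Suc)
  finally show ?thesis .
qed

lemma tendsto_linear_div:
  "(\<lambda>q. real (m * q - a) / real q) \<longlonglongrightarrow> real m"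
proof (rule tendsto_sandwich)
  show "(\<lambda>q. real m - real a / real q) \<longlonglongrightarrow> real m"
    using tendsto_diff[OF tendsto_const lim_const_over_n[of "real a"], of "real m"] by simp
  show "eventually (\<lambda>q. real m - real a / real q \<le> real (m * q - a) / real q) sequentially"
    using eventually_gt_at_top[of 0]
  proof eventually_elim
    case (elim q)
    have "real m * real q - real a \<le> real (m * q - a)"
      by (cases "a \<le> m * q") (auto simp: of_nat_diff simp flip: of_nat_mult)
    then have "(real m * real q - real a) / real q \<le> real (m * q - a) / real q"
      by (rule divide_right_mono) simp
    then show ?case using elim by (simp add: diff_divide_distrib)
  qed
  show "eventually (\<lambda>q. real (m * q - a) / real q \<le> real m) sequentially"
    using eventually_gt_at_top[of 0]
  proof eventually_elim
    case (elim q)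
    have "real (m * q - a) \<le> real m * real q" by (metis diff_le_self of_nat_le_iff of_nat_mult)
    then show ?case using elim by (simp add: divide_le_eq)
  qed
qed (rule tendsto_const)

lemma tendsto_binomial_div:
  "(\<lambda>q. real ((m * q - a + d) choose d) / real q ^ d) \<longlonglongrightarrow> real m ^ d / fact d"
proof -
  have eq: "real ((N + d) choose d) = (\<Prod>i<d. real N + 1 + real i) / fact d" for N
  proof -
    have "real ((N + d) choose d) = (of_nat (N + d) :: real) gchoose d" by (rule binomial_gbinomial)
    also have "\<dots> = pochhammer (real N + 1) d / fact d"
      by (simp add: gbinomial_pochhammer' algebra_simps)
    finally show ?thesis by (simp add: pochhammer_prod atLeast0LessThan)
  qed
  have "(\<lambda>q. (\<Prod>i<d. real (m * q - a) / real q + (1 + real i) / real q) / fact d) \<longlonglongrightarrow> (\<Prod>i<d. real m + 0) / fact d"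
    by (intro tendsto_divide tendsto_prod tendsto_add tendsto_linear_div lim_const_over_n tendsto_const) simp
  moreover have "(\<Prod>i<d. real (m * q - a) / real q + (1 + real i) / real q) / fact d
      = real ((m * q - a + d) choose d) / real q ^ d" for q
  proof -
    have "(\<Prod>i<d. real (m * q - a) / real q + (1 + real i) / real q) = (\<Prod>i<d. (real (m * q - a) + 1 + real i) / real q)"
      by (rule prod.cong) (simp_all add: add_divide_distrib)
    also have "\<dots> = (\<Prod>i<d. real (m * q - a) + 1 + real i) / real q ^ d"
      by (simp add: prod_dividef)
    finally show ?thesis unfolding eq by (simp add: field_simps)
  qed
  ultimately show ?thesis by simp
qed

text \<open>
  The recursion \<open>card_bounded_exps_insert\<close> becomes \<open>alternating_sum_Suc\<close> in the limit. The
  offset \<open>a\<close>, needed for the degrees \<open>r * q - r\<close>, does not affect the leading term.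
\<close>

lemma tendsto_card_bounded_exps:
  assumes "finite T" "T \<subseteq> {0..<Suc d}" "d > 0"
  shows "(\<lambda>q. real (card (bounded_exps {0..<Suc d} T q (m * q - a))) / real q ^ d)
     \<longlonglongrightarrow> alternating_sum (card T) m d / fact d"
  using assms
proof (induction T arbitrary: m)
  case empty
  have "alternating_sum 0 m d = real m ^ d"
    by (simp add: alternating_sum_def sum.atMost_shift)
  then show ?case using tendsto_binomial_div[of m a d] by (simp add: card_bounded_exps_empty)
next
  case (insert i T)
  define c where "c m q = real (card (bounded_exps {0..<Suc d} T q (m * q - a))) / real q ^ d" for m q
  define b where "b q = (if q \<le> m * q - a then c (m - 1) q else 0)" for q
  have IH: "c m \<longlonglongrightarrow> alternating_sum (card T) m d / fact d" for m
    unfolding c_def using insert by auto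
  have rec: "real (card (bounded_exps {0..<Suc d} (insert i T) q (m * q - a))) / real q ^ d = c m q - b q" for q
  proof -
    have "m * q - a - q = (m - 1) * q - a" by (simp add: diff_mult_distrib)
    then show ?thesis
      using card_bounded_exps_insert[of "{0..<Suc d}" i T q "m * q - a"] insert
      by (auto simp: c_def b_def diff_divide_distrib[symmetric])
  qed
  have card: "card (insert i T) = Suc (card T)" using insert by simp
  have zero: "alternating_sum t 0 d = 0" for t using insert by (simp add: alternating_sum_def)
  have c_nonneg: "c m q \<ge> 0" for m q by (simp add: c_def)
  show ?case
  proof (cases "m = 0")
    case True
    have "eventually (\<lambda>q. c m q = c m q - b q) sequentially"
      using eventually_gt_at_top[of 0] by eventually_elim (simp add: b_def True)
    from Lim_transform_eventually[OF IH[of m] this] show ?thesis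
      unfolding rec card by (simp add: True zero)
  next
    case False
    have "b \<longlonglongrightarrow> alternating_sum (card T) (m - 1) d / fact d"
    proof (cases "m = 1")
      \<comment> \<open>The condition \<open>q \<le> q - a\<close> may fail for every large \<open>q\<close>, but the correction then
      counts vectors of degree \<open>0\<close> and vanishes in the limit in any case.\<close>
      case True
      have "b \<longlonglongrightarrow> 0"
      proof (rule tendsto_sandwich[where f = "\<lambda>_. 0" and h = "c 0"])
        show "c 0 \<longlonglongrightarrow> 0" using IH[of 0] by (simp add: zero)
        show "eventually (\<lambda>q. b q \<le> c 0 q) sequentially" using c_nonneg by (simp add: b_def True)
        show "eventually (\<lambda>q. 0 \<le> b q) sequentially" using c_nonneg by (simp add: b_def)
      qed (rule tendsto_const)
      then show ?thesis by (simp add: True zero)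
    next
      case m: False
      have "eventually (\<lambda>q. c (m - 1) q = b q) sequentially"
        using eventually_ge_at_top[of a]
      proof eventually_elim
        case (elim q)
        have "2 * q \<le> m * q" using \<open>m \<noteq> 0\<close> m by (intro mult_right_mono) auto
        then have "q \<le> m * q - a" using elim by linarith
        then show ?case by (simp add: b_def)
      qed
      from Lim_transform_eventually[OF IH[of "m - 1"] this] show ?thesis .
    qed
    then have "(\<lambda>q. c m q - b q) \<longlonglongrightarrow> alternating_sum (card T) m d / fact d - alternating_sum (card T) (m - 1) d / fact d"
      by (intro tendsto_diff IH)
    then show ?thesis
      unfolding rec card using False by (simp add: alternating_sum_Suc diff_divide_distrib)
  qed
qed

text \<open>
  Both sides satisfy \<open>F (n + 1) (k + 1) = (k + 1) * (F n (k + 1) + F n k)\<close>: on the right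
  this is the recursion of the Stirling numbers, on the left it is absorption followed by
  Pascal's rule.
\<close>

lemma alternating_sum_Stirling: "alternating_sum k k n = fact k * real (Stirling n k)"
proof (induction n k rule: Stirling.induct)
  case (2 k)
  have "(\<Sum>i\<le>Suc k. (-1) ^ i * real (Suc k choose i)) = 0"
    by (rule choose_alternating_sum) simp
  then show ?case by (simp add: alternating_sum_def del: binomial_Suc_Suc sum.atMost_Suc)
next
  case (4 n k)
  have absorb: "real (Suc k - i) * real (Suc k choose i) = real (Suc k) * real (k choose i)" if "i \<le> k" for i
    using binomial_absorb_comp[of "Suc k" i] by (metis diff_Suc_1 of_nat_mult)
  have "alternating_sum (Suc k) (Suc k) (Suc n)
     = (\<Sum>i\<le>k. (-1) ^ i * real (Suc k choose i) * real (Suc k - i) ^ Suc n)"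
    by (simp add: alternating_sum_def del: binomial_Suc_Suc)
  also have "\<dots> = (\<Sum>i\<le>k. (-1) ^ i * real (Suc k - i) ^ n * (real (Suc k - i) * real (Suc k choose i)))"
    by (rule sum.cong) (simp_all add: mult_ac del: binomial_Suc_Suc)
  also have "\<dots> = (\<Sum>i\<le>k. (-1) ^ i * real (Suc k - i) ^ n * (real (Suc k) * real (k choose i)))"
    by (rule sum.cong) (simp_all only: absorb atMost_iff)
  also have "\<dots> = real (Suc k) * alternating_sum k (Suc k) n"
    by (simp add: alternating_sum_def sum_distrib_left mult_ac binomial_eq_0)
  also have "alternating_sum k (Suc k) n = alternating_sum (Suc k) (Suc k) n + alternating_sum k k n"
    using alternating_sum_Suc[of "Suc k" k n] by simp
  finally show ?case using 4 by (simp add: algebra_simps)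
qed (simp_all add: alternating_sum_def)

text \<open>
  Expand the binomial coefficient of \<open>r + s\<close> by Vandermonde's identity. The terms without
  a choice among the \<open>s\<close> elements give the first summand, and the others are indexed by
  \<open>k = r - i\<close>.
\<close>

lemma alternating_sum_Vandermonde:
  assumes "d > 0"
  shows "alternating_sum (r + s) r d = alternating_sum r r d + (\<Sum>k=1..r - 1. \<Sum>j=1..r - k.
     real (r choose (k + j)) * real (s choose j) * (-1) ^ (r + k) * real k ^ d)"
proof -
  define g where "g k = (\<Sum>j=1..r - k. real (r choose (k + j)) * real (s choose j) * (-1) ^ (r + k) * real k ^ d)" for k
  have vander: "real ((r + s) choose i) = real (r choose i) + (\<Sum>j=1..i. real (s choose j) * real (r choose (i - j)))" for i
  proof -
    have "(r + s) choose i = (\<Sum>j\<le>i. (s choose j) * (r choose (i - j)))"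
      using vandermonde[of s r i] by (simp add: add.commute)
    also have "{..i} = insert 0 {1..i}" by auto
    finally show ?thesis by (simp add: of_nat_sum)
  qed
  have summand: "(-1) ^ i * (\<Sum>j=1..i. real (s choose j) * real (r choose (i - j))) * real (r - i) ^ d = g (r - i)"
    if "i \<le> r" for i
  proof -
    have sgn: "(-1) ^ (r + (r - i)) = ((-1) ^ i :: real)"
      using that by (simp add: minus_one_power_iff)
    have "r choose (r - i + j) = r choose (i - j)" if "j \<in> {1..i}" for j
      using binomial_symmetric[of "i - j" r] that \<open>i \<le> r\<close> by (simp add: Nat.diff_diff_right)
    then show ?thesis
      using that unfolding g_def sgn by (auto simp: sum_distrib_left sum_distrib_right mult_ac intro!: sum.cong)
  qed
  have "alternating_sum (r + s) r d = alternating_sum r r d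
     + (\<Sum>i\<le>r. (-1) ^ i * (\<Sum>j=1..i. real (s choose j) * real (r choose (i - j))) * real (r - i) ^ d)"
    by (simp add: alternating_sum_def vander distrib_left distrib_right sum.distrib)
  also have "(\<Sum>i\<le>r. (-1) ^ i * (\<Sum>j=1..i. real (s choose j) * real (r choose (i - j))) * real (r - i) ^ d) = (\<Sum>i\<le>r. g (r - i))"
    by (rule sum.cong) (use summand in auto)
  also have "\<dots> = (\<Sum>k\<le>r. g k)"
    by (rule sum.reindex_bij_witness[of _ "\<lambda>k. r - k" "\<lambda>k. r - k"]) auto
  also have "\<dots> = (\<Sum>k=1..r - 1. g k)"
  proof (rule sum.mono_neutral_right)
    show "\<forall>k\<in>{..r} - {1..r - 1}. g k = 0"
    proof
      fix k assume "k \<in> {..r} - {1..r - 1}"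
      then have "k = 0 \<or> k = r" by auto
      then show "g k = 0" using assms by (auto simp: g_def zero_power)
    qed
  qed auto
  finally show ?thesis by (simp add: g_def)
qed

subsection \<open>Balanced exponent vectors\<close>

text \<open>
  Replacing each exponent on \<open>W\<close> by its complement to \<open>q - 1\<close> changes the condition that
  the degrees on \<open>W\<close> and \<open>W'\<close> agree into the condition that the total degree is
  \<open>card W * (q - 1)\<close>.
\<close>

lemma card_balanced:
  assumes W: "finite W" "finite W'" "W \<inter> W' = {}" and T: "W \<subseteq> T" and q: "q > 0"
  shows "card {t :: expv. keys t \<subseteq> W \<union> W' \<and> deg_on W t = deg_on W' t \<and> (\<forall>i\<in>T. lookup t i < q)}
     = card (bounded_exps (W \<union> W') T q (card W * q - card W))" (is "card ?A = card ?B")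
proof -
  define c where "c t = expv_of (W \<union> W') (\<lambda>i. if i \<in> W then q - 1 - lookup t i else lookup t i)" for t
  have fin: "finite (W \<union> W')" using W by simp
  have keys: "keys (c t) \<subseteq> W \<union> W'" for t unfolding c_def by (rule keys_expv_of[OF fin])
  have lookup: "lookup (c t) i = (if i \<in> W then q - 1 - lookup t i
      else if i \<in> W' then lookup t i else 0)" for t i
    by (simp add: c_def lookup_expv_of[OF fin])
  have degW': "deg_on W' (c t) = deg_on W' t" for t
    unfolding deg_on_def by (rule sum.cong) (use W in \<open>auto simp: lookup\<close>)
  have degW: "deg_on W (c t) + deg_on W t = card W * q - card W" if "\<forall>i\<in>T. lookup t i < q" for t
  proof -
    have "deg_on W (c t) + deg_on W t = (\<Sum>i\<in>W. q - 1)"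
      unfolding deg_on_def sum.distrib[symmetric]
      by (rule sum.cong) (use that T in \<open>force simp: lookup\<close>)+
    then show ?thesis by (simp add: diff_mult_distrib2)
  qed
  have degU: "deg_on (W \<union> W') t = deg_on W t + deg_on W' t" for t
    unfolding deg_on_def by (rule sum.union_disjoint) (use W in auto)
  have invol: "c (c t) = t" if "keys t \<subseteq> W \<union> W'" "\<forall>i\<in>T. lookup t i < q" for t
  proof (rule poly_mapping_eqI)
    fix i
    have "i \<notin> W \<union> W' \<Longrightarrow> lookup t i = 0" using that(1) by (auto simp: in_keys_iff subset_iff)
    moreover have "i \<in> W \<Longrightarrow> lookup t i < q" using that(2) T by auto
    ultimately show "lookup (c (c t)) i = lookup t i" by (auto simp: lookup)
  qed
  have bound: "\<forall>i\<in>T. lookup (c t) i < q" if "\<forall>i\<in>T. lookup t i < q" for t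
    using that q by (auto simp: lookup)
  have "bij_betw c ?A ?B"
  proof (rule bij_betw_byWitness[where f' = c])
    show "\<forall>t\<in>?A. c (c t) = t" "\<forall>t\<in>?B. c (c t) = t" using invol by (auto simp: bounded_exps_def)
    show "c ` ?A \<subseteq> ?B"
    proof
      fix u assume "u \<in> c ` ?A"
      then obtain t where t: "u = c t" "deg_on W t = deg_on W' t" "\<forall>i\<in>T. lookup t i < q" by auto
      then show "u \<in> ?B"
        using keys[of t] degW[OF t(3)] degW'[of t] bound[OF t(3)] by (simp add: bounded_exps_def degU)
    qed
    show "c ` ?B \<subseteq> ?A"
    proof
      fix u assume "u \<in> c ` ?B"
      then obtain t where t: "u = c t" "deg_on W t + deg_on W' t = card W * q - card W" "\<forall>i\<in>T. lookup t i < q"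
        by (auto simp: bounded_exps_def degU)
      then show "u \<in> ?A"
        using keys[of t] degW[OF t(3)] degW'[of t] bound[OF t(3)] by simp
    qed
  qed
  then show ?thesis by (rule bij_betw_same_card)
qed

context segre
begin

definition small_exps :: "nat set \<Rightarrow> nat \<Rightarrow> expv set" where
  "small_exps T q = {t \<in> Q. \<forall>i\<in>T. lookup t i < q}"

lemma XY: "X \<union> Y = {0..<Suc (r + s - 1)}"
  using r2 by auto

lemma card_small_exps:
  assumes q: "q > 0"
  shows "X \<subseteq> T \<Longrightarrow> card (small_exps T q) = card (bounded_exps {0..<Suc (r + s - 1)} T q (r * q - r))"
    and "Y \<subseteq> T \<Longrightarrow> card (small_exps T q) = card (bounded_exps {0..<Suc (r + s - 1)} T q (s * q - s))"
proof -
  have V: "{0..<r + s} = X \<union> Y" by auto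
  show "card (small_exps T q) = card (bounded_exps {0..<Suc (r + s - 1)} T q (r * q - r))" if "X \<subseteq> T"
    unfolding XY[symmetric] using card_balanced[of X Y T q] that q
    by (simp add: small_exps_def segre_monoid_def V conj_assoc ivl_disj_int)
  have "Y \<union> X = X \<union> Y" "card Y = s" by auto
  then show "card (small_exps T q) = card (bounded_exps {0..<Suc (r + s - 1)} T q (s * q - s))" if "Y \<subseteq> T"
    unfolding XY[symmetric] using card_balanced[of Y X T q] that q
    by (simp add: small_exps_def segre_monoid_def V conj_assoc ivl_disj_int Int_commute eq_commute[of "deg_on Y _"])
qed

lemma finite_small_exps:
  assumes "X \<subseteq> T \<or> Y \<subseteq> T"
  shows "finite (small_exps T q)"
proof (rule finite_subset)
  show "finite {t :: expv. keys t \<subseteq> {0..<r + s} \<and> (\<forall>i\<in>{0..<r + s}. lookup t i \<le> (r + s) * q)}"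
    by (rule finite_bounded_expv) simp
  show "small_exps T q \<subseteq> {t. keys t \<subseteq> {0..<r + s} \<and> (\<forall>i\<in>{0..<r + s}. lookup t i \<le> (r + s) * q)}"
  proof (intro subsetI CollectI conjI ballI)
    fix t i assume t: "t \<in> small_exps T q" and i: "i \<in> {0..<r + s}"
    have bound: "deg_on W t \<le> card W * q" if "W \<subseteq> T" "finite W" for W
    proof -
      have "deg_on W t \<le> (\<Sum>i\<in>W. q)"
        unfolding deg_on_def by (rule sum_mono) (use t that in \<open>force simp: small_exps_def\<close>)
      then show ?thesis by simp
    qed
    have "deg_on X t = deg_on Y t" using t by (simp add: small_exps_def segre_monoid_def)
    moreover have "deg_on X t \<le> r * q \<or> deg_on Y t \<le> s * q" using assms bound[of X] bound[of Y] by auto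
    ultimately have "deg_on X t \<le> (r + s) * q" "deg_on Y t \<le> (r + s) * q" by (auto simp: algebra_simps)
    moreover have "lookup t i \<le> deg_on X t \<or> lookup t i \<le> deg_on Y t"
      using i lookup_le_deg_on[of X i t] lookup_le_deg_on[of Y i t] by (cases "i < r") auto
    ultimately show "lookup t i \<le> (r + s) * q" by linarith
  qed (auto simp: small_exps_def segre_monoid_def)
qed

lemma complement_large_exps: "Q - large_exps q = small_exps (X \<union> Y) q"
  unfolding large_exps_def small_exps_def not_le[symmetric] by blast

lemma complement_frob_exps: "Q - frob_exps q = small_exps X q \<union> small_exps Y q"
  unfolding frob_exps_def small_exps_def not_le[symmetric] by blast

lemma card_complement_frob_exps:
  "real (card (Q - frob_exps q)) = real (card (small_exps X q)) + real (card (small_exps Y q)) - real (card (small_exps (X \<union> Y) q))"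
proof -
  have "small_exps X q \<inter> small_exps Y q = small_exps (X \<union> Y) q" by (auto simp: small_exps_def)
  then have "card (small_exps X q) + card (small_exps Y q) = card (Q - frob_exps q) + card (small_exps (X \<union> Y) q)"
    unfolding complement_frob_exps using card_Un_Int[of "small_exps X q" "small_exps Y q"] finite_small_exps by simp
  then show ?thesis by linarith
qed

lemma tendsto_card_small_exps:
  defines "d \<equiv> r + s - 1"
  shows "(\<lambda>q. real (card (small_exps X q)) / real q ^ d) \<longlonglongrightarrow> fact r * real (Stirling d r) / fact d" (is ?A)
    and "(\<lambda>q. real (card (small_exps Y q)) / real q ^ d) \<longlonglongrightarrow> fact s * real (Stirling d s) / fact d" (is ?B)
    and "(\<lambda>q. real (card (small_exps (X \<union> Y) q)) / real q ^ d) \<longlonglongrightarrow> alternating_sum (r + s) r d / fact d" (is ?C)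
proof -
  have d: "d > 0" using r2 by (simp add: d_def)
  have cong: "(\<lambda>q. real (card (small_exps T q)) / real q ^ d) \<longlonglongrightarrow> L"
    if "(\<lambda>q. real (f q) / real q ^ d) \<longlonglongrightarrow> L" "\<And>q. q > 0 \<Longrightarrow> card (small_exps T q) = f q" for T f L
    using that(1)
  proof (rule Lim_transform_eventually)
    show "eventually (\<lambda>q. real (f q) / real q ^ d = real (card (small_exps T q)) / real q ^ d) sequentially"
      using eventually_gt_at_top[of 0] by eventually_elim (simp add: that(2))
  qed
  have sub: "X \<subseteq> {0..<Suc d}" "Y \<subseteq> {0..<Suc d}" "X \<union> Y \<subseteq> {0..<Suc d}"
    unfolding d_def XY[symmetric] by auto
  show ?A
    using tendsto_card_bounded_exps[OF _ sub(1) d, of r r]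
    by (intro cong[OF _ card_small_exps(1)]) (auto simp: alternating_sum_Stirling d_def)
  show ?B
    using tendsto_card_bounded_exps[OF _ sub(2) d, of s s]
    by (intro cong[OF _ card_small_exps(2)]) (auto simp: alternating_sum_Stirling d_def)
  have "card (X \<union> Y) = r + s" by (subst card_Un_disjoint) auto
  then show ?C
    using tendsto_card_bounded_exps[OF _ sub(3) d, of r r]
    by (intro cong[OF _ card_small_exps(1)]) (auto simp: d_def)
qed

end

section \<open>The Krull dimension\<close>

context local_subring
begin

definition is_prime :: "'f set \<Rightarrow> bool" where
  "is_prime J \<longleftrightarrow> is_ideal J \<and> 1 \<notin> J \<and> (\<forall>x\<in>B. \<forall>y\<in>B. x * y \<in> J \<longrightarrow> x \<in> J \<or> y \<in> J)"

lemma primeideal_iff: "primeideal J R \<longleftrightarrow> is_prime J"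
proof
  assume "primeideal J R"
  then interpret primeideal J R .
  have J: "is_ideal J" using is_ideal ideal_iff by blast
  have "1 \<notin> J" using one_imp_carrier I_notcarr by auto
  then show "is_prime J" using J I_prime by (auto simp: is_prime_def)
next
  assume J: "is_prime J"
  then have id: "is_ideal J" and one: "1 \<notin> J" by (auto simp: is_prime_def)
  show "primeideal J R"
  proof (rule primeidealI)
    show "ideal J R" using id by (simp add: ideal_iff)
    show "cring R" by (rule cring_R)
    show "carrier R \<noteq> J" using one one_in by auto
    show "\<And>a b. a \<in> carrier R \<Longrightarrow> b \<in> carrier R \<Longrightarrow> a \<otimes>\<^bsub>R\<^esub> b \<in> J \<Longrightarrow> a \<in> J \<or> b \<in> J"
      using J by (auto simp: is_prime_def)
  qed
qed

lemma is_prime_power: "is_prime J \<Longrightarrow> x \<in> B \<Longrightarrow> x ^ n \<in> J \<Longrightarrow> x \<in> J"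
proof (induction n)
  case (Suc n)
  then have "x \<in> J \<or> x ^ n \<in> J" using power_in[of x n] by (auto simp: is_prime_def)
  then show ?case using Suc by blast
qed (auto simp: is_prime_def)

end

definition power_product :: "'a::comm_monoid_mult list \<Rightarrow> nat list \<Rightarrow> 'a" where
  "power_product xs as = prod_list (map2 (^) xs as)"

lemma power_product_simps [simp]:
  "power_product [] [] = 1"
  "power_product (x # xs) (a # as) = x ^ a * power_product xs as"
  by (simp_all add: power_product_def)

abbreviation exponent_lists :: "nat \<Rightarrow> nat \<Rightarrow> nat list set" where
  "exponent_lists N n \<equiv> {as. set as \<subseteq> {..<N} \<and> length as = n}"

lemma exponent_lists_Suc: "exponent_lists N (Suc n) = (\<lambda>(a, as). a # as) ` ({..<N} \<times> exponent_lists N n)"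
proof (intro equalityI subsetI)
  fix as assume "as \<in> exponent_lists N (Suc n)"
  then show "as \<in> (\<lambda>(a, as). a # as) ` ({..<N} \<times> exponent_lists N n)" by (cases as) auto
qed auto

definition emb :: "'k::field poly_ring \<Rightarrow> 'k poly_ring fract" where
  "emb f = Fract f 1"

lemma emb_simps:
  fixes f g :: "'k::field poly_ring"
  shows "emb (f + g) = emb f + emb g" "emb (f * g) = emb f * emb g" "emb (f ^ n) = emb f ^ n"
  "emb (0 :: 'k poly_ring) = 0" "emb (1 :: 'k poly_ring) = 1"
proof -
  show "emb (f + g) = emb f + emb g" and mult: "emb (f * g) = emb f * emb g" for f g :: "'k poly_ring"
    by (simp_all add: emb_def)
  show "emb (0 :: 'k poly_ring) = 0" "emb (1 :: 'k poly_ring) = 1"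
    by (simp_all add: emb_def Zero_fract_def One_fract_def)
  then show "emb (f ^ n) = emb f ^ n" by (induction n) (simp_all add: mult)
qed

lemma keys_const_mult:
  fixes f :: "'k::field poly_ring"
  shows "keys f \<subseteq> S \<Longrightarrow> keys (single 0 c * f) \<subseteq> S"
  using keys_mult[of "single 0 c" f] by (auto split: if_splits)

lemma vector_space_poly: "vector_space (\<lambda>(c :: 'k::field) (f :: 'k poly_ring). single 0 c * f)"
  by unfold_locales (simp_all add: distrib_left distrib_right single_add mult_single mult.assoc[symmetric])

lemma card_le_of_independent:
  fixes F :: "'i \<Rightarrow> 'k::field poly_ring"
  assumes L: "finite L" and S: "finite S" and keys: "\<And>i. i \<in> L \<Longrightarrow> keys (F i) \<subseteq> S"
    and indep: "\<And>c i. (\<Sum>i\<in>L. single 0 (c i) * F i) = 0 \<Longrightarrow> i \<in> L \<Longrightarrow> c i = 0"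
  shows "card L \<le> card S"
proof -
  interpret VS: vector_space "\<lambda>(c :: 'k) (f :: 'k poly_ring). single 0 c * f"
    by (rule vector_space_poly)
  have inj: "inj_on F L"
  proof (rule inj_onI, rule ccontr)
    fix i j assume ij: "i \<in> L" "j \<in> L" "F i = F j" "i \<noteq> j"
    define c :: "'i \<Rightarrow> 'k" where "c l = (if l = i then 1 else if l = j then -1 else 0)" for l
    have "(\<Sum>l\<in>L. single 0 (c l) * F l) = (\<Sum>l\<in>{i, j}. single 0 (c l) * F l)"
      by (rule sum.mono_neutral_right) (use ij L in \<open>auto simp: c_def\<close>)
    also have "\<dots> = 0" using ij by (simp add: c_def single_uminus)
    finally have "c i = 0" using indep ij by blast
    then show False by (simp add: c_def)
  qed
  have "VS.independent (F ` L)"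
    unfolding VS.dependent_finite[OF finite_imageI[OF L]]
  proof safe
    fix u i assume "(\<Sum>v\<in>F ` L. single 0 (u v) * v) = 0" and i: "i \<in> L" and nz: "u (F i) \<noteq> 0"
    then have "(\<Sum>i\<in>L. single 0 (u (F i)) * F i) = 0" by (simp add: sum.reindex[OF inj])
    then show False using indep[of "\<lambda>i. u (F i)"] i nz by blast
  qed
  moreover have "F ` L \<subseteq> VS.span ((\<lambda>t. single t 1) ` S)"
  proof
    fix f assume "f \<in> F ` L"
    then have f: "keys f \<subseteq> S" using keys by auto
    have "f = (\<Sum>t\<in>keys f. single 0 (lookup f t) * single t 1)"
      by (subst poly_mapping_eq_sum_single[of f]) (simp add: mult_single)
    also have "\<dots> \<in> VS.span ((\<lambda>t. single t 1) ` S)"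
      using f by (intro VS.span_sum VS.span_scale VS.span_base) auto
    finally show "f \<in> VS.span ((\<lambda>t. single t 1) ` S)" .
  qed
  ultimately have "card (F ` L) \<le> card ((\<lambda>t. single t (1 :: 'k)) ` S)"
    using VS.independent_span_bound[of "(\<lambda>t. single t (1 :: 'k)) ` S" "F ` L"] S by blast
  also have "\<dots> \<le> card S" by (rule card_image_le[OF S])
  finally show ?thesis by (simp add: card_image[OF inj])
qed

context affine_monoid
begin

lemma emb_in_loc: "keys f \<subseteq> Q \<Longrightarrow> emb f \<in> loc Q"
  unfolding emb_def by (rule locI) (use zero_Q in auto)

lemma keys_power_product_Q:
  fixes xs :: "'k::field poly_ring list"
  assumes "length as = length xs" "\<And>x. x \<in> set xs \<Longrightarrow> keys x \<subseteq> Q"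
  shows "keys (power_product xs as) \<subseteq> Q"
  using assms
proof (induction as xs rule: list_induct2)
  case (Cons a as x xs)
  have "keys (x ^ a) \<subseteq> Q" by (rule keys_power_Q) (use Cons.prems in simp)
  moreover have "keys (power_product xs as) \<subseteq> Q" by (rule Cons.IH) (use Cons.prems in simp)
  ultimately show ?case using keys_mult_Q by simp
qed (use zero_Q in auto)

text \<open>
  Consider a relation modulo \<open>P 0\<close> as a polynomial in the first element \<open>x\<close> and let \<open>G a\<close>
  be its lowest coefficient that is not yet known to vanish. Since \<open>x\<close> is not in \<open>P 0\<close>,
  the power \<open>x ^ a\<close> can be cancelled, and since \<open>x\<close> lies in \<open>P 1\<close>, the coefficient \<open>G a\<close>
  is in \<open>P 1\<close>. This is a relation modulo \<open>P 1\<close> among the remaining elements, so its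
  coefficients vanish by induction.
\<close>

lemma prime_chain_independent:
  fixes xs :: "'k::field poly_ring list" and P :: "nat \<Rightarrow> 'k poly_ring fract set"
  assumes "\<And>i. i \<le> length xs \<Longrightarrow> LR.is_prime (P i)"
    and "\<And>i. i < length xs \<Longrightarrow> P i \<subseteq> P (Suc i)"
    and "\<And>i. i < length xs \<Longrightarrow> emb (xs ! i) \<in> P (Suc i) - P i"
    and "\<And>x. x \<in> set xs \<Longrightarrow> keys x \<subseteq> Q"
    and "emb (\<Sum>as\<in>exponent_lists N (length xs). single 0 (c as) * power_product xs as) \<in> P 0"
    and "as \<in> exponent_lists N (length xs)"
  shows "c as = 0"
  using assms
proof (induction xs arbitrary: P c as)
  case Nil
  have ex: "exponent_lists N 0 = {[]}" by auto
  have prime: "LR.is_prime (P 0)" using Nil.prems(1)[of 0] by simp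
  then have id: "LR.is_ideal (P 0)" and one: "1 \<notin> P 0" by (auto simp: LR.is_prime_def)
  have in_P: "emb (single 0 (c [])) \<in> P 0" 
    using Nil.prems(5) unfolding list.size(3) ex by simp
  have "c [] = 0"
  proof (rule ccontr)
    assume nz: "c [] \<noteq> 0"
    have "emb (single 0 (inverse (c []))) * emb (single 0 (c [])) \<in> P 0"
      by (rule LR.is_idealD(4)[OF id emb_in_loc in_P]) (use zero_Q in auto)
    moreover have "single 0 (inverse (c [])) * single 0 (c []) = (1 :: 'k poly_ring)"
      using nz by (simp add: mult_single)
    ultimately show False using one by (simp add: emb_simps(2)[symmetric] emb_simps(5))
  qed
  then show ?case using Nil.prems(6) by simp
next
  case (Cons x xs)
  define n where "n = length xs"
  define L where "L = exponent_lists N n"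
  define G where "G a = (\<Sum>as\<in>L. single 0 (c (a # as)) * power_product xs as)" for a
  have prime0: "LR.is_prime (P 0)" and prime1: "LR.is_prime (P 1)"
    using Cons.prems(1)[of 0] Cons.prems(1)[of 1] by simp_all
  have id0: "LR.is_ideal (P 0)" and id1: "LR.is_ideal (P 1)" using prime0 prime1 by (auto simp: LR.is_prime_def)
  have x: "emb x \<in> P 1" "emb x \<notin> P 0" "keys x \<subseteq> Q"
    using Cons.prems(3)[of 0] Cons.prems(4)[of x] by auto
  have keysG: "keys (G a) \<subseteq> Q" for a
    unfolding G_def
    by (intro keys_sum_subset keys_const_mult keys_power_product_Q)
      (use Cons.prems(4) in \<open>auto simp: L_def n_def\<close>)
  have total: "(\<Sum>as\<in>exponent_lists N (length (x # xs)). single 0 (c as) * power_product (x # xs) as)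
     = (\<Sum>a<N. x ^ a * G a)"
  proof -
    have "(\<Sum>as\<in>exponent_lists N (length (x # xs)). single 0 (c as) * power_product (x # xs) as)
      = (\<Sum>(a, as)\<in>{..<N} \<times> L. single 0 (c (a # as)) * (x ^ a * power_product xs as))"
      unfolding list.size(4) add_0_right add_Suc_right exponent_lists_Suc L_def n_def
      by (subst sum.reindex) (auto simp: inj_on_def case_prod_unfold)
    also have "\<dots> = (\<Sum>a<N. x ^ a * G a)"
      unfolding G_def sum_distrib_left by (subst sum.cartesian_product) (simp add: mult.left_commute)
    finally show ?thesis .
  qed
  have IH: "c (a # as) = 0" if G: "emb (G a) \<in> P 1" and as: "as \<in> L" for a as
  proof (rule Cons.IH[of "\<lambda>i. P (Suc i)" "\<lambda>as. c (a # as)"])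
    show "emb (\<Sum>as\<in>exponent_lists N (length xs). single 0 (c (a # as)) * power_product xs as) \<in> P (Suc 0)"
      using G by (simp add: G_def L_def n_def)
    show "as \<in> exponent_lists N (length xs)" using as by (simp add: L_def n_def)
    show "LR.is_prime (P (Suc i))" if "i \<le> length xs" for i using Cons.prems(1)[of "Suc i"] that by simp
    show "P (Suc i) \<subseteq> P (Suc (Suc i))" if "i < length xs" for i using Cons.prems(2)[of "Suc i"] that by simp
    show "emb (xs ! i) \<in> P (Suc (Suc i)) - P (Suc i)" if "i < length xs" for i
      using Cons.prems(3)[of "Suc i"] that by simp
    show "keys y \<subseteq> Q" if "y \<in> set xs" for y using Cons.prems(4)[of y] that by simp
  qed
  have G_in: "emb (G a) \<in> P 1" if "a < N" for a
    using that
  proof (induction a rule: less_induct)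
    case (less a)
    have G0: "G b = 0" if "b < a" for b
    proof -
      have "emb (G b) \<in> P 1" using less that by simp
      then have "c (b # as) = 0" if "as \<in> L" for as using IH that by blast
      then show ?thesis unfolding G_def by (intro sum.neutral) simp
    qed
    define H where "H = (\<Sum>b\<in>{a<..<N}. x ^ (b - Suc a) * G b)"
    have "(\<Sum>b<N. x ^ b * G b) = (\<Sum>b\<in>insert a {a<..<N}. x ^ b * G b)"
      by (rule sum.mono_neutral_right) (use less.prems G0 in \<open>auto simp: not_less\<close>)
    also have "\<dots> = x ^ a * G a + (\<Sum>b\<in>{a<..<N}. x ^ a * (x * (x ^ (b - Suc a) * G b)))"
    proof -
      have "x ^ b * G b = x ^ a * (x * (x ^ (b - Suc a) * G b))" if "b \<in> {a<..<N}" for b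
      proof -
        have "b = a + Suc (b - Suc a)" using that by simp
        then have "x ^ b = x ^ a * (x * x ^ (b - Suc a))" by (metis power_add power_Suc)
        then show ?thesis by (simp add: mult.assoc)
      qed
      then have "(\<Sum>b\<in>{a<..<N}. x ^ b * G b) = (\<Sum>b\<in>{a<..<N}. x ^ a * (x * (x ^ (b - Suc a) * G b)))"
        by (rule sum.cong[OF refl])
      then show ?thesis by simp
    qed
    also have "\<dots> = x ^ a * (G a + x * H)" by (simp add: H_def sum_distrib_left distrib_left)
    finally have "emb x ^ a * emb (G a + x * H) \<in> P 0"
      using Cons.prems(5) unfolding total by (simp add: emb_simps)
    moreover have keysH: "keys H \<subseteq> Q"
      unfolding H_def by (intro keys_sum_subset keys_mult_Q keys_power_Q x keysG)
    have keysGH: "keys (G a + x * H) \<subseteq> Q"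
      using keys_add[of "G a" "x * H"] keysG[of a] keys_mult_Q[OF x(3) keysH] by blast
    ultimately have "emb (G a + x * H) \<in> P 0"
      using prime0 LR.is_prime_power[OF prime0 emb_in_loc[OF x(3)], of a] x(2)
        LR.power_in[OF emb_in_loc[OF x(3)], of a] emb_in_loc[OF keysGH]
      unfolding LR.is_prime_def by blast
    then have sum_in: "emb (G a) + emb x * emb H \<in> P 1" using Cons.prems(2)[of 0] by (auto simp: emb_simps)
    have "emb H * emb x \<in> P 1" by (rule LR.is_idealD(4)[OF id1 emb_in_loc[OF keysH] x(1)])
    from LR.is_idealD(6)[OF id1 sum_in this] show ?case by (simp add: mult.commute)
  qed
  obtain a bs where as: "as = a # bs" "a < N" "bs \<in> L"
    using Cons.prems(6) by (cases as) (auto simp: L_def n_def)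
  then show ?case using IH G_in by blast
qed

text \<open>
  Denominators are units, so ideals are told apart by polynomials, for which the degree
  makes sense.
\<close>

lemma numerator_witness:
  fixes I J :: "'k::field poly_ring fract set"
  assumes I: "LR.is_ideal I" and J: "LR.is_ideal J" and "I \<subset> J"
  obtains f where "keys f \<subseteq> Q" "emb f \<in> J - I"
proof -
  obtain x where x: "x \<in> J" "x \<notin> I" using assms by blast
  then have "x \<in> loc Q" using LR.is_idealD(1)[OF J] by blast
  then obtain f g where fg: "x = Fract f g" and f: "keys f \<subseteq> Q" and g: "keys g \<subseteq> Q"
    "lookup g 0 \<noteq> 0" "g \<noteq> 0" by (rule locE)
  have "emb g * x = emb f" using g by (simp add: fg emb_def eq_fract)
  then have "emb f \<in> J" using LR.is_idealD(4)[OF J emb_in_loc[OF g(1)] x(1)] by simp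
  moreover have "emb f \<notin> I"
  proof
    assume fI: "emb f \<in> I"
    have "Fract 1 g \<in> loc Q" by (rule locI) (use g zero_Q in auto)
    from LR.is_idealD(4)[OF I this fI] have "x \<in> I" by (simp add: fg emb_def)
    then show False using x by simp
  qed
  ultimately show thesis using that f by blast
qed

end

context segre
begin

definition deg_le :: "nat \<Rightarrow> expv set" where
  "deg_le m = {t \<in> Q. deg_on X t \<le> m}"

text \<open>
  The last exponent of a balanced vector is determined by the others; this is why the
  exponent is \<open>r + s - 1\<close> and not the number of variables.
\<close>

lemma card_deg_le: "finite (deg_le m)" "card (deg_le m) \<le> (m + 1) ^ (r + s - 1)"
proof -
  define h where "h t = map (lookup t) [0..<r + s - 1]" for t :: expv
  have last: "Y = insert (r + s - 1) {r..<r + s - 1}" using s2 by auto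
  have inj: "inj_on h (deg_le m)"
  proof (rule inj_onI)
    fix t u assume t: "t \<in> deg_le m" and u: "u \<in> deg_le m" and eq: "h t = h u"
    have lt: "lookup t i = lookup u i" if "i < r + s - 1" for i
      using arg_cong[OF eq, of "\<lambda>l. l ! i"] that by (simp add: h_def)
    have "deg_on X t = deg_on X u"
      unfolding deg_on_def by (rule sum.cong) (use s2 in \<open>auto intro: lt\<close>)
    then have "deg_on Y t = deg_on Y u" using t u by (simp add: deg_le_def segre_monoid_def)
    moreover have "(\<Sum>i\<in>{r..<r + s - 1}. lookup t i) = (\<Sum>i\<in>{r..<r + s - 1}. lookup u i)"
      by (rule sum.cong) (auto intro: lt)
    ultimately have last_eq: "lookup t (r + s - 1) = lookup u (r + s - 1)"
      unfolding deg_on_def last by simp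
    show "t = u"
    proof (rule poly_mapping_eqI)
      fix i
      consider "i < r + s - 1" | "i = r + s - 1" | "i \<ge> r + s" using s2 by linarith
      then show "lookup t i = lookup u i"
      proof cases
        case 3
        then have "i \<notin> keys t" "i \<notin> keys u"
          using t u by (auto simp: deg_le_def segre_monoid_def)
        then show ?thesis by (simp add: in_keys_iff)
      qed (use lt last_eq in auto)
    qed
  qed
  have sub: "h ` deg_le m \<subseteq> {l. set l \<subseteq> {..m} \<and> length l = r + s - 1}"
  proof
    fix l assume "l \<in> h ` deg_le m"
    then obtain t where t: "t \<in> deg_le m" "l = h t" by auto
    have deg: "deg_on X t \<le> m" "deg_on Y t \<le> m" using t by (auto simp: deg_le_def segre_monoid_def)
    have "lookup t i \<le> m" if "i < r + s - 1" for i
    proof -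
      have "i \<in> X \<or> i \<in> Y" using that by auto
      then show ?thesis
        using lookup_le_deg_on[of X i t] lookup_le_deg_on[of Y i t] deg by auto
    qed
    then show "l \<in> {l. set l \<subseteq> {..m} \<and> length l = r + s - 1}" by (auto simp: t(2) h_def)
  qed
  have fin: "finite {l. set l \<subseteq> {..m} \<and> length l = r + s - 1}" by (rule finite_lists_length_eq) simp
  show "finite (deg_le m)" by (rule inj_on_finite[OF inj sub fin])
  have "card (deg_le m) \<le> card {l. set l \<subseteq> {..m} \<and> length l = r + s - 1}"
    by (rule card_inj_on_le[OF inj sub fin])
  then show "card (deg_le m) \<le> (m + 1) ^ (r + s - 1)" by (simp add: card_lists_length_eq)
qed

lemma keys_mult_deg_le:
  fixes f g :: "'k::field poly_ring"
  assumes "keys f \<subseteq> deg_le m" "keys g \<subseteq> deg_le n"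
  shows "keys (f * g) \<subseteq> deg_le (m + n)"
proof
  fix t assume "t \<in> keys (f * g)"
  then obtain a b where "t = a + b" "a \<in> keys f" "b \<in> keys g"
    using keys_mult[of f g] by blast
  moreover from this have "a \<in> deg_le m" "b \<in> deg_le n" using assms by blast+
  ultimately show "t \<in> deg_le (m + n)" using add_Q[of a b] by (simp add: deg_le_def deg_on_add)
qed

lemma deg_le_mono: "m \<le> n \<Longrightarrow> deg_le m \<subseteq> deg_le n"
  by (auto simp: deg_le_def)

lemma deg_le_zero: "0 \<in> deg_le m"
  using zero_Q by (simp add: deg_le_def)

lemma keys_power_deg_le:
  fixes f :: "'k::field poly_ring"
  assumes "keys f \<subseteq> deg_le m"
  shows "keys (f ^ n) \<subseteq> deg_le (n * m)"
  by (induction n) (use keys_mult_deg_le[OF assms] deg_le_zero in auto)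

lemma keys_power_product_deg_le:
  fixes xs :: "'k::field poly_ring list"
  assumes "length as = length xs" "\<And>x. x \<in> set xs \<Longrightarrow> keys x \<subseteq> deg_le m"
  shows "keys (power_product xs as) \<subseteq> deg_le (sum_list as * m)"
  using assms
proof (induction as xs rule: list_induct2)
  case (Cons a as x xs)
  then show ?case using keys_mult_deg_le[OF keys_power_deg_le[of x m a] Cons.IH] by (simp add: algebra_simps)
qed (use deg_le_zero in auto)

text \<open>
  Choose polynomials \<open>F i\<close> in \<open>P (Suc i)\<close> outside \<open>P i\<close>, of degree at most \<open>m\<close>. Their
  \<open>N ^ n\<close> monomials with exponents below \<open>N\<close> are linearly independent and have degree at
  most \<open>n * N * m\<close>, so \<open>N ^ n \<le> (n * N * m + 1) ^ d\<close> for every \<open>N\<close>. This fails for large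
  \<open>N\<close> unless \<open>n \<le> d\<close>.
\<close>

lemma prime_chain_length_le:
  fixes P :: "nat \<Rightarrow> 'k::field poly_ring fract set"
  assumes prime: "\<And>i. i \<le> n \<Longrightarrow> LR.is_prime (P i)" and strict: "\<And>i. i < n \<Longrightarrow> P i \<subset> P (Suc i)"
  shows "n \<le> r + s - 1"
proof (rule ccontr)
  define d where "d = r + s - 1"
  assume "\<not> n \<le> r + s - 1"
  then have nd: "n \<ge> Suc d" by (simp add: d_def)
  have "\<exists>f. keys f \<subseteq> Q \<and> emb f \<in> P (Suc i) - P i" if "i < n" for i
    using numerator_witness[of "P i" "P (Suc i)"] prime[of i] prime[of "Suc i"] strict[OF that] that
    by (metis LR.is_prime_def Suc_leI less_imp_le)
  then obtain F where F: "\<And>i. i < n \<Longrightarrow> keys (F i) \<subseteq> Q \<and> emb (F i) \<in> P (Suc i) - P i"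
    by metis
  define xs where "xs = map F [0..<n]"
  have len: "length xs = n" by (simp add: xs_def)
  have xsQ: "keys x \<subseteq> Q" if "x \<in> set xs" for x
  proof -
    obtain i where "i < n" "x = F i" using \<open>x \<in> set xs\<close> by (auto simp: xs_def)
    then show ?thesis using F[of i] by simp
  qed
  define m where "m = Max (insert 0 (deg_on X ` (\<Union>x\<in>set xs. keys x)))"
  have xsm: "keys x \<subseteq> deg_le m" if "x \<in> set xs" for x
  proof
    fix t assume t: "t \<in> keys x"
    then have "deg_on X t \<le> m" unfolding m_def by (intro Max_ge) (use that in auto)
    then show "t \<in> deg_le m" using xsQ[OF that] t by (auto simp: deg_le_def)
  qed
  have bound: "N ^ n \<le> (n * N * m + 1) ^ d" for N
  proof -
    have "card (exponent_lists N n) \<le> card (deg_le (n * N * m))"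
    proof (rule card_le_of_independent[where F = "power_product xs"])
      show "finite (exponent_lists N n)" by (rule finite_lists_length_eq) simp
      show "finite (deg_le (n * N * m))" by (rule card_deg_le)
      fix as assume as: "as \<in> exponent_lists N n"
      have "set bs \<subseteq> {..<N} \<Longrightarrow> sum_list bs \<le> length bs * N" for bs
        by (induction bs) auto
      then have "sum_list as \<le> length as * N" using as by blast
      then have "sum_list as * m \<le> n * N * m" using as by (intro mult_right_mono) auto
      moreover have "keys (power_product xs as) \<subseteq> deg_le (sum_list as * m)"
        using as len by (intro keys_power_product_deg_le xsm) auto
      ultimately show "keys (power_product xs as) \<subseteq> deg_le (n * N * m)"
        using deg_le_mono by blast
    next
      fix c :: "nat list \<Rightarrow> 'k" and as
      assume zero: "(\<Sum>as\<in>exponent_lists N n. single 0 (c as) * power_product xs as) = 0"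
        and as: "as \<in> exponent_lists N n"
      show "c as = 0"
      proof (rule prime_chain_independent[where xs = xs and P = P and N = N])
        have "LR.is_ideal (P 0)" using prime[of 0] by (simp add: LR.is_prime_def)
        then show "emb (\<Sum>as\<in>exponent_lists N (length xs). single 0 (c as) * power_product xs as) \<in> P 0"
          unfolding len zero emb_simps by (rule LR.is_idealD(2))
        show "emb (xs ! i) \<in> P (Suc i) - P i" if "i < length xs" for i
          using F[of i] that len by (simp add: xs_def)
        show "P i \<subseteq> P (Suc i)" if "i < length xs" for i using strict[of i] that len by auto
      qed (use prime xsQ as len in auto)
    qed
    also have "\<dots> \<le> (n * N * m + 1) ^ d" unfolding d_def by (rule card_deg_le)
    finally show ?thesis by (simp add: card_lists_length_eq)
  qed
  define C where "C = (n * m + 1) ^ d"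
  define N where "N = C + 1"
  have N: "N \<ge> 1" by (simp add: N_def)
  have "N ^ d * N ^ (n - d) = N ^ n" using nd by (simp add: power_add[symmetric])
  also have "\<dots> \<le> (n * N * m + 1) ^ d" by (rule bound)
  also have "\<dots> \<le> (N * (n * m + 1)) ^ d" using N by (intro power_mono) (simp_all add: algebra_simps)
  also have "\<dots> = N ^ d * C" unfolding C_def by (rule power_mult_distrib)
  finally have "N ^ (n - d) \<le> C" using N by simp
  moreover have "N ^ 1 \<le> N ^ (n - d)" using N nd by (intro power_increasing) auto
  ultimately show False by (simp add: N_def)
qed

text \<open>
  The exponents of the monomials divisible by some variable from \<open>V\<close>.
\<close>

definition meeting :: "nat set \<Rightarrow> expv set" where
  "meeting V = {t \<in> Q. keys t \<inter> V \<noteq> {}}"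

lemma monoid_ideal_meeting: "monoid_ideal (meeting V)"
  using add_Q by (auto simp: monoid_ideal_def meeting_def keys_add_expv)

text \<open>
  Modulo the monomials meeting \<open>V\<close>, a polynomial may be replaced by the nonzero sum \<open>res\<close>
  of its terms that avoid \<open>V\<close>; the product of two such sums is nonzero and avoids \<open>V\<close>
  again.
\<close>

lemma keys_mult_not_meeting:
  fixes f g :: "'k::field poly_ring"
  assumes f: "keys f \<subseteq> Q" "\<not> keys f \<subseteq> meeting V"
    and g: "keys g \<subseteq> Q" "\<not> keys g \<subseteq> meeting V"
  shows "\<not> keys (f * g) \<subseteq> meeting V"
proof
  assume fg: "keys (f * g) \<subseteq> meeting V"
  define res where "res h = Poly_Mapping.mapp (\<lambda>t c. if t \<in> meeting V then 0 else c) h" for h :: "'k poly_ring"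
  have lres: "lookup (res h) t = (if t \<in> meeting V then 0 else lookup h t)" for h t
    by (simp add: res_def lookup_mapp when_def in_keys_iff)
  have res_nz: "res h \<noteq> 0" if "\<not> keys h \<subseteq> meeting V" for h
  proof -
    obtain t where t: "t \<in> keys h" "t \<notin> meeting V" using \<open>\<not> keys h \<subseteq> meeting V\<close> by blast
    then have "lookup (res h) t \<noteq> 0" by (simp add: lres in_keys_iff)
    then show ?thesis by auto
  qed
  have keys_res: "keys (res h) \<subseteq> Q - meeting V" if "keys h \<subseteq> Q" for h
    using that by (auto simp: in_keys_iff lres split: if_splits)
  have keys_diff: "keys (h - res h) \<subseteq> meeting V" for h
    by (auto simp: in_keys_iff lres lookup_minus split: if_splits)
  have "res f * res g \<noteq> 0" using res_nz[OF f(2)] res_nz[OF g(2)] by simp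
  then obtain t where t: "t \<in> keys (res f * res g)" by fastforce
  have t_not: "t \<notin> meeting V"
  proof -
    obtain a b where ab: "t = a + b" "a \<in> keys (res f)" "b \<in> keys (res g)"
      using t keys_mult[of "res f" "res g"] by blast
    then have "a \<in> Q - meeting V" "b \<in> Q - meeting V" using keys_res[OF f(1)] keys_res[OF g(1)] by blast+
    then show ?thesis by (auto simp: ab(1) meeting_def keys_add_expv)
  qed
  have resgQ: "keys (res f) \<subseteq> Q" using keys_res[OF f(1)] by blast
  have "f * g = (f - res f) * g + res f * (g - res g) + res f * res g" by (simp add: algebra_simps)
  moreover have "t \<notin> keys ((f - res f) * g)"
    using keys_mult_monoid_ideal(1)[OF monoid_ideal_meeting keys_diff g(1)] t_not by blast
  moreover have "t \<notin> keys (res f * (g - res g))"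
    using keys_mult_monoid_ideal(2)[OF monoid_ideal_meeting keys_diff resgQ] t_not by blast
  ultimately have "lookup (f * g) t = lookup (res f * res g) t"
    by (simp add: in_keys_iff lookup_add)
  then have "t \<in> keys (f * g)" using t by (simp add: in_keys_iff)
  then show False using fg t_not by blast
qed

lemma is_prime_meeting: "LR.is_prime (loc (meeting V) :: 'k::field poly_ring fract set)"
  unfolding LR.is_prime_def
proof (intro conjI ballI impI)
  show "LR.is_ideal (loc (meeting V) :: 'k poly_ring fract set)" by (rule is_ideal_loc[OF monoid_ideal_meeting])
  have "monom_fract 0 = (1 :: 'k poly_ring fract)" by (simp add: monom_fract_def One_fract_def)
  moreover have "0 \<notin> meeting V" by (simp add: meeting_def)
  ultimately show "(1 :: 'k poly_ring fract) \<notin> loc (meeting V)" by (metis monom_fract_in_loc_iff)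
  fix x y :: "'k poly_ring fract" assume x: "x \<in> loc Q" and y: "y \<in> loc Q" and xy: "x * y \<in> loc (meeting V)"
  obtain f g :: "'k poly_ring" where xfg: "x = Fract f g" and f: "keys f \<subseteq> Q"
    and g: "keys g \<subseteq> Q" "lookup g 0 \<noteq> 0" "g \<noteq> 0" by (rule locE[OF x])
  obtain f' g' :: "'k poly_ring" where yfg: "y = Fract f' g'" and f': "keys f' \<subseteq> Q"
    and g': "keys g' \<subseteq> Q" "lookup g' 0 \<noteq> 0" "g' \<noteq> 0" by (rule locE[OF y])
  obtain h k :: "'k poly_ring" where hk: "x * y = Fract h k" and h: "keys h \<subseteq> meeting V"
    and k: "keys k \<subseteq> Q" "lookup k 0 \<noteq> 0" "k \<noteq> 0" by (rule locE[OF xy])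
  have eq: "f * f' * k = h * (g * g')" using hk g g' k by (simp add: xfg yfg eq_fract)
  have "keys (f * f' * k) \<subseteq> meeting V"
    unfolding eq by (rule keys_mult_monoid_ideal(1)[OF monoid_ideal_meeting h keys_mult_Q[OF g(1) g'(1)]])
  moreover have "\<not> keys k \<subseteq> meeting V"
  proof -
    have "0 \<in> keys k" using k by (simp add: in_keys_iff)
    then show ?thesis by (auto simp: meeting_def)
  qed
  ultimately have "keys f \<subseteq> meeting V \<or> keys f' \<subseteq> meeting V"
    using keys_mult_not_meeting[OF keys_mult_Q[OF f f'] _ k(1)] keys_mult_not_meeting[OF f _ f'] by blast
  then show "x \<in> loc (meeting V) \<or> y \<in> loc (meeting V)"
    unfolding xfg yfg using locI[OF _ g(1,2)] locI[OF _ g'(1,2)] by blast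
qed

lemma krull_dim_segre: "krull_dim (segre_local_ring r s :: 'k::field poly_ring fract ring) = enat (r + s - 1)"
proof -
  define d where "d = r + s - 1"
  \<comment> \<open>Kill the variables with indices \<open>1\<close> to \<open>i\<close>. The variable with index \<open>0\<close>, an \<open>x\<close>, is
  never killed: killing the last \<open>y\<close> already gives the maximal ideal.\<close>
  define P where "P i = (loc (meeting {1..i}) :: 'k poly_ring fract set)" for i :: nat
  have strict: "P i \<subset> P (Suc i)" if "i < d" for i
  proof -
    \<comment> \<open>A monomial containing the variable to be killed next and otherwise only one that is
    still alive.\<close>
    define t where "t = (if Suc i < r then pair (Suc i) d else pair 0 (Suc i))"
    have keys: "keys t = (if Suc i < r then {Suc i, d} else {0, Suc i})"
      by (auto simp: t_def pair_def keys_add_expv)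
    have "t \<in> Q" unfolding t_def using that r2 s2 by (auto simp: d_def intro!: pair_in_Q)
    then have "t \<in> meeting {1..Suc i}" "t \<notin> meeting {1..i}"
      using that by (auto simp: meeting_def keys)
    then have "monom_fract t \<in> P (Suc i)" "monom_fract t \<notin> P i"
      by (simp_all add: P_def monom_fract_in_loc_iff)
    moreover have "P i \<subseteq> P (Suc i)" unfolding P_def by (rule loc_subset) (auto simp: meeting_def)
    ultimately show ?thesis by blast
  qed
  have ex: "\<exists>P :: nat \<Rightarrow> 'k poly_ring fract set. (\<forall>i\<le>d. primeideal (P i) LR.R) \<and> (\<forall>i<d. P i \<subset> P (Suc i))"
    by (rule exI[of _ P]) (use strict in \<open>auto simp: LR.primeideal_iff P_def is_prime_meeting\<close>)
  have le: "n \<le> d" if "\<forall>i\<le>n. primeideal (P i) LR.R" "\<forall>i<n. P i \<subset> P (Suc i)"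
    for n and P :: "nat \<Rightarrow> 'k poly_ring fract set"
    unfolding d_def by (rule prime_chain_length_le[of n P]) (use that in \<open>auto simp: LR.primeideal_iff\<close>)
  show ?thesis
    unfolding krull_dim_def segre_local_ring_eq d_def[symmetric]
  proof (rule antisym)
    show "Sup {enat n |n. \<exists>P :: nat \<Rightarrow> 'k poly_ring fract set. (\<forall>i\<le>n. primeideal (P i) LR.R) \<and> (\<forall>i<n. P i \<subset> P (Suc i))} \<le> enat d"
      by (rule Sup_least) (use le in auto)
    show "enat d \<le> Sup {enat n |n. \<exists>P :: nat \<Rightarrow> 'k poly_ring fract set. (\<forall>i\<le>n. primeideal (P i) LR.R) \<and> (\<forall>i<n. P i \<subset> P (Suc i))}"
      by (rule Sup_upper) (use ex in blast)
  qed
qed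

end

section \<open>Hilbert-Kunz multiplicities\<close>

context local_subring
begin

text \<open>
  The image of the residue field in \<open>E\<close> is nonzero and lies in the socle, so the socle is
  not spanned by zero.
\<close>

lemma socle_generator_nonzero:
  assumes hull: "injective_hull R (quotient_module R \<mm>) E" and z: "socle_generator R E z"
  shows "z \<in> carrier E" "z \<noteq> \<zero>\<^bsub>E\<^esub>" "\<And>a. a \<in> \<mm> \<Longrightarrow> a \<odot>\<^bsub>E\<^esub> z = \<zero>\<^bsub>E\<^esub>"
proof -
  obtain \<iota> where lin: "linear_map R (quotient_module R \<mm>) E \<iota>"
    and inj: "inj_on \<iota> (carrier (quotient_module R \<mm>))"
    using hull by (auto simp: injective_hull_def)
  interpret E: module R E using hull by (simp add: injective_hull_def injective_module_def)
  have soc: "z \<in> socle R E" "socle R E = (\<lambda>a. a \<odot>\<^bsub>E\<^esub> z) ` B"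
    using z by (auto simp: socle_generator_def)
  show "z \<in> carrier E" "\<And>a. a \<in> \<mm> \<Longrightarrow> a \<odot>\<^bsub>E\<^esub> z = \<zero>\<^bsub>E\<^esub>"
    using soc(1) by (auto simp: socle_def max_ideal_R)
  define u where "u = \<mm> +>\<^bsub>R\<^esub> 1"
  have coset: "\<mm> +>\<^bsub>R\<^esub> a \<in> carrier (quotient_module R \<mm>)" if "a \<in> B" for a
    using quotient_hom(1)[OF is_ideal_mm that that] by (simp add: quotient_module_simps)
  have smult_u: "a \<odot>\<^bsub>quotient_module R \<mm>\<^esub> u = \<mm> +>\<^bsub>R\<^esub> a" if "a \<in> B" for a
    using quotient_hom(3)[OF is_ideal_mm that one_in] by (simp add: quotient_module_def u_def)
  have u: "u \<in> carrier (quotient_module R \<mm>)" unfolding u_def by (rule coset[OF one_in])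
  have iu: "\<iota> u \<in> carrier E" using lin u by (auto simp: linear_map_def)
  have \<iota>_coset: "\<iota> (\<mm> +>\<^bsub>R\<^esub> a) = a \<odot>\<^bsub>E\<^esub> \<iota> u" if "a \<in> B" for a
  proof -
    have "\<forall>b\<in>carrier R. \<forall>x\<in>carrier (quotient_module R \<mm>).
        \<iota> (b \<odot>\<^bsub>quotient_module R \<mm>\<^esub> x) = b \<odot>\<^bsub>E\<^esub> \<iota> x"
      using lin unfolding linear_map_def by (elim conjE)
    from this[rule_format, OF _ u, of a] show ?thesis using that by (simp add: smult_u)
  qed
  have \<iota>_zero: "\<iota> (\<mm> +>\<^bsub>R\<^esub> 0) = \<zero>\<^bsub>E\<^esub>"
    using \<iota>_coset[OF zero_in] E.smult_l_null[OF iu] by simp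
  have "a \<odot>\<^bsub>E\<^esub> \<iota> u = \<zero>\<^bsub>E\<^esub>" if "a \<in> \<mm>" for a
  proof -
    have aB: "a \<in> B" using that mm_subset by auto
    have "\<mm> +>\<^bsub>R\<^esub> a = \<mm> +>\<^bsub>R\<^esub> 0" using quotient_coset_eq[OF is_ideal_mm aB zero_in] that by simp
    then show ?thesis using \<iota>_coset[OF aB] \<iota>_zero by simp
  qed
  then have iu_soc: "\<iota> u \<in> socle R E" using iu by (simp add: socle_def max_ideal_R)
  show "z \<noteq> \<zero>\<^bsub>E\<^esub>"
  proof
    assume z0: "z = \<zero>\<^bsub>E\<^esub>"
    obtain a where "a \<in> B" "\<iota> u = a \<odot>\<^bsub>E\<^esub> z" using iu_soc unfolding soc(2) by blast
    then have "\<iota> u = \<zero>\<^bsub>E\<^esub>" using E.smult_r_null[of a] by (simp add: z0)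
    then have "u = \<mm> +>\<^bsub>R\<^esub> 0"
      using inj_onD[OF inj _ u coset[OF zero_in]] \<iota>_zero by simp
    then have "1 - 0 \<in> \<mm>" using quotient_coset_eq[OF is_ideal_mm one_in zero_in] by (simp add: u_def)
    then show False using one_notin_mm by simp
  qed
qed

end

theorem theorem5p6:
  fixes r s d p :: nat
    and A :: "'k::field poly_ring fract ring"
    and E :: "('k poly_ring fract, 'e) module"
    and z :: 'e
  assumes "perfect_char TYPE('k) p"
    and "2 \<le> r" and "r \<le> s"
    and "d = r + s - 1"
    and "A = segre_local_ring r s"
    and "injective_hull A (quotient_module A (max_ideal A)) E"
    and "socle_generator A E z"
  shows "m_HK p A E z =
           ereal (fact r / fact d * real (Stirling d r)
             + 1 / fact d * (\<Sum>k=1..r - 1. \<Sum>j=1..r - k.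
                 real (r choose (k + j)) * real (s choose j) * (-1) ^ (r + k) * real k ^ d))
         \<and> e_HK p A + m_HK p A E z =
           ereal ((fact r * real (Stirling d r) + fact s * real (Stirling d s)) / fact d)"
proof -
  interpret segre r s using assms(2,3) by unfold_locales auto
  define x where "x = fact r * real (Stirling d r) / fact d"
  define y where "y = fact s * real (Stirling d s) / fact d"
  define m where "m = alternating_sum (r + s) r d / fact d"
  have A: "A = field_subring (loc Q)" using assms(5) by (simp add: segre_local_ring_eq)
  have max: "max_ideal A = loc (Q - {0})" unfolding assms(5) by (rule max_ideal_segre)
  have dim: "the_enat (krull_dim A) = d" unfolding assms(5) krull_dim_segre by (simp add: assms(4))
  have inj: "injective_module (field_subring (loc Q)) E" using assms(6) by (simp add: injective_hull_def A)
  note z = LR.socle_generator_nonzero[OF assms(6)[unfolded max, unfolded A] assms(7)[unfolded A]]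
  have frob_locale: "segre_frobenius TYPE('k) r s p"
    using assms(1) by (intro segre_frobenius.intro segre_axioms perfect_frobenius.intro)
  have frob: "frobenius_power A (max_ideal A) (p ^ e) = loc (frob_exps (p ^ e))" for e
    unfolding max unfolding A by (rule segre_frobenius.frobenius_power_max[OF frob_locale])
  have ann: "annihilator A (frobenius_functor A p e E) (frobenius_map A p e E z) = loc (large_exps (p ^ e))" for e
    unfolding A by (rule segre_frobenius.ann_socle_eq[OF frob_locale inj z])
  have p: "p > 1" using perfect_char_prime(1)[OF assms(1)] by (rule prime_gt_1_nat)
  then have q: "filterlim (\<lambda>e. p ^ e) sequentially sequentially"
    by (intro filterlim_subseq strict_monoI power_strict_increasing)
  have len_large: "module_length A (quotient_module A (loc (large_exps q)))
     = enat (card (small_exps (X \<union> Y) q))" for q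
    using length_loc[OF monoid_ideal_large_exps, of q] finite_small_exps[of "X \<union> Y" q]
    unfolding A complement_large_exps by simp
  have len_frob: "module_length A (quotient_module A (loc (frob_exps q)))
     = enat (card (Q - frob_exps q))" for q
    using length_loc[OF monoid_ideal_frob_exps, of q] finite_small_exps[of X q] finite_small_exps[of Y q]
    unfolding A complement_frob_exps by simp
  note lims = tendsto_card_small_exps[folded assms(4), folded x_def y_def m_def]
  have "(\<lambda>q. real (card (Q - frob_exps q)) / real q ^ d) \<longlonglongrightarrow> x + y - m"
    unfolding card_complement_frob_exps add_divide_distrib diff_divide_distrib
    by (intro tendsto_add tendsto_diff lims)
  from filterlim_compose[OF this q]
  have "(\<lambda>e. ereal (real (card (Q - frob_exps (p ^ e))) / real (p ^ e) ^ d)) \<longlonglongrightarrow> ereal (x + y - m)"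
    by simp
  then have e: "e_HK p A = ereal (x + y - m)"
    unfolding e_HK_def frob len_frob dim
    by (intro limI) (use p in \<open>simp add: power_mult[symmetric] mult.commute\<close>)
  from filterlim_compose[OF lims(3) q]
  have "(\<lambda>e. ereal (real (card (small_exps (X \<union> Y) (p ^ e))) / real (p ^ e) ^ d)) \<longlonglongrightarrow> ereal m"
    by simp
  then have m: "m_HK p A E z = ereal m"
    unfolding m_HK_def ann len_large dim
    by (intro lim_imp_Liminf) (use p in \<open>simp_all add: power_mult[symmetric]\<close>)
  have "d > 0" using assms(2,4) by simp
  then have "m = fact r / fact d * real (Stirling d r)
     + 1 / fact d * (\<Sum>k=1..r - 1. \<Sum>j=1..r - k.
         real (r choose (k + j)) * real (s choose j) * (-1) ^ (r + k) * real k ^ d)"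
    unfolding m_def by (simp add: alternating_sum_Vandermonde alternating_sum_Stirling add_divide_distrib)
  then show ?thesis
    unfolding m e by (simp add: x_def y_def add_divide_distrib)
qed

end
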